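(* For every $n\ge 6$ there are an integer $e$ and a sequence $b_\bullet$ such that $\operatorname{M}_e(b_\bullet)\subset\operatorname{Mor}_e(\mathbb{P}^1,\mathbb{P}^n)$ is nonempty and its expected codimension is larger than the dimension of $\operatorname{Mor}_e(\mathbb{P}^1,\mathbb{P}^n)$. In particular, when $n\ge 6$ and $(n-2)(2e-2n-1)\ge (e+1)(n+1)$, the locus $\operatorname{M}_e(b_\bullet(2^{n-2}))$ is nonempty even though its expected dimension is negative.
   Context: We work over an algebraically closed field of characteristic zero. $\operatorname{Mor}_e(\mathbb{P}^1,\mathbb{P}^n)$ is the scheme of degree $e$ morphisms $f:\mathbb{P}^1\to\mathbb{P}^n$; it is irreducible of dimension $(n+1)(e+1)-1$. A morphism $f$ is nondegenerate if its image lies in no hyperplane, and unramified if $f^*\Omega_{\mathbb{P}^n}\to\Omega_{\mathbb{P}^1}$ is surjective; then the normal bundle $N_f$, defined by $0\to T_{\mathbb{P}^1}\to f^*T_{\mathbb{P}^n}\to N_f\to 0$, is a vector bundle of rank $n-1$ and degree $e(n+1)-2$. For integers $1<b_1\le\dots\le b_{n-1}$ with $\sum_i b_i=2e-2$, $\operatorname{M}_e(b_\bullet)$ denotes the locally closed locus in $\operatorname{Mor}_e(\mathbb{P}^1,\mathbb{P}^n)$ of nondegenerate, unramified morphisms $f$, birational onto their image, with $N_f\cong\bigoplus_{i=1}^{n-1}\mathcal{O}_{\mathbb{P}^1}(e+b_i)$. Its expected codimension is $h^1(\mathbb{P}^1,\operatorname{End}(E))$ where $E=\bigoplus_i\mathcal{O}(e+b_i)$,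 and its expected dimension is $(e+1)(n+1)-1-h^1(\mathbb{P}^1,\operatorname{End}(E))$. The sequence $b_\bullet(2^{n-2})$ is $b_1=\dots=b_{n-2}=2$, $b_{n-1}=2e-2-2(n-2)=2e-2n+2$; that is, $N_f\cong\mathcal{O}(e+2)^{n-2}\oplus\mathcal{O}(3e-2n+2)$. *)

theory Defs
  imports
    "HOL-Analysis.Abstract_Topology"
    "HOL-Analysis.Function_Topology"
    "HOL-Computational_Algebra.Computational_Algebra"
    "HOL-Library.Function_Algebras"
    "HOL-Library.Poly_Mapping"
    "HOL-Library.Extended_Nat"
begin

section \<open>The projective line: forms, function field, local rings\<close>

text \<open>
  The ground field is a type of class \<open>alg_closed_field\<close> and \<open>field_char_0\<close>.
  A point \<open>[s:t]\<close> of the projective line is given by homogeneous coordinates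
  \<open>(s, t) \<noteq> (0, 0)\<close>; everything below depends only on the class up to scaling.
  A binary form of degree \<open>d\<close> is given by its dehomogenisation, a polynomial \<open>P\<close> in
  \<open>x = t/s\<close> with \<open>degree P \<le> d\<close>, standing for \<open>s^d P(t/s)\<close>.
  The function field is \<open>K = k(x)\<close>.
\<close>

type_synonym 'a ratfun = "'a poly fract"

definition P1 :: "('a::field \<times> 'a) set" where
  "P1 = {p. p \<noteq> (0, 0)}"

definition form_eval :: "nat \<Rightarrow> 'a::field poly \<Rightarrow> 'a \<times> 'a \<Rightarrow> 'a" where
  "form_eval d P p = (\<Sum>j\<le>d. coeff P j * fst p ^ (d - j) * snd p ^ j)"

abbreviation const :: "'a::field \<Rightarrow> 'a ratfun" where
  "const c \<equiv> Fract [:c:] 1"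

text \<open>
  The stalk of \<open>\<O>(m)\<close> at \<open>p\<close>: quotients \<open>A/B\<close> of forms with \<open>deg A - deg B = m\<close> and
  \<open>B(p) \<noteq> 0\<close>. Dividing by the rational section \<open>s^m\<close> embeds all stalks in \<open>K\<close>.
\<close>

definition O_stalk :: "int \<Rightarrow> 'a::field \<times> 'a \<Rightarrow> 'a ratfun set" where
  "O_stalk m p = {Fract A B | A B. \<exists>a b. int a = int b + m \<and>
     degree A \<le> a \<and> degree B \<le> b \<and> form_eval b B p \<noteq> 0}"

abbreviation local_ring :: "'a::field \<times> 'a \<Rightarrow> 'a ratfun set" where
  "local_ring \<equiv> O_stalk 0"


section \<open>Vector bundles on the projective line\<close>

text \<open>
  A vector bundle \<open>E\<close> on the (integral) curve \<open>P1\<close> is given by its generic stalk, a finite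
  dimensional \<open>K\<close>-vector space, together with the stalks \<open>E p\<close> inside the generic stalk;
  sections over a nonempty open set \<open>U\<close> are the elements lying in \<open>E p\<close> for all \<open>p \<in> U\<close>.
  Homomorphisms of bundles are the \<open>K\<close>-linear maps of generic stalks mapping stalks to stalks,
  and exactness of a sequence of sheaves is exactness on all stalks.
\<close>

definition sections :: "('p \<Rightarrow> 'v set) \<Rightarrow> 'p set \<Rightarrow> 'v set" where
  "sections E U = (\<Inter>p\<in>U. E p)"

text \<open>
  The direct sum of the \<open>\<O>(d)\<close>, \<open>d\<close> running through the list \<open>ds\<close>, with generic stalk
  \<open>K^r\<close> (\<open>r = length ds\<close>), and its endomorphism bundle, with generic stalk the
  \<open>r \<times> r\<close> matrices over \<open>K\<close>. Vectors and matrices are functions vanishing out of range.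
\<close>

definition sum_stalk :: "int list \<Rightarrow> 'a::field \<times> 'a \<Rightarrow> (nat \<Rightarrow> 'a ratfun) set" where
  "sum_stalk ds p = {v. (\<forall>i<length ds. v i \<in> O_stalk (ds ! i) p) \<and> (\<forall>i\<ge>length ds. v i = 0)}"

definition End_stalk :: "int list \<Rightarrow> 'a::field \<times> 'a \<Rightarrow> (nat \<Rightarrow> nat \<Rightarrow> 'a ratfun) set" where
  "End_stalk ds p = {A. (\<forall>i j. i \<ge> length ds \<or> j \<ge> length ds \<longrightarrow> A i j = 0) \<and>
     (\<forall>v\<in>sum_stalk ds p. (\<lambda>i. \<Sum>j<length ds. A i j * v j) \<in> sum_stalk ds p)}"

text \<open>
  The dimension of the quotient \<open>V / W\<close> of vector spaces \<open>W \<subseteq> V\<close>: the cardinality of a family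
  in \<open>V\<close> whose residue classes form a basis.
\<close>

definition quotient_basis ::
    "('k::field \<Rightarrow> 'v::ab_group_add \<Rightarrow> 'v) \<Rightarrow> 'v set \<Rightarrow> 'v set \<Rightarrow> 'v set \<Rightarrow> bool" where
  "quotient_basis scl V W B \<longleftrightarrow> B \<subseteq> V \<and> V \<subseteq> module.span scl (W \<union> B) \<and>
     (\<forall>b\<in>B. b \<notin> module.span scl (W \<union> (B - {b})))"

definition quotient_dim ::
    "('k::field \<Rightarrow> 'v::ab_group_add \<Rightarrow> 'v) \<Rightarrow> 'v set \<Rightarrow> 'v set \<Rightarrow> nat" where
  "quotient_dim scl V W = card (SOME B. quotient_basis scl V W B)"

text \<open>
  \<open>h\<^sup>1\<close> as the dimension of Cech cohomology for the affine cover by \<open>s \<noteq> 0\<close> and \<open>t \<noteq> 0\<close>.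
\<close>

definition cech_h1 ::
    "('a::field \<Rightarrow> 'v::ab_group_add \<Rightarrow> 'v) \<Rightarrow> ('a \<times> 'a \<Rightarrow> 'v set) \<Rightarrow> nat" where
  "cech_h1 scl E =
    (let U0 = {p. fst p \<noteq> 0}; U1 = {p. snd p \<noteq> 0}
     in quotient_dim scl (sections E (U0 \<inter> U1))
          {u + v | u v. u \<in> sections E U0 \<and> v \<in> sections E U1})"

definition h1_End :: "'a::field itself \<Rightarrow> int list \<Rightarrow> nat" where
  "h1_End _ ds =
     cech_h1 (\<lambda>(c::'a) A i j. const c * A i j) (End_stalk ds)"


section \<open>Morphisms to projective space\<close>

text \<open>
  A morphism of degree \<open>e\<close> to projective \<open>n\<close>-space is a tuple \<open>(F 0, \<dots>, F n)\<close> of forms of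
  degree \<open>e\<close> without common zero, up to scaling.
\<close>

definition mor_tuple :: "nat \<Rightarrow> nat \<Rightarrow> (nat \<Rightarrow> 'a::field poly) \<Rightarrow> bool" where
  "mor_tuple n e F \<longleftrightarrow> (\<forall>i\<le>n. degree (F i) \<le> e) \<and> (\<forall>i>n. F i = 0) \<and>
     (\<forall>p\<in>P1. \<exists>i\<le>n. form_eval e (F i) p \<noteq> 0)"

definition scaling_class :: "(nat \<Rightarrow> 'a::field poly) \<Rightarrow> (nat \<Rightarrow> 'a poly) set" where
  "scaling_class F = {\<lambda>i. smult c (F i) | c. c \<noteq> 0}"

definition Mor :: "nat \<Rightarrow> nat \<Rightarrow> (nat \<Rightarrow> 'a::field poly) set set" where
  "Mor n e = scaling_class ` {F. mor_tuple n e F}"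

definition nondegenerate :: "nat \<Rightarrow> nat \<Rightarrow> (nat \<Rightarrow> 'a::field poly) \<Rightarrow> bool" where
  "nondegenerate n e F \<longleftrightarrow>
     (\<forall>c. (\<exists>i\<le>n. c i \<noteq> 0) \<longrightarrow> (\<exists>p\<in>P1. (\<Sum>i\<le>n. c i * form_eval e (F i) p) \<noteq> 0))"

text \<open>
  \<open>coord F i j\<close> is the pullback of the affine coordinate \<open>x\<^sub>j / x\<^sub>i\<close> on the chart
  \<open>x\<^sub>i \<noteq> 0\<close> of projective space; only used when \<open>F i \<noteq> 0\<close>.
\<close>

abbreviation coord :: "(nat \<Rightarrow> 'a::field poly) \<Rightarrow> nat \<Rightarrow> nat \<Rightarrow> 'a ratfun" where
  "coord F i j \<equiv> Fract (F j) (F i)"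

text \<open>
  Birational onto the image: pullback identifies the function field of the image, i.e. the
  subfield of \<open>K\<close> generated over \<open>k\<close> by the coordinate functions, with all of \<open>K\<close>.
\<close>

definition is_subfield :: "'b::field set \<Rightarrow> bool" where
  "is_subfield L \<longleftrightarrow> 0 \<in> L \<and> 1 \<in> L \<and>
     (\<forall>g\<in>L. \<forall>h\<in>L. g - h \<in> L \<and> g * h \<in> L \<and> inverse g \<in> L)"

definition image_function_field :: "nat \<Rightarrow> (nat \<Rightarrow> 'a::field poly) \<Rightarrow> 'a ratfun set" where
  "image_function_field n F = \<Inter>{L. is_subfield L \<and> range const \<subseteq> L \<and>
     (\<forall>i\<le>n. \<forall>j\<le>n. F i \<noteq> 0 \<longrightarrow> coord F i j \<in> L)}"

definition birational_onto_image :: "nat \<Rightarrow> (nat \<Rightarrow> 'a::field poly) \<Rightarrow> bool" where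
  "birational_onto_image n F \<longleftrightarrow> image_function_field n F = UNIV"


section \<open>Vector fields, differentials, normal bundle\<close>

definition Der :: "('a::field ratfun \<Rightarrow> 'a ratfun) set" where
  "Der = {\<theta>. (\<forall>g h. \<theta> (g + h) = \<theta> g + \<theta> h) \<and>
     (\<forall>g h. \<theta> (g * h) = g * \<theta> h + h * \<theta> g) \<and> (\<forall>c. \<theta> (const c) = 0)}"

text \<open>
  The tangent sheaf of the projective line: derivations of \<open>K\<close> over \<open>k\<close> that preserve the
  local ring.
\<close>

definition tangent_stalk :: "'a::field \<times> 'a \<Rightarrow> ('a ratfun \<Rightarrow> 'a ratfun) set" where
  "tangent_stalk p = {\<theta>\<in>Der. \<theta> ` local_ring p \<subseteq> local_ring p}"

text \<open>
  Rational Kaehler differentials of \<open>K\<close> over \<open>k\<close> form the \<open>K\<close>-dual of \<open>Der\<close>; the stalk of the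
  cotangent sheaf at \<open>p\<close> is generated over the local ring by the \<open>dh\<close> with \<open>h\<close> regular
  at \<open>p\<close>.
\<close>

definition differential :: "'a::field ratfun \<Rightarrow> ('a ratfun \<Rightarrow> 'a ratfun) \<Rightarrow> 'a ratfun" where
  "differential h = (\<lambda>\<theta>. if \<theta> \<in> Der then \<theta> h else 0)"

definition generated_submodule :: "'b::field set \<Rightarrow> ('c \<Rightarrow> 'b) set \<Rightarrow> ('c \<Rightarrow> 'b) set" where
  "generated_submodule R S =
     {\<lambda>\<theta>. \<Sum>\<omega>\<in>T. r \<omega> * \<omega> \<theta> | T r. finite T \<and> T \<subseteq> S \<and> r ` T \<subseteq> R}"

definition cotangent_stalk ::
    "'a::field \<times> 'a \<Rightarrow> (('a ratfun \<Rightarrow> 'a ratfun) \<Rightarrow> 'a ratfun) set" where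
  "cotangent_stalk p = generated_submodule (local_ring p) (differential ` local_ring p)"

text \<open>
  Surjectivity on stalks of the map from the pulled back cotangent sheaf. At \<open>p\<close> mapping into
  the chart \<open>x\<^sub>i \<noteq> 0\<close> the source is free on the \<open>d(x\<^sub>j / x\<^sub>i)\<close>, \<open>j \<noteq> i\<close>; the
  additional index \<open>j = i\<close> contributes \<open>d1 = 0\<close>.
\<close>

definition unramified :: "nat \<Rightarrow> nat \<Rightarrow> (nat \<Rightarrow> 'a::field poly) \<Rightarrow> bool" where
  "unramified n e F \<longleftrightarrow> (\<forall>p\<in>P1. \<forall>i\<le>n. form_eval e (F i) p \<noteq> 0 \<longrightarrow>
     generated_submodule (local_ring p) ((\<lambda>j. differential (coord F i j)) ` {..n}) =
       cotangent_stalk p)"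

text \<open>
  The pulled back tangent bundle of projective space. Over the preimage of the chart
  \<open>x\<^sub>i \<noteq> 0\<close> it has the basis \<open>\<partial>/\<partial>(x\<^sub>j / x\<^sub>i)\<close>, \<open>j \<noteq> i\<close>, and \<open>w i j\<close> is the corresponding
  coefficient. The coefficients in different charts are related by the Jacobian of the
  coordinate change
  \<open>x\<^sub>j/x\<^sub>l = (x\<^sub>j/x\<^sub>i) / (x\<^sub>l/x\<^sub>i)\<close>.
\<close>

definition pullback_tangent_generic ::
    "nat \<Rightarrow> (nat \<Rightarrow> 'a::field poly) \<Rightarrow> (nat \<Rightarrow> nat \<Rightarrow> 'a ratfun) set" where
  "pullback_tangent_generic n F = {w.
     (\<forall>i j. i > n \<or> j > n \<or> F i = 0 \<longrightarrow> w i j = 0) \<and> (\<forall>i. w i i = 0) \<and>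
     (\<forall>i\<le>n. \<forall>l\<le>n. \<forall>j\<le>n. F i \<noteq> 0 \<and> F l \<noteq> 0 \<longrightarrow>
        w l j = w i j / coord F i l - coord F i j * w i l / (coord F i l)\<^sup>2)}"

definition pullback_tangent_stalk ::
    "nat \<Rightarrow> nat \<Rightarrow> (nat \<Rightarrow> 'a::field poly) \<Rightarrow> 'a \<times> 'a \<Rightarrow> (nat \<Rightarrow> nat \<Rightarrow> 'a ratfun) set" where
  "pullback_tangent_stalk n e F p = {w\<in>pullback_tangent_generic n F.
     \<forall>i\<le>n. form_eval e (F i) p \<noteq> 0 \<longrightarrow> (\<forall>j\<le>n. w i j \<in> local_ring p)}"

definition tangent_map ::
    "nat \<Rightarrow> (nat \<Rightarrow> 'a::field poly) \<Rightarrow> ('a ratfun \<Rightarrow> 'a ratfun) \<Rightarrow> nat \<Rightarrow> nat \<Rightarrow> 'a ratfun" where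
  "tangent_map n F \<theta> = (\<lambda>i j. if i \<le> n \<and> j \<le> n \<and> F i \<noteq> 0 then \<theta> (coord F i j) else 0)"

text \<open>
  The normal bundle \<open>N\<close> is the cokernel of the tangent map, so it is isomorphic to the sum of
  the \<open>\<O>(d)\<close>, \<open>d\<close> in \<open>ds\<close>, iff that sum is the right-hand term of an exact sequence
  \<open>0 \<rightarrow> T \<rightarrow> f\<^sup>*T \<rightarrow> N \<rightarrow> 0\<close> whose first map is the tangent map.
\<close>

definition normal_bundle_iso_sum ::
    "nat \<Rightarrow> nat \<Rightarrow> (nat \<Rightarrow> 'a::field poly) \<Rightarrow> int list \<Rightarrow> bool" where
  "normal_bundle_iso_sum n e F ds \<longleftrightarrow>
    (\<exists>q :: (nat \<Rightarrow> nat \<Rightarrow> 'a ratfun) \<Rightarrow> nat \<Rightarrow> 'a ratfun.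
       (\<forall>w\<in>pullback_tangent_generic n F. \<forall>w'\<in>pullback_tangent_generic n F.
          q (w + w') = q w + q w') \<and>
       (\<forall>g. \<forall>w\<in>pullback_tangent_generic n F. q (\<lambda>i j. g * w i j) = (\<lambda>i. g * q w i)) \<and>
       (\<forall>p\<in>P1.
          inj_on (tangent_map n F) (tangent_stalk p) \<and>
          tangent_map n F ` tangent_stalk p = {w\<in>pullback_tangent_stalk n e F p. q w = 0} \<and>
          q ` pullback_tangent_stalk n e F p = sum_stalk ds p))"


section \<open>The loci and their expected dimensions\<close>

definition splitting_sequence :: "nat \<Rightarrow> nat \<Rightarrow> int list \<Rightarrow> bool" where
  "splitting_sequence n e bs \<longleftrightarrow> length bs = n - 1 \<and> sorted bs \<and> (\<forall>b\<in>set bs. 1 < b) \<and>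
     sum_list bs = 2 * int e - 2"

abbreviation normal_degrees :: "nat \<Rightarrow> int list \<Rightarrow> int list" where
  "normal_degrees e bs \<equiv> map (\<lambda>b. int e + b) bs"

definition normal_locus :: "nat \<Rightarrow> nat \<Rightarrow> int list \<Rightarrow> (nat \<Rightarrow> 'a::field poly) set set" where
  "normal_locus n e bs = {f\<in>Mor n e. \<forall>F\<in>f. nondegenerate n e F \<and> unramified n e F \<and>
     birational_onto_image n F \<and> normal_bundle_iso_sum n e F (normal_degrees e bs)}"

definition expected_codim :: "'a::field itself \<Rightarrow> nat \<Rightarrow> int list \<Rightarrow> nat" where
  "expected_codim k e bs = h1_End k (normal_degrees e bs)"

definition expected_dim :: "'a::field itself \<Rightarrow> nat \<Rightarrow> nat \<Rightarrow> int list \<Rightarrow> int" where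
  "expected_dim k n e bs = (int e + 1) * (int n + 1) - 1 - int (expected_codim k e bs)"

text \<open>The sequence \<open>2, \<dots>, 2, 2e - 2n + 2\<close> with \<open>n - 2\<close> twos.\<close>

definition b_two :: "nat \<Rightarrow> nat \<Rightarrow> int list" where
  "b_two n e = replicate (n - 2) 2 @ [2 * int e - 2 * int n + 2]"


section \<open>The dimension of the space of morphisms\<close>

text \<open>Multivariate polynomials over \<open>'a\<close> with variables indexed by \<open>'v\<close>.\<close>

type_synonym ('v, 'a) mvpoly = "('v \<Rightarrow>\<^sub>0 nat) \<Rightarrow>\<^sub>0 'a"

definition mv_eval :: "('v, 'a::field) mvpoly \<Rightarrow> ('v \<Rightarrow> 'a) \<Rightarrow> 'a" where
  "mv_eval P x = (\<Sum>m\<in>Poly_Mapping.keys P.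
     Poly_Mapping.lookup P m * (\<Prod>v\<in>Poly_Mapping.keys m. x v ^ Poly_Mapping.lookup m v))"

definition mv_homogeneous :: "nat \<Rightarrow> ('v, 'a::field) mvpoly \<Rightarrow> bool" where
  "mv_homogeneous d P \<longleftrightarrow>
     (\<forall>m\<in>Poly_Mapping.keys P. (\<Sum>v\<in>Poly_Mapping.keys m. Poly_Mapping.lookup m v) = d)"

text \<open>
  The coefficients of the \<open>n + 1\<close> forms embed \<open>Mor n e\<close> in a projective space; \<open>Mor n e\<close> carries
  the induced Zariski topology, which has the nonvanishing loci of homogeneous polynomials in
  the coefficients as a basis.
\<close>

definition coefficients :: "(nat \<Rightarrow> 'a::field poly) \<Rightarrow> nat \<times> nat \<Rightarrow> 'a" where
  "coefficients F = (\<lambda>(i, j). coeff (F i) j)"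

definition Mor_zariski :: "nat \<Rightarrow> nat \<Rightarrow> (nat \<Rightarrow> 'a::field poly) set topology" where
  "Mor_zariski n e = topology_generated_by
     {{f\<in>Mor n e. \<forall>F\<in>f. mv_eval P (coefficients F) \<noteq> 0} | P d. mv_homogeneous d P}"

definition irreducible_closedin :: "'b topology \<Rightarrow> 'b set \<Rightarrow> bool" where
  "irreducible_closedin X Z \<longleftrightarrow> closedin X Z \<and> Z \<noteq> {} \<and>
     (\<forall>A B. closedin X A \<and> closedin X B \<and> Z \<subseteq> A \<union> B \<longrightarrow> Z \<subseteq> A \<or> Z \<subseteq> B)"

definition krull_dim :: "'b topology \<Rightarrow> enat" where
  "krull_dim X = Sup {enat l | l. \<exists>Z. (\<forall>i\<le>l. irreducible_closedin X (Z i)) \<and>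
     (\<forall>i<l. Z i \<subset> Z (Suc i))}"

end

theory Submission
  imports Defs
begin

text \<open>
  A nonempty locus of large expected codimension comes from curves on the cone over a rational
  normal curve. Let \<open>h\<close> be a polynomial of degree \<open>m = e - n + 1\<close> with simple roots and
  \<open>f = [h : h x : \<dots> : h x^(n-1) : 1]\<close>. Its projection from the vertex of the cone is
  \<open>[1 : x : \<dots> : x^(n-1)]\<close>, so the forms \<open>(x^2, -2x, 1)\<close> in three consecutive of the first \<open>n\<close>
  coordinates kill both \<open>f\<close> and \<open>f'\<close>. These \<open>n - 2\<close> relations of degree \<open>2\<close> are completed by the
  relation \<open>(-(h + x h'), h', h^2)\<close> of degree \<open>2 m\<close> in the coordinates number \<open>0\<close>, \<open>1\<close> and \<open>n\<close>.
  Because \<open>h\<close> and \<open>h'\<close> have no common zero, the \<open>n - 1\<close> relations are independent at every point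
  of the projective line, infinity included (\<open>normal_coords_surj\<close>), and a tangent vector that
  all of them kill is a multiple of \<open>f'\<close>, with a regular factor (\<open>normal_map_kernel\<close>). They
  therefore identify the normal bundle with \<open>\<O>(e+2)^(n-2) \<oplus> \<O>(e+2m)\<close>, which is the splitting
  type of \<open>b_two n e\<close>. The function \<open>x\<close> is a quotient of two coordinates, so the curve is
  birational onto its image; it is unramified because \<open>x\<close> or \<open>1/x\<close> is a local coordinate
  where \<open>h\<close> does not vanish and \<open>h\<close> is one at its simple zeros. The polynomial \<open>x^m - 1\<close> serves as \<open>h\<close>.

  The Cech complex of the endomorphism bundle of a sum of line bundles splits into matrix
  entries, and the entry \<open>(i, j)\<close> contributes the monomials \<open>x^l\<close> with \<open>d\<^sub>i - d\<^sub>j < l < 0\<close>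
  (\<open>h1_End_sum\<close>). For \<open>b_two n e\<close> only the entries between the summands of different degree
  count, and the expected codimension is \<open>(n - 2) (2e - 2n - 1)\<close>. For fixed \<open>n\<close> it grows like
  \<open>2 (n - 2) e\<close>, faster than \<open>(n + 1) (e + 1)\<close> when \<open>n \<ge> 6\<close>.

  The Krull dimension of the space of morphisms is bounded by the number
  \<open>N = (n + 1) (e + 1)\<close> of coefficients (\<open>krull_dim_Mor_le\<close>) by comparing growth rates. Along a
  chain \<open>Z\<^sub>0 \<subset> \<dots> \<subset> Z\<^sub>l\<close> of irreducible closed sets, choose a form vanishing on \<open>Z\<^sub>i\<close>
  but not on \<open>Z\<^sub>i\<^sub>+\<^sub>1\<close>; multiplication by it is injective on forms on \<open>Z\<^sub>i\<^sub>+\<^sub>1\<close>, and no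
  nonzero multiple of it is a combination of forms that are independent on \<open>Z\<^sub>i\<close>. Each step of the chain thus raises the
  growth order of the number of independent forms of degree \<open>D m\<close> by one, so that there are at
  least \<open>binomial (m + l) l\<close> of them on \<open>Z\<^sub>l\<close>. As there are at most \<open>(D m + 1)^N\<close> monomials,
  \<open>l \<le> N\<close>. This bound is one more than the dimension, a difference that is immaterial for large
  \<open>e\<close>.
\<close>


section \<open>Stalks of line bundles\<close>

lemma form_eval_affine:
  assumes "degree P \<le> d" "fst p \<noteq> 0"
  shows "form_eval d P p = fst p ^ d * poly P (snd p / fst p)"
proof -
  have "poly P (snd p / fst p) = (\<Sum>j\<le>d. coeff P j * (snd p / fst p) ^ j)"
    unfolding poly_altdef
    by (rule sum.mono_neutral_left) (use assms in \<open>auto simp: coeff_eq_0\<close>)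
  then show ?thesis
    unfolding form_eval_def sum_distrib_left
    using assms by (auto simp: sum_distrib_left power_divide power_diff field_simps intro!: sum.cong)
qed

text \<open>
  At the point \<open>[0:1]\<close> a form of degree \<open>d\<close> is measured by its coefficient of \<open>x^d\<close>, which is how
  degrees of numerator and denominator enter the stalks at infinity.
\<close>

lemma form_eval_infinity:
  assumes "fst p = 0"
  shows "form_eval d P p = coeff P d * snd p ^ d"
proof -
  have "form_eval d P p = (\<Sum>j\<in>{d}. coeff P j * fst p ^ (d - j) * snd p ^ j)"
    unfolding form_eval_def
    by (rule sum.mono_neutral_right) (use assms in auto)
  then show ?thesis by simp
qed

text \<open>
  With the section \<open>s^m\<close> trivialising \<open>\<O>(m)\<close> on \<open>s \<noteq> 0\<close>, the stalk of every \<open>\<O>(m)\<close> at the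
  point \<open>[1:z]\<close> is the local ring of \<open>z\<close>; the twist is visible at infinity only, where it bounds
  the degree of a rational function.
\<close>

definition regular_at :: "'a::field \<Rightarrow> 'a ratfun \<Rightarrow> bool" where
  "regular_at z u \<longleftrightarrow> (\<exists>A B. u = Fract A B \<and> poly B z \<noteq> 0)"

definition deg_le :: "int \<Rightarrow> 'a::field ratfun \<Rightarrow> bool" where
  "deg_le m u \<longleftrightarrow> (\<exists>A B. u = Fract A B \<and> B \<noteq> 0 \<and> int (degree A) \<le> int (degree B) + m)"

lemma O_stalkI:
  assumes "int a = int b + m" "degree A \<le> a" "degree B \<le> b" "form_eval b B p \<noteq> 0"
  shows "Fract A B \<in> O_stalk m p"
  unfolding O_stalk_def using assms by blast

lemma O_stalk_affine:
  assumes "fst p \<noteq> 0"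
  shows "u \<in> O_stalk m p \<longleftrightarrow> regular_at (snd p / fst p) u"
proof
  assume "u \<in> O_stalk m p"
  then obtain A B b where "u = Fract A B" "degree B \<le> b" "form_eval b B p \<noteq> 0"
    by (auto simp: O_stalk_def)
  then show "regular_at (snd p / fst p) u"
    unfolding regular_at_def using assms
    by (intro exI[of _ A] exI[of _ B]) (auto simp: form_eval_affine)
next
  assume "regular_at (snd p / fst p) u"
  then obtain A B where AB: "u = Fract A B" "poly B (snd p / fst p) \<noteq> 0"
    by (auto simp: regular_at_def)
  define b where "b = degree A + degree B + nat (\<bar>m\<bar>)"
  have "form_eval b B p \<noteq> 0"
    using AB(2) assms by (subst form_eval_affine) (auto simp: b_def)
  then show "u \<in> O_stalk m p"
    unfolding AB(1) by (intro O_stalkI[of "nat (int b + m)" b]) (auto simp: b_def)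
qed

lemma O_stalk_infinity:
  assumes "fst p = 0" "snd p \<noteq> 0"
  shows "u \<in> O_stalk m p \<longleftrightarrow> deg_le m u"
proof
  assume "u \<in> O_stalk m p"
  then obtain A B a b where *: "u = Fract A B" "int a = int b + m" "degree A \<le> a" "degree B \<le> b"
      "form_eval b B p \<noteq> 0"
    by (auto simp: O_stalk_def)
  then have "coeff B b \<noteq> 0" using assms by (auto simp: form_eval_infinity)
  then have "degree B = b" "B \<noteq> 0" using * le_degree[of B b] by auto
  then show "deg_le m u"
    unfolding deg_le_def using * by (intro exI[of _ A] exI[of _ B]) auto
next
  assume "deg_le m u"
  then obtain A B where AB: "u = Fract A B" "B \<noteq> 0" "int (degree A) \<le> int (degree B) + m"
    by (auto simp: deg_le_def)
  have "form_eval (degree B) B p \<noteq> 0" using AB assms by (auto simp: form_eval_infinity)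
  then show "u \<in> O_stalk m p"
    unfolding AB(1) using AB(3) by (intro O_stalkI[of "nat (int (degree B) + m)" "degree B"]) auto
qed

lemma regular_at_FractI: "poly B z \<noteq> 0 \<Longrightarrow> regular_at z (Fract A B)"
  by (auto simp: regular_at_def)

lemma regular_at_add:
  assumes "regular_at z u" "regular_at z v" shows "regular_at z (u + v)"
proof -
  obtain A B C D where "u = Fract A B" "poly B z \<noteq> 0" "v = Fract C D" "poly D z \<noteq> 0"
    using assms by (auto simp: regular_at_def)
  moreover from this have "B \<noteq> 0" "D \<noteq> 0" by auto
  ultimately show ?thesis by (auto intro!: regular_at_FractI)
qed

lemma regular_at_mult:
  assumes "regular_at z u" "regular_at z v" shows "regular_at z (u * v)"
proof -
  obtain A B C D where "u = Fract A B" "poly B z \<noteq> 0" "v = Fract C D" "poly D z \<noteq> 0"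
    using assms by (auto simp: regular_at_def)
  then show ?thesis by (auto intro!: regular_at_FractI)
qed

lemma deg_le_add:
  assumes "deg_le m u" "deg_le m v" shows "deg_le m (u + v)"
proof -
  obtain A B C D where *: "u = Fract A B" "B \<noteq> 0" "int (degree A) \<le> int (degree B) + m"
      "v = Fract C D" "D \<noteq> 0" "int (degree C) \<le> int (degree D) + m"
    using assms by (auto simp: deg_le_def)
  have "degree (A * D) \<le> degree A + degree D" "degree (C * B) \<le> degree C + degree B"
    by (rule degree_mult_le)+
  moreover have "degree (B * D) = degree B + degree D" using * by (simp add: degree_mult_eq)
  moreover have "degree (A * D + C * B) \<le> max (degree (A * D)) (degree (C * B))"
    by (rule degree_add_le_max)
  ultimately have "int (degree (A * D + C * B)) \<le> int (degree (B * D)) + m"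
    using * by linarith
  then show ?thesis unfolding deg_le_def using *
    by (intro exI[of _ "A * D + C * B"] exI[of _ "B * D"]) auto
qed

lemma deg_le_mult:
  assumes "deg_le m u" "deg_le m' v" shows "deg_le (m + m') (u * v)"
proof -
  obtain A B C D where *: "u = Fract A B" "B \<noteq> 0" "int (degree A) \<le> int (degree B) + m"
      "v = Fract C D" "D \<noteq> 0" "int (degree C) \<le> int (degree D) + m'"
    using assms by (auto simp: deg_le_def)
  have "degree (A * C) \<le> degree A + degree C" by (rule degree_mult_le)
  moreover have "degree (B * D) = degree B + degree D" using * by (simp add: degree_mult_eq)
  ultimately have "int (degree (A * C)) \<le> int (degree (B * D)) + (m + m')"
    using * by linarith
  then show ?thesis unfolding deg_le_def using *
    by (intro exI[of _ "A * C"] exI[of _ "B * D"]) auto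
qed

lemma deg_le_zero: "deg_le m 0"
proof -
  have "0 = Fract (0::'a poly) (monom 1 (nat \<bar>m\<bar>))" by (simp add: Zero_fract_def eq_fract)
  moreover have "degree (monom (1::'a) (nat \<bar>m\<bar>)) = nat \<bar>m\<bar>" by (simp add: degree_monom_eq)
  ultimately show ?thesis unfolding deg_le_def
    by (intro exI[of _ 0] exI[of _ "monom 1 (nat \<bar>m\<bar>)"]) auto
qed

lemma regular_at_zero: "regular_at z 0"
  using regular_at_FractI[of 1 z 0] by (simp add: Zero_fract_def)

text \<open>
  The degree of a rational function does not depend on the fraction that represents it.
\<close>

lemma deg_le_Fract_iff:
  assumes "B \<noteq> 0" "A \<noteq> 0"
  shows "deg_le m (Fract A B) \<longleftrightarrow> int (degree A) \<le> int (degree B) + m"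
proof
  assume "deg_le m (Fract A B)"
  then obtain C D where *: "Fract A B = Fract C D" "D \<noteq> 0" "int (degree C) \<le> int (degree D) + m"
    by (auto simp: deg_le_def)
  then have eq: "A * D = C * B" using assms by (simp add: eq_fract)
  then have "C \<noteq> 0" using assms * by auto
  then have "degree A + degree D = degree C + degree B"
    using arg_cong[OF eq, of degree] assms * by (simp add: degree_mult_eq)
  then show "int (degree A) \<le> int (degree B) + m" using * by linarith
qed (use assms in \<open>auto simp: deg_le_def\<close>)

lemma P1_cases:
  assumes "p \<in> P1"
  obtains (affine) "fst p \<noteq> 0" | (infinity) "fst p = 0" "snd p \<noteq> 0"
  using assms by (cases p) (auto simp: P1_def)

lemma O_stalk_add:
  assumes "p \<in> P1" "u \<in> O_stalk m p" "v \<in> O_stalk m p"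
  shows "u + v \<in> O_stalk m p"
  using assms(1)
  by (cases rule: P1_cases)
     (use assms in \<open>auto simp: O_stalk_affine O_stalk_infinity intro: regular_at_add deg_le_add\<close>)

lemma O_stalk_mult:
  assumes "p \<in> P1" "u \<in> O_stalk m p" "v \<in> O_stalk m' p"
  shows "u * v \<in> O_stalk (m + m') p"
  using assms(1)
  by (cases rule: P1_cases)
     (use assms in \<open>auto simp: O_stalk_affine O_stalk_infinity intro: regular_at_mult deg_le_mult\<close>)

lemma O_stalk_zero:
  assumes "p \<in> P1" shows "0 \<in> O_stalk m p"
  using assms
  by (cases rule: P1_cases)
     (auto simp: O_stalk_affine O_stalk_infinity regular_at_zero deg_le_zero)

lemma local_ring_const:
  assumes "p \<in> P1" shows "const c \<in> local_ring p"
  using assms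
proof (cases rule: P1_cases)
  case infinity
  have "deg_le 0 (const c)"
    unfolding deg_le_def by (intro exI[of _ "[:c:]"] exI[of _ 1]) auto
  then show ?thesis using infinity by (simp add: O_stalk_infinity)
qed (simp add: O_stalk_affine regular_at_FractI)

lemma O_stalk_scale:
  assumes "p \<in> P1" "u \<in> O_stalk m p" shows "const c * u \<in> O_stalk m p"
  using O_stalk_mult[OF assms(1) local_ring_const[OF assms(1)] assms(2)] by simp

lemma O_stalk_uminus:
  assumes "p \<in> P1" "u \<in> O_stalk m p" shows "- u \<in> O_stalk m p"
proof -
  have "- u = const (- 1) * u"
    by (cases u) simp
  then show ?thesis using O_stalk_scale[OF assms] by simp
qed

lemma O_stalk_diff:
  assumes "p \<in> P1" "u \<in> O_stalk m p" "v \<in> O_stalk m p"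
  shows "u - v \<in> O_stalk m p"
  using O_stalk_add[OF assms(1,2) O_stalk_uminus[OF assms(1,3)]] by simp

lemma O_stalk_sum:
  assumes "p \<in> P1" "\<And>i. i \<in> A \<Longrightarrow> f i \<in> O_stalk m p"
  shows "(\<Sum>i\<in>A. f i) \<in> O_stalk m p"
  using assms(2)
  by (induction A rule: infinite_finite_induct) (auto intro: O_stalk_add O_stalk_zero assms(1))

definition var :: "'a::field ratfun" where
  "var = Fract [:0, 1:] 1"

lemma var_power: "var ^ k = (Fract (monom 1 k) 1 :: 'a::field ratfun)"
  by (induction k) (auto simp: var_def One_fract_def monom_Suc monom_0 one_pCons mult.commute)

lemma var_nonzero [simp]: "(var :: 'a::field ratfun) \<noteq> 0"
  by (simp add: var_def Zero_fract_def eq_fract)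

lemma var_powi_nonneg: "l \<ge> 0 \<Longrightarrow> var powi l = (Fract (monom 1 (nat l)) 1 :: 'a::field ratfun)"
  by (simp add: power_int_def var_power)

lemma var_powi_neg: "l < 0 \<Longrightarrow> var powi l = (Fract 1 (monom 1 (nat (- l))) :: 'a::field ratfun)"
proof -
  assume "l < 0"
  then have "var powi l = inverse ((var :: 'a ratfun) ^ nat (- l))"
    by (simp only: power_int_def power_inverse not_le[symmetric] if_False)
  then show ?thesis unfolding var_power by simp
qed

lemma deg_le_var_powi: "l \<le> m \<Longrightarrow> deg_le m (var powi l)"
proof (cases "l \<ge> 0")
  case True
  assume "l \<le> m" then show ?thesis
    using True by (simp add: var_powi_nonneg deg_le_Fract_iff degree_monom_eq)
next
  case False
  assume "l \<le> m" then show ?thesis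
    using False by (simp add: var_powi_neg deg_le_Fract_iff degree_monom_eq)
qed

lemma regular_at_var_powi: "z \<noteq> 0 \<or> l \<ge> 0 \<Longrightarrow> regular_at z (var powi l)"
  by (cases "l \<ge> 0") (auto simp: var_powi_nonneg var_powi_neg poly_monom intro!: regular_at_FractI)


section \<open>The first cohomology of the endomorphism bundle\<close>

text \<open>
  A local generator of \<open>\<O>(m)\<close> at the point, used to read off the entries of an endomorphism.
\<close>

definition stalk_generator :: "int \<Rightarrow> 'a::field \<times> 'a \<Rightarrow> 'a ratfun" where
  "stalk_generator m p = (if fst p \<noteq> 0 then 1 else var powi m)"

lemma stalk_generator_in: "p \<in> P1 \<Longrightarrow> stalk_generator m p \<in> O_stalk m p"
  by (elim P1_cases)
     (auto simp: stalk_generator_def O_stalk_affine O_stalk_infinity One_fract_def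
        intro!: regular_at_FractI deg_le_var_powi)

lemma O_stalk_mult_generatorD:
  assumes "p \<in> P1" "u * stalk_generator m p \<in> O_stalk m' p"
  shows "u \<in> O_stalk (m' - m) p"
  using assms(1)
proof (cases rule: P1_cases)
  case affine
  then show ?thesis using assms(2) by (simp add: stalk_generator_def O_stalk_affine)
next
  case infinity
  then have "deg_le m' (u * var powi m)"
    using assms(2) by (simp add: stalk_generator_def O_stalk_infinity)
  from deg_le_mult[OF this deg_le_var_powi[OF order_refl, of "- m"]]
  have "deg_le (m' - m) (u * (var powi m * var powi (- m)))" by (simp add: mult.assoc)
  moreover have "var powi m * var powi (- m) = (1 :: 'a ratfun)"
    by (simp flip: power_int_add)
  ultimately show ?thesis using infinity by (simp add: O_stalk_infinity)
qed

text \<open>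
  Applying an endomorphism to a generator of the \<open>j\<close>-th summand shows that its \<open>(i, j)\<close> entry is a
  local section of \<open>\<O>(d\<^sub>i - d\<^sub>j)\<close>; hence the endomorphism bundle is the sum of these line bundles.
\<close>

lemma End_stalk_iff:
  assumes "p \<in> P1"
  shows "A \<in> End_stalk ds p \<longleftrightarrow>
     (\<forall>i j. i \<ge> length ds \<or> j \<ge> length ds \<longrightarrow> A i j = 0) \<and>
     (\<forall>i<length ds. \<forall>j<length ds. A i j \<in> O_stalk (ds ! i - ds ! j) p)" (is "?L \<longleftrightarrow> ?R")
proof
  assume L: ?L
  have "A i j \<in> O_stalk (ds ! i - ds ! j) p" if i: "i < length ds" and j: "j < length ds" for i j
  proof -
    define v where "v = (\<lambda>k. if k = j then stalk_generator (ds ! j) p else 0)"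
    have "v \<in> sum_stalk ds p"
      using assms j by (auto simp: v_def sum_stalk_def stalk_generator_in O_stalk_zero)
    then have "(\<lambda>i. \<Sum>j<length ds. A i j * v j) \<in> sum_stalk ds p"
      using L by (auto simp: End_stalk_def)
    then have "(\<Sum>j<length ds. A i j * v j) \<in> O_stalk (ds ! i) p"
      using i by (auto simp: sum_stalk_def)
    moreover have "(\<Sum>k<length ds. A i k * v k) = A i j * stalk_generator (ds ! j) p"
      using j by (simp add: v_def if_distrib cong: if_cong)
    ultimately show ?thesis using O_stalk_mult_generatorD[OF assms] by simp
  qed
  then show ?R using L by (auto simp: End_stalk_def)
next
  assume R: ?R
  have "(\<Sum>j<length ds. A i j * v j) \<in> O_stalk (ds ! i) p"
    if v: "v \<in> sum_stalk ds p" and i: "i < length ds" for v i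
  proof (rule O_stalk_sum[OF assms])
    fix j assume "j \<in> {..<length ds}"
    then have "A i j * v j \<in> O_stalk (ds ! i - ds ! j + ds ! j) p"
      using R v i by (intro O_stalk_mult[OF assms]) (auto simp: sum_stalk_def)
    then show "A i j * v j \<in> O_stalk (ds ! i) p" by simp
  qed
  then show ?L using R by (auto simp: End_stalk_def sum_stalk_def)
qed

text \<open>
  In a fraction whose denominator has positive degree, a root of the denominator must cancel against
  the numerator, since the function is regular there; so the degree of the denominator descends to
  zero. Algebraic closedness provides the root.
\<close>

lemma regular_everywhere_imp_polynomial:
  fixes u :: "'a::alg_closed_field ratfun"
  assumes "\<And>z. regular_at z u"
  obtains P where "u = Fract P 1"
proof -
  obtain A B where AB: "u = Fract A B" "B \<noteq> 0" by (rule Fract_cases)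
  have "\<exists>P. u = Fract P 1" using AB
  proof (induction "degree B" arbitrary: A B)
    case 0
    then obtain c where c: "B = [:c:]" "c \<noteq> 0" by (metis degree_eq_zeroE pCons_0_0)
    then have "u = Fract (smult (inverse c) A) 1" using 0 by (simp add: eq_fract)
    then show ?case by blast
  next
    case (Suc d)
    then obtain z where z: "poly B z = 0" using alg_closed_imp_poly_has_root[of B] by auto
    obtain C D where CD: "u = Fract C D" "poly D z \<noteq> 0" using assms[of z] by (auto simp: regular_at_def)
    then have "D \<noteq> 0" by auto
    then have "A * D = C * B" using CD Suc by (simp add: eq_fract)
    then have "poly A z * poly D z = 0" using z by (metis mult_zero_right poly_mult)
    then have "poly A z = 0" using CD by simp
    then obtain A' B' where A': "A = [:-z, 1:] * A'" and B': "B = [:-z, 1:] * B'"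
      using z by (metis dvdE poly_eq_0_iff_dvd)
    then have nz: "B' \<noteq> 0" using Suc by auto
    have "Suc d = Suc (degree B')"
      unfolding \<open>Suc d = degree B\<close> B' using nz by (subst degree_mult_eq) auto
    then have deg: "d = degree B'" by simp
    have "u = Fract A' B'"
      using Suc.prems mult_fract_cancel[of "[:-z, 1:]" A' B'] unfolding A' B' by simp
    then show ?case using Suc.hyps(1)[OF deg] nz by blast
  qed
  then show ?thesis using that by blast
qed

definition is_laurent :: "'a::field ratfun \<Rightarrow> bool" where
  "is_laurent u \<longleftrightarrow> (\<exists>P k. u = Fract P (monom 1 k))"

text \<open>
  A power of \<open>x\<close> clears the pole at \<open>0\<close> and leaves a function that is regular everywhere.
\<close>

lemma regular_off_0_imp_laurent:
  fixes u :: "'a::alg_closed_field ratfun"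
  assumes "\<And>z. z \<noteq> 0 \<Longrightarrow> regular_at z u"
  shows "is_laurent u"
proof -
  obtain A B where AB: "u = Fract A B" "B \<noteq> 0" by (rule Fract_cases)
  define k where "k = order 0 B"
  obtain B' where B': "B = [:- 0, 1:] ^ k * B'" "\<not> [:- 0, 1:] dvd B'"
    unfolding k_def using order_decomp[OF AB(2)] by blast
  have xk: "[:- 0, 1:] ^ k = monom (1::'a) k"
    by (simp add: monom_altdef)
  have B'0: "poly B' 0 \<noteq> 0" using B'(2) poly_eq_0_iff_dvd[of B' 0] by simp
  then have nz: "B' \<noteq> 0" by auto
  have eq: "u * Fract (monom 1 k) 1 = Fract A B'"
    using AB nz unfolding B'(1) xk by (simp add: eq_fract mult_ac)
  have "regular_at z (u * Fract (monom 1 k) 1)" for z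
  proof (cases "z = 0")
    case True
    then show ?thesis unfolding eq using B'0 by (intro regular_at_FractI) auto
  next
    case False
    then show ?thesis by (intro regular_at_mult assms regular_at_FractI) auto
  qed
  then obtain P where P: "u * Fract (monom 1 k) 1 = Fract P 1"
    using regular_everywhere_imp_polynomial by blast
  have "Fract (monom 1 k) 1 * Fract 1 (monom 1 k) = (1 :: 'a ratfun)"
    by (simp add: One_fract_def eq_fract)
  then have "u = u * Fract (monom 1 k) 1 * Fract 1 (monom 1 k)"
    by (simp only: mult.assoc mult_1_right)
  also have "\<dots> = Fract P (monom 1 k)" by (simp add: P)
  finally show ?thesis by (auto simp: is_laurent_def)
qed

lemma laurent_expand:
  fixes P :: "'a::field poly"
  shows "Fract P (monom 1 k) = (\<Sum>j\<le>degree P. const (coeff P j) * var powi (int j - int k))"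
proof -
  have step: "const (coeff P j) * var powi (int j - int k) = Fract (monom (coeff P j) j) 1 * Fract 1 (monom 1 k)"
    for j
  proof -
    have "var powi (int j - int k) = var ^ j * inverse (var ^ k :: 'a ratfun)"
      unfolding power_int_diff[OF disjI1[OF var_nonzero]] divide_inverse by simp
    then show ?thesis by (simp add: var_power smult_monom)
  qed
  have "Fract P 1 = (\<Sum>j\<le>degree P. Fract (monom (coeff P j) j) 1)"
  proof -
    have "(\<Sum>j\<in>S. Fract (f j) 1) = Fract (\<Sum>j\<in>S. f j) (1::'a poly)" if "finite S" for S and f :: "nat \<Rightarrow> 'a poly"
      using that by (induction S) (auto simp: Zero_fract_def)
    then show ?thesis by (simp add: poly_as_sum_of_monoms)
  qed
  moreover have "Fract P (monom 1 k) = Fract P 1 * Fract 1 (monom 1 k)" by simp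
  ultimately show ?thesis by (simp add: step sum_distrib_right)
qed

text \<open>
  The Laurent coefficient at \<open>x^l\<close> as a linear condition on rational functions that is phrased
  through a representing fraction. For \<open>d\<^sub>i - d\<^sub>j < l < 0\<close> it holds on the Cech coboundaries and
  fails for \<open>x^l\<close>, so it separates the cohomology classes of the monomials.
\<close>

definition coeff_vanishes :: "int \<Rightarrow> 'a::field ratfun \<Rightarrow> bool" where
  "coeff_vanishes l u \<longleftrightarrow>
     (\<exists>P k. u = Fract P (monom 1 k) \<and> int k + l \<ge> 0 \<and> coeff P (nat (int k + l)) = 0)"

lemma coeff_vanishes_add:
  assumes "coeff_vanishes l u" "coeff_vanishes l v" shows "coeff_vanishes l (u + v)"
proof -
  obtain P k Q j where P: "u = Fract P (monom 1 k)" "int k + l \<ge> 0" "coeff P (nat (int k + l)) = 0"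
    and Q: "v = Fract Q (monom 1 j)" "int j + l \<ge> 0" "coeff Q (nat (int j + l)) = 0"
    using assms by (auto simp: coeff_vanishes_def)
  have "u + v = Fract (monom 1 j * P + monom 1 k * Q) (monom 1 (k + j))"
    by (simp add: P Q mult_monom mult.commute add.commute)
  moreover have "coeff (monom 1 j * P + monom 1 k * Q) (nat (int (k + j) + l)) = 0"
  proof -
    have e1: "nat (int (k + j) + l) = j + nat (int k + l)"
      and e2: "nat (int (k + j) + l) = k + nat (int j + l)"
      using P Q by linarith+
    have "coeff (monom 1 j * P) (nat (int (k + j) + l)) = 0"
      unfolding e1 using P(3) by (simp add: coeff_monom_mult)
    moreover have "coeff (monom 1 k * Q) (nat (int (k + j) + l)) = 0"
      unfolding e2 using Q(3) by (simp add: coeff_monom_mult)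
    ultimately show ?thesis by simp
  qed
  moreover have "int (k + j) + l \<ge> 0" using P(2) by linarith
  ultimately show ?thesis unfolding coeff_vanishes_def by blast
qed

lemma coeff_vanishes_scale:
  assumes "coeff_vanishes l u" shows "coeff_vanishes l (const c * u)"
proof -
  obtain P k where P: "u = Fract P (monom 1 k)" "int k + l \<ge> 0" "coeff P (nat (int k + l)) = 0"
    using assms by (auto simp: coeff_vanishes_def)
  then show ?thesis unfolding coeff_vanishes_def
    by (intro exI[of _ "smult c P"] exI[of _ k]) auto
qed

lemma coeff_vanishes_zero: "coeff_vanishes l 0"
  unfolding coeff_vanishes_def
  by (intro exI[of _ 0] exI[of _ "nat \<bar>l\<bar>"]) (auto simp: Zero_fract_def eq_fract)

lemma coeff_vanishes_polynomial:
  assumes "l < 0" shows "coeff_vanishes l (Fract P 1)"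
proof -
  have "Fract P 1 = Fract (monom 1 (nat (- l)) * P) (monom 1 (nat (- l)))"
    by (simp add: eq_fract mult.commute)
  then show ?thesis unfolding coeff_vanishes_def using assms
    by (intro exI[of _ "monom 1 (nat (- l)) * P"] exI[of _ "nat (- l)"]) (auto simp: coeff_monom_mult)
qed

lemma coeff_vanishes_deg_le:
  assumes "is_laurent u" "deg_le m u" "m < l" shows "coeff_vanishes l u"
proof (cases "u = 0")
  case True
  then show ?thesis by (simp add: coeff_vanishes_zero)
next
  case False
  obtain P k where u: "u = Fract P (monom 1 k)" using assms by (auto simp: is_laurent_def)
  have P: "P \<noteq> 0" using False u by (auto simp: Zero_fract_def eq_fract)
  have d: "int (degree P) \<le> int k + m"
    using assms(2) P unfolding u by (simp add: deg_le_Fract_iff degree_monom_eq)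
  show ?thesis unfolding coeff_vanishes_def
    using u d assms(3) by (intro exI[of _ P] exI[of _ k]) (auto intro!: coeff_eq_0)
qed

lemma coeff_vanishes_var_powi:
  assumes "l < 0" shows "coeff_vanishes l (var powi l' :: 'a::field ratfun) \<longleftrightarrow> l \<noteq> l'"
proof
  assume "coeff_vanishes l (var powi l' :: 'a ratfun)"
  then obtain P k where P: "var powi l' = (Fract P (monom 1 k) :: 'a ratfun)" "int k + l \<ge> 0" "coeff P (nat (int k + l)) = 0"
    by (auto simp: coeff_vanishes_def)
  show "l \<noteq> l'"
  proof
    assume "l = l'"
    then have "Fract 1 (monom 1 (nat (- l))) = Fract P (monom 1 k)"
      using P assms by (simp add: var_powi_neg)
    then have "monom 1 k = monom 1 (nat (- l)) * P" by (simp add: eq_fract mult.commute)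
    then have "coeff (monom 1 k) k = coeff (monom 1 (nat (- l)) * P) k" by simp
    moreover have "k - nat (- l) = nat (int k + l)" "nat (- l) \<le> k" using P(2) assms by linarith+
    ultimately show False using P(3) by (simp add: coeff_monom_mult)
  qed
next
  assume ne: "l \<noteq> l'"
  show "coeff_vanishes l (var powi l' :: 'a ratfun)"
  proof (cases "l' \<ge> 0")
    case True
    then show ?thesis using coeff_vanishes_polynomial[OF assms] by (simp add: var_powi_nonneg)
  next
    case False
    have "var powi l' = (Fract (monom 1 (nat (- l))) (monom 1 (nat (- l) + nat (- l'))) :: 'a ratfun)"
      using False by (simp add: var_powi_neg eq_fract mult_monom)
    then show ?thesis unfolding coeff_vanishes_def using ne False assms
      by (intro exI[of _ "monom 1 (nat (- l))"] exI[of _ "nat (- l) + nat (- l')"]) auto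
  qed
qed

text \<open>
  Exchange argument relative to \<open>W\<close>. A finite part of \<open>B\<close> involves finitely many vectors of \<open>W\<close>
  only; adjoining a basis of their span to both sides reduces the claim to the bound of an independent
  set by a spanning set.
\<close>

lemma (in vector_space) relative_independent_card_le:
  assumes "finite B0" "B \<subseteq> span (W \<union> B0)" "\<And>b. b \<in> B \<Longrightarrow> b \<notin> span (W \<union> (B - {b}))"
  shows "finite B \<and> card B \<le> card B0"
proof -
  have main: "card S \<le> card B0" if S: "finite S" "S \<subseteq> B" for S
  proof -
    have "\<exists>C. finite C \<and> C \<subseteq> W \<and> S \<subseteq> span (C \<union> B0)"
      using S
    proof (induction S rule: finite_induct)
      case empty
      then show ?case by (intro exI[of _ "{}"]) auto
    next
      case (insert b S)
      then obtain C where C: "finite C" "C \<subseteq> W" "S \<subseteq> span (C \<union> B0)" by auto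
      have "b \<in> span (W \<union> B0)" using insert assms(2) by auto
      then obtain t r where t: "finite t" "t \<subseteq> W \<union> B0" "b = (\<Sum>a\<in>t. r a *s a)"
        unfolding span_explicit by auto
      have "b \<in> span (t \<inter> W \<union> B0)"
        unfolding t(3) using t(2) by (intro span_sum span_scale span_base) auto
      then have "insert b S \<subseteq> span (C \<union> (t \<inter> W) \<union> B0)"
        using C(3) span_mono[of "C \<union> B0" "C \<union> (t \<inter> W) \<union> B0"]
          span_mono[of "t \<inter> W \<union> B0" "C \<union> (t \<inter> W) \<union> B0"] by blast
      then show ?case using C t by (intro exI[of _ "C \<union> (t \<inter> W)"]) auto
    qed
    then obtain C where C: "finite C" "C \<subseteq> W" "S \<subseteq> span (C \<union> B0)" by blast
    obtain C0 where C0: "C0 \<subseteq> C" "independent C0" "C \<subseteq> span C0"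
      using maximal_independent_subset by blast
    have finC0: "finite C0" using C0 C finite_subset by blast
    have "independent (C0 \<union> T) \<and> C0 \<inter> T = {}" if "T \<subseteq> S" for T
      using finite_subset[OF that S(1)] that
    proof (induction T rule: finite_induct)
      case empty
      then show ?case using C0 by simp
    next
      case (insert b T)
      have "C0 \<union> T \<subseteq> W \<union> (B - {b})" using insert C0 C S by auto
      then have "b \<notin> span (C0 \<union> T)"
        using assms(3)[of b] insert S span_mono by blast
      then show ?case using insert span_base[of b "C0 \<union> T"]
        by (auto simp: independent_insertI)
    qed
    then have ind: "independent (C0 \<union> S)" "C0 \<inter> S = {}" by auto
    have "C \<union> B0 \<subseteq> span (C0 \<union> B0)"
      using C0(3) span_mono[of C0 "C0 \<union> B0"] span_superset[of "C0 \<union> B0"] by blast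
    then have "span (C \<union> B0) \<subseteq> span (C0 \<union> B0)"
      using span_minimal subspace_span by blast
    then have "C0 \<union> S \<subseteq> span (C0 \<union> B0)"
      using C(3) span_superset[of "C0 \<union> B0"] by blast
    then have "card (C0 \<union> S) \<le> card (C0 \<union> B0)"
      using independent_span_bound[OF _ ind(1)] finC0 assms(1) by auto
    also have "\<dots> \<le> card C0 + card B0" by (rule card_Un_le)
    finally show ?thesis using card_Un_disjoint[OF finC0 S(1) ind(2)] by simp
  qed
  have "finite B"
  proof (rule ccontr)
    assume "infinite B"
    then obtain S where "S \<subseteq> B" "finite S" "card S = Suc (card B0)"
      using infinite_arbitrarily_large by metis
    then show False using main[of S] by simp
  qed
  then show ?thesis using main by blast
qed

text \<open>
  Two bases of a quotient space have the same cardinality, so the chosen one can be replaced by any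
  finite one at hand.
\<close>

lemma (in vector_space) quotient_dim_eq_card:
  assumes "finite B" "quotient_basis scale V W B"
  shows "quotient_dim scale V W = card B"
proof -
  define B' where "B' = (SOME B. quotient_basis scale V W B)"
  have B': "quotient_basis scale V W B'"
    unfolding B'_def by (rule someI[of _ B]) (rule assms(2))
  have "finite B' \<and> card B' \<le> card B"
    by (rule relative_independent_card_le[OF assms(1), of B' W])
       (use B' assms(2) in \<open>auto simp: quotient_basis_def\<close>)
  moreover from this have "card B \<le> card B'"
    using relative_independent_card_le[of B' B W] B' assms(2) by (auto simp: quotient_basis_def)
  ultimately show ?thesis by (simp add: quotient_dim_def B'_def)
qed

definition matrix_scale :: "'a::field \<Rightarrow> (nat \<Rightarrow> nat \<Rightarrow> 'a ratfun) \<Rightarrow> nat \<Rightarrow> nat \<Rightarrow> 'a ratfun" where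
  "matrix_scale c A = (\<lambda>i j. const c * A i j)"

lemma const_add: "const (a + b) = const a + (const b :: 'a::field ratfun)"
  by simp

lemma const_mult: "const (a * b) = const a * (const b :: 'a::field ratfun)"
  by (simp add: mult.commute)

interpretation mat: vector_space matrix_scale
proof
  fix a b :: 'a and A B :: "nat \<Rightarrow> nat \<Rightarrow> 'a ratfun"
  show "matrix_scale a (A + B) = matrix_scale a A + matrix_scale a B"
    by (simp add: matrix_scale_def fun_eq_iff distrib_left)
  show "matrix_scale (a + b) A = matrix_scale a A + matrix_scale b A"
    by (simp only: matrix_scale_def fun_eq_iff distrib_right plus_fun_apply const_add) simp
  show "matrix_scale a (matrix_scale b A) = matrix_scale (a * b) A"
    by (simp only: matrix_scale_def const_mult mult.assoc)
  show "matrix_scale 1 A = A"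
    by (simp add: matrix_scale_def fun_eq_iff flip: one_pCons One_fract_def)
qed

definition matrix_unit :: "nat \<Rightarrow> nat \<Rightarrow> 'a::field ratfun \<Rightarrow> nat \<Rightarrow> nat \<Rightarrow> 'a ratfun" where
  "matrix_unit i j u = (\<lambda>i' j'. if i' = i \<and> j' = j then u else 0)"

lemma sections_End_iff:
  assumes "U \<subseteq> P1" "U \<noteq> {}"
  shows "A \<in> sections (End_stalk ds) U \<longleftrightarrow>
     (\<forall>i j. i \<ge> length ds \<or> j \<ge> length ds \<longrightarrow> A i j = 0) \<and>
     (\<forall>i<length ds. \<forall>j<length ds. A i j \<in> sections (O_stalk (ds ! i - ds ! j)) U)"
  using assms by (auto simp: sections_def End_stalk_iff subset_iff)

lemma sections_U0:
  fixes u :: "'a::alg_closed_field ratfun"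
  shows "u \<in> sections (O_stalk m) {p. fst p \<noteq> 0} \<longleftrightarrow> (\<exists>P. u = Fract P 1)"
proof
  assume u: "u \<in> sections (O_stalk m) {p. fst p \<noteq> 0}"
  have "regular_at z u" for z
    using u[unfolded sections_def, THEN INT_D, of "(1, z)"] by (simp add: O_stalk_affine)
  then show "\<exists>P. u = Fract P 1" using regular_everywhere_imp_polynomial by blast
qed (auto simp: sections_def O_stalk_affine intro!: regular_at_FractI)

lemma sections_U01:
  fixes u :: "'a::alg_closed_field ratfun"
  shows "u \<in> sections (O_stalk m) ({p. fst p \<noteq> 0} \<inter> {p. snd p \<noteq> 0}) \<longleftrightarrow> is_laurent u"
proof
  assume u: "u \<in> sections (O_stalk m) ({p. fst p \<noteq> 0} \<inter> {p. snd p \<noteq> 0})"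
  have "regular_at z u" if "z \<noteq> 0" for z
    using u[unfolded sections_def, THEN INT_D, of "(1, z)"] that by (simp add: O_stalk_affine)
  then show "is_laurent u" using regular_off_0_imp_laurent by blast
qed (auto simp: sections_def O_stalk_affine is_laurent_def poly_monom intro!: regular_at_FractI)

lemma sections_U1_D:
  fixes u :: "'a::alg_closed_field ratfun"
  assumes "u \<in> sections (O_stalk m) {p. snd p \<noteq> 0}"
  shows "is_laurent u" "deg_le m u"
proof -
  have "u \<in> sections (O_stalk m) ({p. fst p \<noteq> 0} \<inter> {p. snd p \<noteq> 0})"
    using assms by (auto simp: sections_def)
  then show "is_laurent u" by (simp only: sections_U01)
  show "deg_le m u"
    using assms[unfolded sections_def, THEN INT_D, of "(0, 1)"] by (simp add: O_stalk_infinity)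
qed

lemma var_powi_section_U1:
  assumes "l \<le> m" shows "var powi l \<in> sections (O_stalk m) {p. snd p \<noteq> 0}"
  unfolding sections_def
proof (rule INT_I)
  fix p :: "'a \<times> 'a" assume p: "p \<in> {p. snd p \<noteq> 0}"
  then show "var powi l \<in> O_stalk m p"
    by (cases "fst p = 0")
       (auto simp: O_stalk_affine O_stalk_infinity intro!: deg_le_var_powi regular_at_var_powi assms)
qed

lemma fun_sum_apply: "(\<Sum>i\<in>A. f i) x = (\<Sum>i\<in>A. f i x)"
  by (induction A rule: infinite_finite_induct) auto

text \<open>
  Sections over \<open>s t \<noteq> 0\<close> have Laurent polynomials as entries. The entry \<open>(i, j)\<close> of a section over
  \<open>s \<noteq> 0\<close> is a polynomial, that of a section over \<open>t \<noteq> 0\<close> is a Laurent polynomial of degree at most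
  \<open>d\<^sub>i - d\<^sub>j\<close>. The monomials \<open>x^l\<close> with \<open>d\<^sub>i - d\<^sub>j < l < 0\<close> that neither kind reaches form the
  basis \<open>B\<close>.
\<close>

theorem h1_End_sum:
  "h1_End TYPE('a::alg_closed_field) ds =
     (\<Sum>i<length ds. \<Sum>j<length ds. nat (ds ! j - ds ! i - 1))"
proof -
  let ?r = "length ds"
  let ?U0 = "{p :: 'a \<times> 'a. fst p \<noteq> 0}" and ?U1 = "{p :: 'a \<times> 'a. snd p \<noteq> 0}"
  define V where "V = sections (End_stalk ds) (?U0 \<inter> ?U1)"
  define W where "W = {u + v | u v. u \<in> sections (End_stalk ds) ?U0 \<and> v \<in> sections (End_stalk ds) ?U1}"
  define J where "J = (SIGMA i:{..<?r}. SIGMA j:{..<?r}. {ds ! i - ds ! j<..<0})"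
  define b where "b = (\<lambda>(i, j, l). matrix_unit i j (var powi l) :: nat \<Rightarrow> nat \<Rightarrow> 'a ratfun)"
  define B where "B = b ` J"
  have sub: "?U0 \<subseteq> P1" "?U1 \<subseteq> P1" "?U0 \<inter> ?U1 \<subseteq> P1"
    and ne: "?U0 \<noteq> {}" "?U1 \<noteq> {}" "?U0 \<inter> ?U1 \<noteq> {}"
    by (auto simp: P1_def set_eq_iff intro: exI[of _ 1])
  note secs = sections_End_iff[OF sub(1) ne(1)] sections_End_iff[OF sub(2) ne(2)] sections_End_iff[OF sub(3) ne(3)]
  have V_iff: "A \<in> V \<longleftrightarrow> (\<forall>i j. i \<ge> ?r \<or> j \<ge> ?r \<longrightarrow> A i j = 0) \<and> (\<forall>i<?r. \<forall>j<?r. is_laurent (A i j))" for A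
    unfolding V_def secs sections_U01 ..
  have finJ: "finite J" by (auto simp: J_def intro!: finite_SigmaI)
  \<comment> \<open>The coefficient at \<open>x^l\<close> of the entry \<open>(i, j)\<close> is a functional that separates the basis
    element \<open>b (i, j, l)\<close> from the coboundaries and from all other basis elements.\<close>
  have sep: "coeff_vanishes l (A i j)" if ijl: "(i, j, l) \<in> J" and A: "A \<in> W \<union> (B - {b (i, j, l)})" for A i j l
  proof -
    have J: "i < ?r" "j < ?r" "ds ! i - ds ! j < l" "l < 0" using ijl by (auto simp: J_def)
    from A consider "A \<in> W" | "A \<in> B - {b (i, j, l)}" by blast
    then show ?thesis
    proof cases
      case 1
      then obtain u v where uv: "A = u + v" "u \<in> sections (End_stalk ds) ?U0" "v \<in> sections (End_stalk ds) ?U1"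
        by (auto simp: W_def)
      have u: "u i j \<in> sections (O_stalk (ds ! i - ds ! j)) ?U0" using uv(2) J unfolding secs by blast
      have v: "v i j \<in> sections (O_stalk (ds ! i - ds ! j)) ?U1" using uv(3) J unfolding secs by blast
      have "coeff_vanishes l (u i j)"
        using u J(4) unfolding sections_U0 by (auto intro: coeff_vanishes_polynomial)
      moreover have "coeff_vanishes l (v i j)"
        using sections_U1_D[OF v] J(3) by (rule coeff_vanishes_deg_le)
      ultimately show ?thesis by (simp add: uv(1) coeff_vanishes_add)
    next
      case 2
      then obtain i' j' l' where A: "A = b (i', j', l')" by (auto simp: B_def)
      then have ne: "(i', j', l') \<noteq> (i, j, l)" using 2 by auto
      show ?thesis
      proof (cases "i' = i \<and> j' = j")
        case True
        then have "l \<noteq> l'" using ne by auto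
        then show ?thesis using True by (simp add: A b_def matrix_unit_def coeff_vanishes_var_powi[OF J(4)])
      next
        case False
        then show ?thesis by (auto simp: A b_def matrix_unit_def coeff_vanishes_zero)
      qed
    qed
  qed
  have not_van: "\<not> coeff_vanishes l (b (i, j, l) i j)" if "(i, j, l) \<in> J" for i j l
    using that by (simp add: b_def matrix_unit_def J_def coeff_vanishes_var_powi)
  have sub_van: "mat.subspace {A. coeff_vanishes l (A i j)}" for i j l
    by (auto simp: mat.subspace_def coeff_vanishes_zero coeff_vanishes_add matrix_scale_def
        intro: coeff_vanishes_scale)
  have indep: "b x \<notin> mat.span (W \<union> (B - {b x}))" if "x \<in> J" for x
  proof -
    obtain i j l where x: "x = (i, j, l)" by (cases x)
    have "mat.span (W \<union> (B - {b x})) \<subseteq> {A. coeff_vanishes l (A i j)}"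
      by (rule mat.span_minimal[OF _ sub_van]) (use sep that x in blast)
    then show ?thesis using not_van that x by blast
  qed
  have inj: "inj_on b J"
  proof (rule inj_onI, rule ccontr)
    fix x y assume xy: "x \<in> J" "y \<in> J" "b x = b y" "x \<noteq> y"
    obtain i j l where x: "x = (i, j, l)" by (cases x)
    obtain i' j' l' where y: "y = (i', j', l')" by (cases y)
    have l: "l < 0" using xy(1) x by (auto simp: J_def)
    have "b x i j = var powi l" by (simp add: x b_def matrix_unit_def)
    then have "b y i j = var powi l" by (simp only: xy(3))
    then have "i' = i \<and> j' = j \<and> var powi l' = (var powi l :: 'a ratfun)"
      by (auto simp: y b_def matrix_unit_def split: if_splits)
    moreover have "l \<noteq> l'" using calculation xy(4) x y by auto
    ultimately show False
      using coeff_vanishes_var_powi[OF l, of l'] coeff_vanishes_var_powi[OF l, of l] by (metis (no_types))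
  qed
  have "B \<subseteq> V"
  proof
    fix A assume "A \<in> B"
    then obtain i j l where A: "A = matrix_unit i j (var powi l)" "i < ?r" "j < ?r"
      by (auto simp: B_def J_def b_def)
    have "var powi l \<in> sections (O_stalk m) (?U0 \<inter> ?U1)" for m
      by (auto simp: sections_def O_stalk_affine intro!: regular_at_var_powi)
    then have "is_laurent (var powi l :: 'a ratfun)" using sections_U01 by blast
    moreover have "is_laurent (0 :: 'a ratfun)"
      unfolding is_laurent_def by (intro exI[of _ 0] exI[of _ 0]) (simp add: Zero_fract_def eq_fract)
    ultimately show "A \<in> V" using A by (auto simp: V_iff matrix_unit_def)
  qed
  moreover have "V \<subseteq> mat.span (W \<union> B)"
  proof
    fix A assume A: "A \<in> V"
    have unit_in: "matrix_unit i j (var powi l) \<in> mat.span (W \<union> B)" if ij: "i < ?r" "j < ?r" for i j l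
    proof -
      have zero: "0 \<in> sections (End_stalk ds) U" if "U \<subseteq> P1" "U \<noteq> {}" for U :: "('a \<times> 'a) set"
      proof -
        have "0 \<in> End_stalk ds p" if "p \<in> P1" for p :: "'a \<times> 'a"
          using that by (simp add: End_stalk_iff O_stalk_zero)
        then show ?thesis using that unfolding sections_def by blast
      qed
      have mem: "matrix_unit i j u \<in> sections (End_stalk ds) U"
        if "U \<subseteq> P1" "U \<noteq> {}" "u \<in> sections (O_stalk (ds ! i - ds ! j)) U" for U and u :: "'a ratfun"
      proof -
        have "matrix_unit i j u \<in> End_stalk ds p"
          if "p \<in> P1" "u \<in> O_stalk (ds ! i - ds ! j) p" for p
          using that ij by (simp add: End_stalk_iff O_stalk_zero matrix_unit_def)
        then show ?thesis using that unfolding sections_def by blast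
      qed
      consider "l \<ge> 0" | "l \<le> ds ! i - ds ! j" | "ds ! i - ds ! j < l" "l < 0" by linarith
      then have "matrix_unit i j (var powi l) \<in> W \<union> B"
      proof cases
        case 1
        then have "var powi l \<in> sections (O_stalk (ds ! i - ds ! j)) ?U0"
          unfolding sections_U0 using var_powi_nonneg[OF 1] by blast
        from mem[OF sub(1) ne(1) this] have "matrix_unit i j (var powi l) + 0 \<in> W"
          unfolding W_def using zero[OF sub(2) ne(2)] by blast
        then show ?thesis by simp
      next
        case 2
        then have "var powi l \<in> sections (O_stalk (ds ! i - ds ! j)) ?U1"
          by (rule var_powi_section_U1)
        from mem[OF sub(2) ne(2) this] have "0 + matrix_unit i j (var powi l) \<in> W"
          unfolding W_def using zero[OF sub(1) ne(1)] by blast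
        then show ?thesis by simp
      next
        case 3
        then have "(i, j, l) \<in> J" using ij by (auto simp: J_def)
        then show ?thesis by (force simp: B_def b_def)
      qed
      then show ?thesis by (rule mat.span_base)
    qed
    have entry: "matrix_unit i j (A i j) \<in> mat.span (W \<union> B)" if ij: "i < ?r" "j < ?r" for i j
    proof -
      have "is_laurent (A i j)" using A ij unfolding V_iff by blast
      then obtain P k where P: "A i j = Fract P (monom 1 k)"
        unfolding is_laurent_def by blast
      have "matrix_unit i j (A i j) =
          (\<Sum>t\<le>degree P. matrix_scale (coeff P t) (matrix_unit i j (var powi (int t - int k))))"
      proof (intro ext)
        fix i' j'
        show "matrix_unit i j (A i j) i' j' =
          (\<Sum>t\<le>degree P. matrix_scale (coeff P t) (matrix_unit i j (var powi (int t - int k)))) i' j'"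
          unfolding fun_sum_apply
          by (cases "i' = i \<and> j' = j")
             (auto simp: matrix_scale_def matrix_unit_def P laurent_expand intro!: sum.neutral)
      qed
      also have "\<dots> \<in> mat.span (W \<union> B)"
        by (intro mat.span_sum mat.span_scale unit_in[OF ij])
      finally show ?thesis .
    qed
    have "A = (\<Sum>i<?r. \<Sum>j<?r. matrix_unit i j (A i j))"
    proof (intro ext)
      fix i' j'
      have "(\<Sum>i<?r. \<Sum>j<?r. matrix_unit i j (A i j) i' j') =
          (\<Sum>i<?r. if i = i' then (\<Sum>j<?r. if j = j' then A i j else 0) else 0)"
        by (intro sum.cong) (auto simp: matrix_unit_def)
      also have "\<dots> = A i' j'"
      proof -
        have "A i' j' = 0" if "\<not> i' < ?r \<or> \<not> j' < ?r"
          using A that unfolding V_iff not_less by blast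
        then show ?thesis by auto
      qed
      finally show "A i' j' = (\<Sum>i<?r. \<Sum>j<?r. matrix_unit i j (A i j)) i' j'"
        by (simp add: fun_sum_apply)
    qed
    also have "\<dots> \<in> mat.span (W \<union> B)" by (intro mat.span_sum entry) auto
    finally show "A \<in> mat.span (W \<union> B)" .
  qed
  ultimately have "quotient_basis matrix_scale V W B"
    using indep by (auto simp: quotient_basis_def B_def)
  then have "quotient_dim matrix_scale V W = card B"
    using finJ by (intro mat.quotient_dim_eq_card) (auto simp: B_def)
  also have "card B = card J" unfolding B_def by (rule card_image[OF inj])
  also have "\<dots> = (\<Sum>i<?r. \<Sum>j<?r. nat (ds ! j - ds ! i - 1))"
    unfolding J_def by (subst card_SigmaI) (auto intro!: finite_SigmaI sum.cong arg_cong[of _ _ nat])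
  finally show ?thesis
    by (simp add: h1_End_def cech_h1_def V_def W_def Let_def matrix_scale_def[abs_def])
qed

lemma expected_codim_b_two:
  assumes "n \<ge> 2" "e > n"
  shows "int (expected_codim TYPE('a::alg_closed_field) e (b_two n e)) =
    (int n - 2) * (2 * int e - 2 * int n - 1)"
proof -
  define ds where "ds = normal_degrees e (b_two n e)"
  have len: "length ds = Suc (n - 2)" by (simp add: ds_def b_two_def)
  have ds1: "ds ! i = int e + 2" if "i < n - 2" for i
    using that by (simp add: ds_def b_two_def nth_append)
  have ds2: "ds ! (n - 2) = 3 * int e - 2 * int n + 2"
    by (simp add: ds_def b_two_def nth_append)
  have "expected_codim TYPE('a) e (b_two n e) = (\<Sum>i<Suc (n - 2). \<Sum>j<Suc (n - 2). nat (ds ! j - ds ! i - 1))"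
    unfolding expected_codim_def h1_End_sum ds_def[symmetric] len ..
  also have "\<dots> = (\<Sum>i<n - 2. nat (2 * int e - 2 * int n - 1))"
    using assms by (simp add: ds1 ds2)
  also have "int \<dots> = (int n - 2) * (2 * int e - 2 * int n - 1)"
    using assms by (simp add: of_nat_diff)
  finally show ?thesis .
qed


section \<open>Derivations of the function field\<close>

lemma Der_add: "\<theta> \<in> Der \<Longrightarrow> \<theta> (u + v) = \<theta> u + \<theta> v"
  and Der_mult: "\<theta> \<in> Der \<Longrightarrow> \<theta> (u * v) = u * \<theta> v + v * \<theta> u"
  and Der_const: "\<theta> \<in> Der \<Longrightarrow> \<theta> (const c) = 0"
  by (simp_all add: Der_def)

lemma Der_0: "\<theta> \<in> Der \<Longrightarrow> \<theta> 0 = 0"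
  using Der_const[of \<theta> 0] by (simp add: Zero_fract_def)

lemma Der_1: "\<theta> \<in> Der \<Longrightarrow> \<theta> 1 = 0"
  using Der_const[of \<theta> 1] by (simp add: One_fract_def one_pCons)

lemma Der_inverse:
  assumes "\<theta> \<in> Der" "v \<noteq> 0"
  shows "\<theta> (inverse v) = - \<theta> v / v\<^sup>2"
proof -
  have "0 = \<theta> (v * inverse v)" using assms by (simp add: Der_1)
  also have "\<dots> = v * \<theta> (inverse v) + inverse v * \<theta> v" by (rule Der_mult[OF assms(1)])
  finally have "v * \<theta> (inverse v) = - (inverse v * \<theta> v)" by (simp add: eq_neg_iff_add_eq_0)
  moreover have "\<theta> (inverse v) = inverse v * (v * \<theta> (inverse v))"
    using assms(2) by (simp flip: mult.assoc)
  ultimately show ?thesis by (simp add: power2_eq_square divide_inverse mult_ac)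
qed

lemma Der_divide:
  assumes "\<theta> \<in> Der" "v \<noteq> 0"
  shows "\<theta> (u / v) = \<theta> u / v - u * \<theta> v / v\<^sup>2"
  using assms by (simp add: divide_inverse Der_mult Der_inverse mult_ac)

lemma to_fract_pCons: "to_fract (pCons a P) = const a + var * to_fract P"
  by (simp add: to_fract_def var_def)

lemma Fract_eq_divide: "Fract A B = to_fract A / to_fract B"
  by (simp add: to_fract_def)

text \<open>
  The function field is generated by \<open>x\<close>, so a derivation is determined by its value there. This
  makes every derivation a multiple of \<open>d/dx\<close>.
\<close>

lemma Der_eqI:
  fixes \<theta> :: "'a::field ratfun \<Rightarrow> 'a ratfun"
  assumes "\<theta> \<in> Der" "\<theta>' \<in> Der" "\<theta> var = \<theta>' var"
  shows "\<theta> = \<theta>'"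
proof
  fix u :: "'a ratfun"
  have poly: "\<theta> (to_fract P) = \<theta>' (to_fract P)" for P
  proof (induction P)
    case 0
    show ?case using assms by (simp add: Der_0)
  next
    case (pCons a P)
    then show ?case using assms by (simp add: to_fract_pCons Der_add Der_mult Der_const)
  qed
  obtain A B where u: "u = Fract A B" "B \<noteq> 0" by (rule Fract_cases)
  then show "\<theta> u = \<theta>' u"
    unfolding u(1) Fract_eq_divide using assms u(2) poly by (simp add: Der_divide)
qed

text \<open>
  The quotient rule; \<open>ddx_Fract\<close> shows that the value does not depend on the fraction.
\<close>

definition ddx :: "'a::field ratfun \<Rightarrow> 'a ratfun" where
  "ddx u = (THE v. \<exists>A B. B \<noteq> 0 \<and> u = Fract A B \<and>
     v = Fract (pderiv A * B - A * pderiv B) (B * B))"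

lemma ddx_Fract:
  assumes "B \<noteq> 0"
  shows "ddx (Fract A B) = Fract (pderiv A * B - A * pderiv B) (B * B)"
  unfolding ddx_def
proof (rule the_equality)
  show "\<exists>C D. D \<noteq> 0 \<and> Fract A B = Fract C D \<and>
     Fract (pderiv A * B - A * pderiv B) (B * B) = Fract (pderiv C * D - C * pderiv D) (D * D)"
    using assms by blast
next
  fix v
  assume "\<exists>C D. D \<noteq> 0 \<and> Fract A B = Fract C D \<and> v = Fract (pderiv C * D - C * pderiv D) (D * D)"
  then obtain C D where CD: "D \<noteq> 0" "Fract A B = Fract C D"
      "v = Fract (pderiv C * D - C * pderiv D) (D * D)" by blast
  have eq: "A * D = C * B" using CD assms by (simp add: eq_fract)
  have "pderiv (A * D) = pderiv (C * B)" by (simp only: eq)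
  then have eq': "A * pderiv D + D * pderiv A = C * pderiv B + B * pderiv C"
    by (simp add: pderiv_mult)
  have "(pderiv C * D - C * pderiv D) * (B * B) = (pderiv A * B - A * pderiv B) * (D * D)"
  proof -
    have "(pderiv C * D - C * pderiv D) * (B * B)
        = B * D * (B * pderiv C) - (C * B) * (B * pderiv D)" by (simp add: algebra_simps)
    also have "\<dots> = B * D * (A * pderiv D + D * pderiv A - C * pderiv B) - (A * D) * (B * pderiv D)"
      by (simp add: eq eq')
    also have "\<dots> = (pderiv A * B) * (D * D) - (C * B) * (D * pderiv B)"
      by (simp add: algebra_simps)
    also have "\<dots> = (pderiv A * B) * (D * D) - (A * D) * (D * pderiv B)" by (simp only: eq)
    also have "\<dots> = (pderiv A * B - A * pderiv B) * (D * D)" by (simp add: algebra_simps)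
    finally show ?thesis .
  qed
  then show "v = Fract (pderiv A * B - A * pderiv B) (B * B)"
    using CD assms by (simp add: eq_fract)
qed

lemma ddx_Der: "(ddx :: 'a::field ratfun \<Rightarrow> 'a ratfun) \<in> Der"
proof -
  have "ddx (u + v) = ddx u + ddx v" for u v :: "'a ratfun"
  proof -
    obtain A B C D where *: "u = Fract A B" "B \<noteq> 0" "v = Fract C D" "D \<noteq> 0"
      by (metis Fract_cases)
    show ?thesis unfolding *
      using *(2,4) by (simp add: ddx_Fract eq_fract pderiv_mult pderiv_add algebra_simps)
  qed
  moreover have "ddx (u * v) = u * ddx v + v * ddx u" for u v :: "'a ratfun"
  proof -
    obtain A B C D where *: "u = Fract A B" "B \<noteq> 0" "v = Fract C D" "D \<noteq> 0"
      by (metis Fract_cases)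
    show ?thesis unfolding *
      using *(2,4) by (simp add: ddx_Fract eq_fract pderiv_mult algebra_simps)
  qed
  moreover have "ddx (const c) = 0" for c :: 'a
    by (simp add: ddx_Fract pderiv_pCons Zero_fract_def eq_fract)
  ultimately show ?thesis by (simp add: Der_def)
qed

lemma ddx_to_fract: "ddx (to_fract P) = to_fract (pderiv P)"
  by (simp add: to_fract_def ddx_Fract)

lemma ddx_var: "ddx var = 1"
  using ddx_to_fract[of "[:0, 1:]"] by (simp add: to_fract_def var_def pderiv_pCons One_fract_def one_pCons)

lemma Der_scale: "\<theta> \<in> Der \<Longrightarrow> (\<lambda>u. g * \<theta> u) \<in> Der"
  by (simp add: Der_def algebra_simps)

lemma Der_eq_ddx:
  assumes "\<theta> \<in> Der" shows "\<theta> u = \<theta> var * ddx u"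
  using Der_eqI[OF assms Der_scale[OF ddx_Der, of "\<theta> var"]] by (metis ddx_var mult_1_right)

lemma regular_at_ddx:
  assumes "regular_at z u" shows "regular_at z (ddx u)"
proof -
  obtain A B where *: "u = Fract A B" "poly B z \<noteq> 0" using assms by (auto simp: regular_at_def)
  then have "B \<noteq> 0" by auto
  then show ?thesis unfolding *(1) by (auto simp: ddx_Fract *(2) intro!: regular_at_FractI)
qed

lemma degree_pderiv_le_diff: "degree (pderiv P) \<le> degree P - 1"
  by (rule degree_le) (auto simp: coeff_pderiv coeff_eq_0)

lemma deg_le_ddx:
  assumes "deg_le m u" shows "deg_le (m - 1) (ddx u)"
proof -
  obtain A B where *: "u = Fract A B" "B \<noteq> 0" "int (degree A) \<le> int (degree B) + m"
    using assms by (auto simp: deg_le_def)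
  define N where "N = pderiv A * B - A * pderiv B"
  have bound: "int (degree (pderiv P * Q)) \<le> int (degree P) + int (degree Q) - 1 \<or> pderiv P * Q = 0"
    for P Q :: "'a poly"
  proof (cases "degree P = 0")
    case True
    then show ?thesis by (auto elim: degree_eq_zeroE simp: pderiv_pCons)
  next
    case False
    have "degree (pderiv P * Q) \<le> degree (pderiv P) + degree Q" by (rule degree_mult_le)
    then show ?thesis using degree_pderiv_le_diff[of P] False by linarith
  qed
  show ?thesis
  proof (cases "N = 0")
    case True
    then have "ddx u = 0" using *(2) unfolding *(1) by (simp add: ddx_Fract N_def Zero_fract_def eq_fract)
    then show ?thesis by (simp add: deg_le_zero)
  next
    case False
    have "int (degree N) \<le> int (degree A) + int (degree B) - 1"
    proof -
      consider "pderiv A * B = 0" | "pderiv B * A = 0"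
        | "int (degree (pderiv A * B)) \<le> int (degree A) + int (degree B) - 1"
          "int (degree (pderiv B * A)) \<le> int (degree B) + int (degree A) - 1"
        using bound by blast
      then show ?thesis
      proof cases
        case 1
        then have "N = - (pderiv B * A)" by (simp add: N_def mult.commute)
        then show ?thesis using bound[of B A] False by auto
      next
        case 2
        then have "N = pderiv A * B" by (simp add: N_def mult.commute)
        then show ?thesis using bound[of A B] False by auto
      next
        case 3
        have "degree N \<le> max (degree (pderiv A * B)) (degree (pderiv B * A))"
          unfolding N_def mult.commute[of A] by (rule degree_diff_le_max)
        then show ?thesis using 3 by linarith
      qed
    qed
    moreover have "degree (B * B) = degree B + degree B" using *(2) by (simp add: degree_mult_eq)
    ultimately have "int (degree N) \<le> int (degree (B * B)) + (m - 1)" using *(3) by linarith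
    then show ?thesis unfolding deg_le_def *(1) using *(2)
      by (intro exI[of _ N] exI[of _ "B * B"]) (auto simp: ddx_Fract N_def)
  qed
qed

lemma deg_le_mono: "deg_le m u \<Longrightarrow> m \<le> m' \<Longrightarrow> deg_le m' u"
  unfolding deg_le_def by (elim exE conjE, intro exI conjI) auto

text \<open>
  At infinity a regular function loses two degrees under \<open>d/dx\<close>, not just one: subtracting its value
  at infinity leaves a function of degree at most \<open>-1\<close>. In terms of the local coordinate
  \<open>y = 1/x\<close> this says that \<open>x^2 d/dx = - d/dy\<close> preserves the local ring.
\<close>

lemma deg_le_0_ddx:
  assumes "deg_le 0 u" shows "deg_le (- 2) (ddx u)"
proof -
  obtain A B where *: "u = Fract A B" "B \<noteq> 0" "degree A \<le> degree B"
    using assms by (auto simp: deg_le_def)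
  \<comment> \<open>The value of \<open>u\<close> at infinity.\<close>
  define c where "c = coeff A (degree B) / lead_coeff B"
  define R where "R = A - smult c B"
  have "degree R \<le> degree B" unfolding R_def using *(3) by (intro degree_diff_le) auto
  moreover have "coeff R (degree B) = 0" using *(2) by (simp add: R_def c_def)
  ultimately have "R = 0 \<or> degree R < degree B" by (metis le_neq_implies_less leading_coeff_0_iff)
  then have "deg_le (- 1) (Fract R B)"
  proof
    assume "R = 0"
    then have "Fract R B = 0" using *(2) by (simp add: Zero_fract_def eq_fract)
    then show ?thesis by (simp add: deg_le_zero)
  next
    assume "degree R < degree B"
    then show ?thesis unfolding deg_le_def using *(2) by (intro exI[of _ R] exI[of _ B]) auto
  qed
  moreover have "u = const c + Fract R B"
    unfolding *(1) using *(2) by (simp add: eq_fract R_def algebra_simps)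
  ultimately show ?thesis
    using deg_le_ddx[of "- 1" "Fract R B"] by (simp add: Der_add[OF ddx_Der] Der_const[OF ddx_Der])
qed

lemma tangent_stalk_affine:
  assumes "fst p \<noteq> 0"
  shows "(\<lambda>u. g * ddx u) \<in> tangent_stalk p \<longleftrightarrow> regular_at (snd p / fst p) g"
proof
  assume L: "(\<lambda>u. g * ddx u) \<in> tangent_stalk p"
  have "var \<in> local_ring p" using assms by (simp add: O_stalk_affine var_def regular_at_FractI)
  then have "g * ddx var \<in> local_ring p" using L unfolding tangent_stalk_def by blast
  then show "regular_at (snd p / fst p) g" using assms by (simp add: ddx_var O_stalk_affine)
next
  assume g: "regular_at (snd p / fst p) g"
  have "regular_at (snd p / fst p) (g * ddx u)" if "regular_at (snd p / fst p) u" for u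
    by (rule regular_at_mult[OF g regular_at_ddx[OF that]])
  then show "(\<lambda>u. g * ddx u) \<in> tangent_stalk p"
    using assms Der_scale[OF ddx_Der] by (auto simp: tangent_stalk_def O_stalk_affine)
qed

lemma tangent_stalk_infinityI:
  assumes "fst p = 0" "snd p \<noteq> 0" "deg_le 2 g"
  shows "(\<lambda>u. g * ddx u) \<in> tangent_stalk p"
proof -
  have "deg_le 0 (g * ddx u)" if "deg_le 0 u" for u
    using deg_le_mult[OF assms(3) deg_le_0_ddx[OF that]] by simp
  then show ?thesis
    using assms Der_scale[OF ddx_Der] by (auto simp: tangent_stalk_def O_stalk_infinity)
qed

lemma generated_submodule_mono:
  assumes "S \<subseteq> S'" shows "generated_submodule R S \<subseteq> generated_submodule R S'"
proof
  fix \<eta> assume "\<eta> \<in> generated_submodule R S"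
  then obtain T r where "\<eta> = (\<lambda>\<theta>. \<Sum>\<omega>\<in>T. r \<omega> * \<omega> \<theta>)" "finite T" "T \<subseteq> S" "r ` T \<subseteq> R"
    unfolding generated_submodule_def by blast
  then show "\<eta> \<in> generated_submodule R S'"
    unfolding generated_submodule_def
    by (intro CollectI exI[of _ T] exI[of _ r] conjI) (use assms in auto)
qed

text \<open>
  Unramifiedness at a point is witnessed by a single coordinate: if \<open>u j0\<close> is such that the derivative
  of every regular function is a regular multiple of the derivative of \<open>u j0\<close>, then the differential
  of \<open>u j0\<close> alone generates the cotangent stalk.
\<close>

lemma cotangent_stalk_generated:
  assumes p: "p \<in> P1" and u: "\<And>j. j \<in> J \<Longrightarrow> u j \<in> local_ring p" and j: "j0 \<in> J"
    and gen: "\<And>h. h \<in> local_ring p \<Longrightarrow> \<exists>r\<in>local_ring p. ddx h = r * ddx (u j0)"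
  shows "generated_submodule (local_ring p) ((\<lambda>j. differential (u j)) ` J) = cotangent_stalk p"
proof
  show "generated_submodule (local_ring p) ((\<lambda>j. differential (u j)) ` J) \<subseteq> cotangent_stalk p"
  proof -
    have "(\<lambda>j. differential (u j)) ` J \<subseteq> differential ` local_ring p" using u by auto
    then show ?thesis unfolding cotangent_stalk_def by (rule generated_submodule_mono)
  qed
  show "cotangent_stalk p \<subseteq> generated_submodule (local_ring p) ((\<lambda>j. differential (u j)) ` J)"
  proof
    fix \<eta> assume "\<eta> \<in> cotangent_stalk p"
    then obtain T r where T: "\<eta> = (\<lambda>\<theta>. \<Sum>\<omega>\<in>T. r \<omega> * \<omega> \<theta>)" "finite T"
        "T \<subseteq> differential ` local_ring p" "r ` T \<subseteq> local_ring p"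
      unfolding cotangent_stalk_def generated_submodule_def by blast
    let ?\<omega>0 = "differential (u j0)"
    have "\<forall>\<omega>\<in>T. \<exists>s\<in>local_ring p. \<forall>\<theta>. \<omega> \<theta> = s * ?\<omega>0 \<theta>"
    proof
      fix \<omega> assume "\<omega> \<in> T"
      then obtain h where h: "h \<in> local_ring p" "\<omega> = differential h" using T(3) by blast
      obtain s where s: "s \<in> local_ring p" "ddx h = s * ddx (u j0)" using gen[OF h(1)] by blast
      have "differential h \<theta> = s * ?\<omega>0 \<theta>" for \<theta>
      proof (cases "\<theta> \<in> Der")
        case True
        then have "\<theta> h = \<theta> var * ddx h" "\<theta> (u j0) = \<theta> var * ddx (u j0)"
          by (rule Der_eq_ddx)+
        then show ?thesis using True s(2) by (simp add: differential_def mult_ac)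
      qed (simp add: differential_def)
      then show "\<exists>s\<in>local_ring p. \<forall>\<theta>. \<omega> \<theta> = s * ?\<omega>0 \<theta>" using s(1) h(2) by blast
    qed
    then obtain s where s: "\<And>\<omega>. \<omega> \<in> T \<Longrightarrow> s \<omega> \<in> local_ring p"
        "\<And>\<omega> \<theta>. \<omega> \<in> T \<Longrightarrow> \<omega> \<theta> = s \<omega> * ?\<omega>0 \<theta>"
      by metis
    define c where "c = (\<Sum>\<omega>\<in>T. r \<omega> * s \<omega>)"
    have c: "c \<in> local_ring p"
      unfolding c_def
    proof (rule O_stalk_sum[OF p])
      fix \<omega> assume "\<omega> \<in> T"
      then have "r \<omega> * s \<omega> \<in> O_stalk (0 + 0) p" using T(4) s(1) by (intro O_stalk_mult[OF p]) auto
      then show "r \<omega> * s \<omega> \<in> local_ring p" by simp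
    qed
    have "\<eta> = (\<lambda>\<theta>. \<Sum>\<omega>\<in>{?\<omega>0}. c * \<omega> \<theta>)"
    proof
      fix \<theta>
      have "\<eta> \<theta> = (\<Sum>\<omega>\<in>T. r \<omega> * (s \<omega> * ?\<omega>0 \<theta>))"
        unfolding T(1) by (rule sum.cong) (use s(2) in auto)
      then show "\<eta> \<theta> = (\<Sum>\<omega>\<in>{?\<omega>0}. c * \<omega> \<theta>)"
        by (simp add: c_def sum_distrib_right mult.assoc)
    qed
    moreover have "{?\<omega>0} \<subseteq> (\<lambda>j. differential (u j)) ` J" "finite {?\<omega>0}"
      "(\<lambda>_. c) ` {?\<omega>0} \<subseteq> local_ring p" using j c by auto
    ultimately show "\<eta> \<in> generated_submodule (local_ring p) ((\<lambda>j. differential (u j)) ` J)"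
      unfolding generated_submodule_def
      by (intro CollectI exI[of _ "{?\<omega>0}"] exI[of _ "\<lambda>_. c"] conjI)
  qed
qed

lemma regular_at_to_fract: "regular_at z (to_fract P)"
  by (simp add: to_fract_def regular_at_FractI)

lemma regular_at_inverse_to_fract: "poly P z \<noteq> 0 \<Longrightarrow> regular_at z (inverse (to_fract P))"
  by (simp add: to_fract_def regular_at_FractI)

lemma var_eq_to_fract: "var = to_fract [:0, 1:]"
  by (simp add: var_def to_fract_def)

lemma ddx_inverse_var: "ddx (inverse var) = - inverse (var\<^sup>2 :: 'a::field ratfun)"
  by (simp add: Der_inverse[OF ddx_Der] ddx_var divide_inverse)

lemma deg_le_to_fract: "degree P \<le> d \<Longrightarrow> deg_le (int d) (to_fract P)"
  unfolding deg_le_def to_fract_def by (rule exI[of _ P], rule exI[of _ 1]) auto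

lemma deg_le_inverse_to_fract:
  "P \<noteq> 0 \<Longrightarrow> deg_le (- int (degree P)) (inverse (to_fract P))"
  unfolding deg_le_def to_fract_def inverse_fract by (rule exI[of _ 1], rule exI[of _ P]) auto

lemma var_power2_eq_to_fract: "var\<^sup>2 = to_fract (monom 1 2)"
  by (simp add: to_fract_def var_power)

lemma deg_le_var: "deg_le 1 var"
  using deg_le_to_fract[of "[:0, 1:]" 1] by (simp add: var_eq_to_fract)

lemma deg_le_var2: "deg_le 2 (var\<^sup>2)"
  using deg_le_to_fract[of "monom 1 2" 2] by (simp add: var_power2_eq_to_fract degree_monom_eq)

lemma deg_le_inverse_var2: "deg_le (- 2) (inverse (var\<^sup>2 :: 'a::field ratfun))"
  using deg_le_inverse_to_fract[of "monom (1::'a) 2"]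
  by (simp add: var_power2_eq_to_fract degree_monom_eq)

lemma deg_le_uminus: "deg_le m u \<Longrightarrow> deg_le m (- u)"
  using deg_le_mult[of m u 0 "to_fract (- 1)"] deg_le_to_fract[of "- 1" 0] by simp

lemma deg_le_diff: "deg_le m u \<Longrightarrow> deg_le m v \<Longrightarrow> deg_le m (u - v)"
  using deg_le_add[of m u "- v"] deg_le_uminus[of m v] by simp

lemma regular_at_uminus: "regular_at z u \<Longrightarrow> regular_at z (- u)"
  using regular_at_mult[of z u "to_fract (- 1)"] regular_at_to_fract[of z "- 1"] by simp

lemma regular_at_diff: "regular_at z u \<Longrightarrow> regular_at z v \<Longrightarrow> regular_at z (u - v)"
  using regular_at_add[of z u "- v"] regular_at_uminus[of z v] by simp


section \<open>The pulled back tangent bundle\<close>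

lemma to_fract_in_O_stalk:
  assumes "degree P \<le> d" shows "to_fract P \<in> O_stalk (int d) p"
  unfolding to_fract_def by (rule O_stalkI[of d 0]) (use assms in \<open>auto simp: form_eval_def\<close>)

lemma inverse_to_fract_in_O_stalk:
  assumes "degree P \<le> d" "form_eval d P p \<noteq> 0"
  shows "inverse (to_fract P) \<in> O_stalk (- int d) p"
  unfolding to_fract_def inverse_fract by (rule O_stalkI[of 0 d]) (use assms in auto)

lemma divide_in_local_ring:
  assumes "p \<in> P1" "u \<in> O_stalk (int d) p" "degree P \<le> d" "form_eval d P p \<noteq> 0"
  shows "u / to_fract P \<in> local_ring p"
  using O_stalk_mult[OF assms(1,2) inverse_to_fract_in_O_stalk[OF assms(3,4)]]
  by (simp add: divide_inverse)

lemma coord_in_local_ring: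
  assumes "p \<in> P1" "degree (F i) \<le> e" "degree (F j) \<le> e" "form_eval e (F i) p \<noteq> 0"
  shows "coord F i j \<in> local_ring p"
  unfolding Fract_eq_divide
  by (rule divide_in_local_ring[OF assms(1) to_fract_in_O_stalk[OF assms(3)] assms(2,4)])

lemma chart_change_identity:
  fixes a b c x y :: "'k::field"
  assumes "a \<noteq> 0" "b \<noteq> 0"
  shows "b * (x / (b / a) - c / a * y / (b / a)\<^sup>2) = a * x - c / b * (a * y)"
  using assms by (simp add: field_simps power2_eq_square)

lemma lift_identity:
  fixes a b d x y z :: "'k::field"
  assumes "a \<noteq> 0" "b \<noteq> 0"
  shows "(y - d / b * x) / b =
    ((y - d / a * z) / a) / (b / a) - (d / a) * ((x - b / a * z) / a) / (b / a)\<^sup>2"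
  using assms
  by (simp add: diff_divide_distrib right_diff_distrib left_diff_distrib power2_eq_square mult_ac)

text \<open>
  Clearing denominators in the Jacobian of the coordinate change: up to a multiple of the vector
  \<open>(F 0, \<dots>, F n)\<close>, the vector with entries \<open>F i * w i j\<close> does not depend on the chart \<open>i\<close>. This is
  the Euler sequence.
\<close>

lemma generic_chart_change:
  assumes w: "w \<in> pullback_tangent_generic n F" and "i \<le> n" "l \<le> n" "j \<le> n" "F i \<noteq> 0" "F l \<noteq> 0"
  shows "to_fract (F l) * w l j =
     to_fract (F i) * w i j - to_fract (F j) / to_fract (F l) * (to_fract (F i) * w i l)"
proof -
  have "w l j = w i j / coord F i l - coord F i j * w i l / (coord F i l)\<^sup>2"
    using w[unfolded pullback_tangent_generic_def, THEN CollectD] assms(2-) by blast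
  then show ?thesis
    using assms(5,6) by (simp only: Fract_eq_divide chart_change_identity to_fract_eq_0_iff not_False_eq_True)
qed

lemma generic_eqI:
  assumes w: "w \<in> pullback_tangent_generic n F" and w': "w' \<in> pullback_tangent_generic n F"
    and i: "i \<le> n" "F i \<noteq> 0" and eq: "\<And>j. j \<le> n \<Longrightarrow> w i j = w' i j"
  shows "w = w'"
proof (intro ext)
  fix l j
  show "w l j = w' l j"
  proof (cases "l \<le> n \<and> j \<le> n \<and> F l \<noteq> 0")
    case True
    then have "to_fract (F l) * w l j = to_fract (F l) * w' l j"
      using generic_chart_change[OF w i(1), of l j] generic_chart_change[OF w' i(1), of l j] i eq
      by simp
    then show ?thesis using True by simp
  next
    case False
    then have "w l j = 0" "w' l j = 0"
      using w[unfolded pullback_tangent_generic_def, THEN CollectD, THEN conjunct1]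
        w'[unfolded pullback_tangent_generic_def, THEN CollectD, THEN conjunct1] by (meson not_le)+
    then show ?thesis by simp
  qed
qed

text \<open>
  The map \<open>\<O>(e)^(n+1) \<rightarrow> f\<^sup>*T\<close> of the Euler sequence: the image of \<open>v\<close> differentiates \<open>x\<^sub>j / x\<^sub>i\<close>
  by the quotient rule.
\<close>

definition lift_tangent :: "nat \<Rightarrow> (nat \<Rightarrow> 'a::field poly) \<Rightarrow> (nat \<Rightarrow> 'a ratfun) \<Rightarrow> nat \<Rightarrow> nat \<Rightarrow> 'a ratfun" where
  "lift_tangent n F v = (\<lambda>i j. if i \<le> n \<and> j \<le> n \<and> F i \<noteq> 0
     then (v j - to_fract (F j) / to_fract (F i) * v i) / to_fract (F i) else 0)"

lemma lift_tangent_generic: "lift_tangent n F v \<in> pullback_tangent_generic n F"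
proof -
  show ?thesis
    unfolding pullback_tangent_generic_def
  proof (intro CollectI conjI allI impI)
    fix i l j assume *: "i \<le> n" "l \<le> n" "j \<le> n" "F i \<noteq> 0 \<and> F l \<noteq> 0"
    have entry: "lift_tangent n F v l' j' =
        (v j' - to_fract (F j') / to_fract (F l') * v l') / to_fract (F l')"
      if "l' \<le> n" "j' \<le> n" "F l' \<noteq> 0" for l' j'
      using that by (simp add: lift_tangent_def)
    show "lift_tangent n F v l j = lift_tangent n F v i j / coord F i l -
        coord F i j * lift_tangent n F v i l / (coord F i l)\<^sup>2"
      unfolding entry[OF *(2,3) conjunct2[OF *(4)]] entry[OF *(1,3) conjunct1[OF *(4)]]
        entry[OF *(1,2) conjunct1[OF *(4)]] Fract_eq_divide
      by (rule lift_identity) (use * in simp_all)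
  qed (auto simp: lift_tangent_def)
qed

lemma lift_tangent_stalk:
  assumes "p \<in> P1" "\<And>i. i \<le> n \<Longrightarrow> degree (F i) \<le> e" "\<And>i. i \<le> n \<Longrightarrow> v i \<in> O_stalk (int e) p"
  shows "lift_tangent n F v \<in> pullback_tangent_stalk n e F p"
proof -
  have "(v j - to_fract (F j) / to_fract (F i) * v i) / to_fract (F i) \<in> local_ring p"
    if "i \<le> n" "j \<le> n" "form_eval e (F i) p \<noteq> 0" for i j
  proof (rule divide_in_local_ring[OF assms(1) _ assms(2)[OF that(1)] that(3)])
    have "coord F i j * v i \<in> O_stalk (0 + int e) p"
      using that assms by (intro O_stalk_mult coord_in_local_ring[of p F i e j]) auto
    then show "v j - to_fract (F j) / to_fract (F i) * v i \<in> O_stalk (int e) p"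
      using that assms by (intro O_stalk_diff) (auto simp: Fract_eq_divide)
  qed
  then show ?thesis
    using lift_tangent_generic[of n F v] O_stalk_zero[OF assms(1)]
    by (simp add: pullback_tangent_stalk_def lift_tangent_def)
qed

lemma tangent_map_generic:
  assumes "\<theta> \<in> Der"
  shows "tangent_map n F \<theta> \<in> pullback_tangent_generic n F"
proof -
  have "\<theta> (coord F l j) = \<theta> (coord F i j) / coord F i l - coord F i j * \<theta> (coord F i l) / (coord F i l)\<^sup>2"
    if "F i \<noteq> 0" "F l \<noteq> 0" for i l j
  proof -
    have eq: "coord F l j = coord F i j / coord F i l" using that by (simp add: Fract_eq_divide)
    have "coord F i l \<noteq> 0" using that by (simp add: Fract_eq_divide)
    then show ?thesis by (subst eq) (rule Der_divide[OF assms])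
  qed
  moreover have "\<theta> (coord F i i) = 0" for i
  proof (cases "F i = 0")
    case True
    then show ?thesis by (simp add: Fract_eq_divide Der_0[OF assms])
  next
    case False
    then show ?thesis by (simp add: Fract_eq_divide Der_1[OF assms])
  qed
  ultimately show ?thesis by (simp add: pullback_tangent_generic_def tangent_map_def)
qed

lemma tangent_map_stalk:
  assumes "\<theta> \<in> tangent_stalk p" "p \<in> P1" "\<And>i. i \<le> n \<Longrightarrow> degree (F i) \<le> e"
  shows "tangent_map n F \<theta> \<in> pullback_tangent_stalk n e F p"
proof -
  have \<theta>: "\<theta> \<in> Der" "\<And>u. u \<in> local_ring p \<Longrightarrow> \<theta> u \<in> local_ring p"
    using assms(1) by (auto simp: tangent_stalk_def)
  have "tangent_map n F \<theta> i j \<in> local_ring p" if "i \<le> n" "j \<le> n" "form_eval e (F i) p \<noteq> 0" for i j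
    using that assms \<theta>(2)[OF coord_in_local_ring[of p F i e j]] O_stalk_zero[OF assms(2)]
    by (simp add: tangent_map_def)
  then show ?thesis
    using tangent_map_generic[OF \<theta>(1)] by (simp add: pullback_tangent_stalk_def)
qed


text \<open>
  Solutions of the linear recurrences by which the quadratic relations are inverted.
\<close>

fun two_step :: "('k \<Rightarrow> 'k \<Rightarrow> nat \<Rightarrow> 'k) \<Rightarrow> 'k \<Rightarrow> 'k \<Rightarrow> nat \<Rightarrow> 'k" where
  "two_step g a b 0 = a"
| "two_step g a b (Suc 0) = b"
| "two_step g a b (Suc (Suc k)) = g (two_step g a b k) (two_step g a b (Suc k)) k"


section \<open>Curves on the cone over a rational normal curve\<close>

text \<open>
  Simple roots of \<open>h\<close> make the curve unramified where it passes through the vertex of the cone, and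
  they keep the last of the relations below from vanishing there. By the choice of \<open>e\<close> the
  coordinate \<open>h x^(n-1)\<close> has degree \<open>e\<close>, so that the forms have no common zero at infinity.
\<close>

locale cone_curve =
  fixes n m e :: nat and h :: "'a::field_char_0 poly"
  assumes n: "2 \<le> n" and deg_h: "degree h = m" and m: "1 \<le> m" and e: "e + 1 = m + n"
    and simple_roots: "\<And>z. poly h z = 0 \<Longrightarrow> poly (pderiv h) z \<noteq> 0"
begin

definition F :: "nat \<Rightarrow> 'a poly" where
  "F i = (if i < n then h * monom 1 i else if i = n then 1 else 0)"

abbreviation f :: "nat \<Rightarrow> 'a ratfun" where "f i \<equiv> to_fract (F i)"
abbreviation H :: "'a ratfun" where "H \<equiv> to_fract h"
abbreviation H' :: "'a ratfun" where "H' \<equiv> to_fract (pderiv h)"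

lemma h_nonzero [simp]: "h \<noteq> 0"
  using deg_h m by auto

lemma F_nonzero [simp]: "i \<le> n \<Longrightarrow> F i \<noteq> 0"
  by (simp add: F_def)

lemma degree_F: "i < n \<Longrightarrow> degree (F i) = m + i"
  by (simp add: F_def degree_mult_eq degree_monom_eq deg_h)

lemma degree_F_le: "degree (F i) \<le> e"
proof (cases "i < n")
  case True
  then show ?thesis using degree_F[OF True] e by linarith
qed (simp add: F_def)

lemma F_vanish: "i > n \<Longrightarrow> F i = 0"
  by (simp add: F_def)

lemma to_fract_monom: "to_fract (monom 1 k) = (var :: 'a ratfun) ^ k"
  by (simp add: to_fract_def var_power)

lemma f_eq: "i < n \<Longrightarrow> f i = H * var ^ i" "f n = 1"
  by (simp_all add: F_def to_fract_monom)

lemma chart_affine: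
  assumes "fst p \<noteq> 0" "i \<le> n"
  shows "form_eval e (F i) p \<noteq> 0 \<longleftrightarrow>
     i = n \<or> poly h (snd p / fst p) \<noteq> 0 \<and> (i = 0 \<or> snd p / fst p \<noteq> 0)"
proof -
  have "form_eval e (F i) p \<noteq> 0 \<longleftrightarrow> poly (F i) (snd p / fst p) \<noteq> 0"
    unfolding form_eval_affine[OF degree_F_le assms(1)] using assms(1) by simp
  then show ?thesis
    using assms by (cases "i < n") (auto simp: F_def poly_monom)
qed

text \<open>
  Of all coordinates only \<open>h x^(n-1)\<close> has the full degree \<open>e\<close>.
\<close>

lemma chart_infinity:
  assumes "fst p = 0" "snd p \<noteq> 0" "i \<le> n"
  shows "form_eval e (F i) p \<noteq> 0 \<longleftrightarrow> i = n - 1"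
proof -
  have "coeff (F i) e \<noteq> 0 \<longleftrightarrow> i = n - 1"
  proof (cases "i < n")
    case True
    have "coeff (F i) e \<noteq> 0 \<longleftrightarrow> degree (F i) = e"
      using degree_F_le[of i] True by (metis F_nonzero coeff_eq_0 le_neq_implies_less leading_coeff_0_iff less_imp_le)
    then show ?thesis using degree_F[OF True] e True by auto
  next
    case False
    then have "F i = 1" using assms by (simp add: F_def)
    then show ?thesis using e n m False by auto
  qed
  then show ?thesis using assms by (simp add: form_eval_infinity)
qed

lemma chart_exists:
  assumes "p \<in> P1" shows "\<exists>i\<le>n. form_eval e (F i) p \<noteq> 0"
  using assms
proof (cases rule: P1_cases)
  case affine
  then show ?thesis using chart_affine[of p n] by blast
next
  case infinity
  then show ?thesis using chart_infinity[of p "n - 1"] by (metis diff_le_self)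
qed

lemma mor_tuple_F: "mor_tuple n e F"
  unfolding mor_tuple_def using chart_exists degree_F_le F_vanish by blast

text \<open>
  In a linear relation the constant last coordinate would have to be a multiple of \<open>h\<close>.
\<close>

lemma nondegenerate_F: "nondegenerate n e F"
  unfolding nondegenerate_def
proof (intro allI impI, rule ccontr)
  fix c :: "nat \<Rightarrow> 'a"
  assume c: "\<exists>i\<le>n. c i \<noteq> 0" and "\<not> (\<exists>p\<in>P1. (\<Sum>i\<le>n. c i * form_eval e (F i) p) \<noteq> 0)"
  then have vanish: "(\<Sum>i\<le>n. c i * form_eval e (F i) p) = 0" if "p \<in> P1" for p using that by blast
  define C where "C = (\<Sum>i<n. monom (c i) i)"
  have "poly (h * C + [:c n:]) z = 0" for z
  proof -
    have "0 = (\<Sum>i\<le>n. c i * form_eval e (F i) (1, z))" using vanish[of "(1, z)"] by (simp add: P1_def)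
    also have "\<dots> = (\<Sum>i\<le>n. c i * poly (F i) z)" by (simp add: form_eval_affine degree_F_le)
    also have "\<dots> = (\<Sum>i<n. c i * poly (F i) z) + c n"
      by (simp add: F_def flip: lessThan_Suc_atMost)
    also have "(\<Sum>i<n. c i * poly (F i) z) = poly (h * C) z"
      by (simp add: C_def F_def poly_sum poly_monom sum_distrib_left mult_ac)
    finally show ?thesis by simp
  qed
  then have "h * C + [:c n:] = 0" using poly_all_0_iff_0 by blast
  then have eq: "h * C = - [:c n:]" by (simp only: eq_neg_iff_add_eq_0)
  have "C = 0"
  proof (rule ccontr)
    assume "C \<noteq> 0"
    then have "degree (h * C) = m + degree C" by (simp add: degree_mult_eq deg_h)
    then show False using eq m by simp
  qed
  then have "c n = 0" using eq by simp
  moreover have "c i = 0" if "i < n" for i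
  proof -
    have "coeff C i = c i" using that by (simp add: C_def coeff_sum)
    then show ?thesis using \<open>C = 0\<close> by simp
  qed
  ultimately show False using c by (metis le_neq_implies_less)
qed

lemma coord_0_1: "coord F 0 1 = var"
proof -
  have "f 0 = H" "f 1 = H * var" using n f_eq(1)[of 0] f_eq(1)[of 1] by auto
  then show ?thesis unfolding Fract_eq_divide by simp
qed

text \<open>
  The quotient of the first two coordinates is \<open>x\<close>, which generates the function field.
\<close>

lemma birational_F: "birational_onto_image n F"
  unfolding birational_onto_image_def image_function_field_def
proof (intro equalityI subset_UNIV subsetI InterI, clarify)
  fix u :: "'a ratfun" and L :: "'a ratfun set"
  assume L: "is_subfield L" and c: "range const \<subseteq> L"
    and co: "\<forall>i\<le>n. \<forall>j\<le>n. F i \<noteq> 0 \<longrightarrow> coord F i j \<in> L"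
  have diff: "g - k \<in> L" and mult: "g * k \<in> L" and inv: "inverse g \<in> L" if "g \<in> L" "k \<in> L" for g k
    using L that by (auto simp: is_subfield_def)
  have zero: "0 \<in> L" using L by (simp add: is_subfield_def)
  have add: "g + k \<in> L" if "g \<in> L" "k \<in> L" for g k
    using diff[OF that(1) diff[OF zero that(2)]] by simp
  have "coord F 0 1 \<in> L" using co n by simp
  then have var: "var \<in> L" by (simp only: coord_0_1)
  have poly: "to_fract P \<in> L" for P
  proof (induction P)
    case (pCons a P)
    have "const a \<in> L" using c by blast
    then show ?case unfolding to_fract_pCons by (intro add mult var pCons.IH)
  qed (simp add: zero)
  obtain A B where "u = Fract A B" by (rule Fract_cases)
  then show "u \<in> L"
    unfolding Fract_eq_divide divide_inverse using mult[OF poly inv[OF poly zero]] by blast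
qed

lemma coord_pred:
  assumes "0 < i" "i < n" shows "coord F i (i - 1) = inverse var"
proof -
  obtain k where k: "i = Suc k" using assms(1) by (cases i) auto
  have "f i = f k * var" using f_eq(1)[of i] f_eq(1)[of k] assms by (simp add: k mult_ac)
  moreover have "f k \<noteq> 0" using assms by (simp add: k)
  ultimately have "f k / f i = 1 / var" by simp
  then show ?thesis unfolding Fract_eq_divide by (simp add: k inverse_eq_divide)
qed

lemma coord_n: "coord F n j = f j"
  unfolding Fract_eq_divide f_eq(2) by simp

text \<open>
  At each point the differential of one affine coordinate of the chart suffices: that of \<open>x\<close> in
  chart \<open>0\<close>, that of \<open>1/x\<close> in the charts \<open>0 < i < n\<close>, and that of \<open>h\<close> or \<open>h x\<close> in chart \<open>n\<close>, which
  contains the zeros of \<open>h\<close>.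
\<close>

lemma unramified_F: "unramified n e F"
  unfolding unramified_def
proof (intro ballI allI impI)
  fix p :: "'a \<times> 'a" and i
  assume p: "p \<in> P1" and i: "i \<le> n" and chart: "form_eval e (F i) p \<noteq> 0"
  have coords: "coord F i j \<in> local_ring p" for j
    by (rule coord_in_local_ring[of p F i e j, OF p degree_F_le degree_F_le chart])
  have "\<exists>j\<in>{..n}. \<forall>h\<in>local_ring p. \<exists>r\<in>local_ring p. ddx h = r * ddx (coord F i j)"
    using p
  proof (cases rule: P1_cases)
    case affine
    define z where "z = snd p / fst p"
    have O: "u \<in> local_ring p \<longleftrightarrow> regular_at z u" for u
      using affine by (simp add: O_stalk_affine z_def)
    have unit: "\<forall>h\<in>local_ring p. \<exists>r\<in>local_ring p. ddx h = r * ddx u"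
      if "ddx u \<noteq> 0" "regular_at z (inverse (ddx u))" for u
    proof
      fix h assume "h \<in> local_ring p"
      then have "regular_at z (ddx h * inverse (ddx u))"
        unfolding O by (intro regular_at_mult regular_at_ddx that)
      then show "\<exists>r\<in>local_ring p. ddx h = r * ddx u"
        using that by (intro bexI[of _ "ddx h * inverse (ddx u)"]) (auto simp: O)
    qed
    consider "i = n" "poly (pderiv h) z \<noteq> 0" | "i = n" "poly (pderiv h) z = 0"
      | "i = 0" "i < n" | "0 < i" "i < n" "poly h z \<noteq> 0" "z \<noteq> 0"
      using chart_affine[OF affine i] chart i n unfolding z_def by linarith
    then show ?thesis
    proof cases
      case 1
      have d: "ddx (coord F i 0) = H'"
        using n f_eq(1)[of 0] by (simp only: 1(1) coord_n) (simp add: ddx_to_fract)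
      have "pderiv h \<noteq> 0" using 1(2) by auto
      show ?thesis
      proof (rule bexI[of _ 0], rule unit)
        show "ddx (coord F i 0) \<noteq> 0" unfolding d using \<open>pderiv h \<noteq> 0\<close> by simp
        show "regular_at z (inverse (ddx (coord F i 0)))"
          unfolding d by (rule regular_at_inverse_to_fract[OF 1(2)])
      qed simp
    next
      case 2
      define P where "P = h + [:0, 1:] * pderiv h"
      have "f 1 = H * var" using n f_eq(1)[of 1] by simp
      then have "coord F i 1 = to_fract (h * [:0, 1:])"
        by (simp only: 2(1) coord_n to_fract_mult var_eq_to_fract)
      then have d: "ddx (coord F i 1) = to_fract P"
        by (simp add: ddx_to_fract pderiv_mult pderiv_pCons P_def mult.commute add.commute)
      have Pz: "poly P z \<noteq> 0" using simple_roots[of z] 2(2) by (auto simp: P_def)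
      then have "P \<noteq> 0" by auto
      show ?thesis
      proof (rule bexI[of _ 1], rule unit)
        show "ddx (coord F i 1) \<noteq> 0" unfolding d using \<open>P \<noteq> 0\<close> by simp
        show "regular_at z (inverse (ddx (coord F i 1)))"
          unfolding d by (rule regular_at_inverse_to_fract[OF Pz])
      qed (use n in simp)
    next
      case 3
      have d: "ddx (coord F i 1) = 1" unfolding 3(1) coord_0_1 by (rule ddx_var)
      show ?thesis
      proof (rule bexI[of _ 1], rule unit)
        show "ddx (coord F i 1) \<noteq> 0" unfolding d by simp
        show "regular_at z (inverse (ddx (coord F i 1)))"
          unfolding d using regular_at_to_fract[of z 1] by simp
      qed (use n in simp)
    next
      case 4
      have d: "ddx (coord F i (i - 1)) = - inverse (var\<^sup>2)"
        unfolding coord_pred[OF 4(1,2)] by (rule ddx_inverse_var)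
      have reg: "regular_at z (- (var\<^sup>2))"
        unfolding var_power2_eq_to_fract by (intro regular_at_uminus regular_at_to_fract)
      show ?thesis
      proof (rule bexI[of _ "i - 1"], rule unit)
        show "ddx (coord F i (i - 1)) \<noteq> 0" unfolding d by simp
        show "regular_at z (inverse (ddx (coord F i (i - 1))))"
          unfolding d using reg by simp
      qed (use i in simp)
    qed
  next
    case infinity
    have i': "i = n - 1" using chart_infinity[OF infinity i] chart by simp
    then have "0 < i" "i < n" using n by auto
    note d = ddx_inverse_var[where 'a='a, folded coord_pred[OF this]]
    have "\<exists>r\<in>local_ring p. ddx u = r * ddx (coord F i (i - 1))" if "u \<in> local_ring p" for u
    proof -
      have "deg_le 0 u" using that infinity by (simp add: O_stalk_infinity)
      from deg_le_mult[OF deg_le_var2 deg_le_0_ddx[OF this]]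
      have "deg_le 0 (- (var\<^sup>2 * ddx u))" by (intro deg_le_uminus) simp
      then show ?thesis unfolding d using infinity
        by (intro bexI[of _ "- (var\<^sup>2 * ddx u)"]) (auto simp: O_stalk_infinity)
    qed
    then show ?thesis by (intro bexI[of _ "i - 1"] ballI) (use i in auto)
  qed
  then obtain j where j: "j \<in> {..n}"
    and gen: "\<And>h. h \<in> local_ring p \<Longrightarrow> \<exists>r\<in>local_ring p. ddx h = r * ddx (coord F i j)"
    by blast
  show "generated_submodule (local_ring p) ((\<lambda>j. differential (coord F i j)) ` {..n}) = cotangent_stalk p"
    by (rule cotangent_stalk_generated[where u="coord F i", OF p coords j gen])
qed


section \<open>The normal bundle of the curve on the cone\<close>

text \<open>
  The \<open>n - 1\<close> relations as linear forms on \<open>\<O>(e)^(n+1)\<close>. Those with \<open>r < n - 2\<close> express that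
  \<open>(1, x, \<dots>, x^(n-1))\<close> and its derivative satisfy a linear recurrence with characteristic polynomial
  \<open>(X - x)^2\<close>. The last one is found by solving \<open>\<alpha> h + \<beta> h x + \<gamma> = 0\<close> together with the equation
  \<open>\<alpha> h' + \<beta> (h x)' = 0\<close> for the derivatives.
\<close>

definition normal_coords :: "(nat \<Rightarrow> 'a ratfun) \<Rightarrow> nat \<Rightarrow> 'a ratfun" where
  "normal_coords v r =
    (if r < n - 2 then var\<^sup>2 * v r - 2 * (var * v (r + 1)) + v (r + 2)
     else if r = n - 2 then H' * v 1 - (H + var * H') * v 0 + H\<^sup>2 * v n
     else 0)"

lemma normal_coords_low:
  "r < n - 2 \<Longrightarrow> normal_coords v r = var\<^sup>2 * v r - 2 * (var * v (r + 1)) + v (r + 2)"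
  by (simp only: normal_coords_def if_True)

lemma normal_coords_last: "normal_coords v (n - 2) = H' * v 1 - (H + var * H') * v 0 + H\<^sup>2 * v n"
  unfolding normal_coords_def by simp

lemma normal_coords_cong:
  assumes "\<And>j. j \<le> n \<Longrightarrow> u j = v j"
  shows "normal_coords u = normal_coords v"
  using n by (auto simp: normal_coords_def fun_eq_iff assms)

lemma normal_coords_add: "normal_coords (\<lambda>j. u j + v j) r = normal_coords u r + normal_coords v r"
  by (simp add: normal_coords_def algebra_simps)

lemma normal_coords_scale: "normal_coords (\<lambda>j. g * v j) r = g * normal_coords v r"
  by (simp add: normal_coords_def algebra_simps)

lemma f_Suc: "Suc r < n \<Longrightarrow> f (Suc r) = var * f r"
  by (simp add: f_eq(1) mult_ac)

lemma normal_coords_f: "normal_coords f r = 0"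
proof -
  consider "r < n - 2" | "r = n - 2" | "r > n - 2" by linarith
  then show ?thesis
  proof cases
    case 1
    then have "f (r + 1) = var * f r" "f (r + 2) = var * (var * f r)"
      using f_Suc[of r] f_Suc[of "Suc r"] by auto
    then show ?thesis using 1 by (simp add: normal_coords_def power2_eq_square)
  next
    case 2
    have "f 0 = H" "f 1 = H * var" "f n = 1" using n f_eq(1)[of 0] f_eq(1)[of 1] f_eq(2) by auto
    then show ?thesis using 2 by (simp add: normal_coords_def power2_eq_square algebra_simps)
  next
    case 3
    then show ?thesis by (simp add: normal_coords_def)
  qed
qed

lemma normal_coords_ddx: "normal_coords (\<lambda>j. ddx (f j)) r = 0"
proof -
  note [simp] = Der_mult[OF ddx_Der] ddx_var ddx_to_fract
  consider "r < n - 2" | "r = n - 2" | "r > n - 2" by linarith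
  then show ?thesis
  proof cases
    case 1
    then have "f (r + 1) = var * f r" "f (r + 2) = var * (var * f r)"
      using f_Suc[of r] f_Suc[of "Suc r"] by auto
    then have "ddx (f (r + 1)) = var * ddx (f r) + f r"
      "ddx (f (r + 2)) = var * (var * ddx (f r) + f r) + var * f r"
      by (simp_all only: Der_mult[OF ddx_Der] ddx_var mult_1_right)
    then show ?thesis using 1 by (simp only: normal_coords_low) (simp add: power2_eq_square algebra_simps)
  next
    case 2
    have "f 0 = H" "f 1 = H * var" "f n = 1" using n f_eq(1)[of 0] f_eq(1)[of 1] f_eq(2) by auto
    then have "ddx (f 0) = H'" "ddx (f 1) = H + var * H'" "ddx (f n) = 0"
      by (simp_all add: Der_1[OF ddx_Der] del: One_nat_def)
    then show ?thesis using 2 by (simp only: normal_coords_last) (simp add: algebra_simps)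
  next
    case 3
    then show ?thesis by (simp add: normal_coords_def)
  qed
qed

lemma normal_coords_diff_multiple:
  assumes "\<And>j. j \<le> n \<Longrightarrow> u j = v j - c * f j"
  shows "normal_coords u = normal_coords v"
proof
  fix r
  have "normal_coords u = normal_coords (\<lambda>j. v j + (- c) * f j)"
    by (rule normal_coords_cong) (simp add: assms)
  then show "normal_coords u r = normal_coords v r"
    by (simp only: normal_coords_add normal_coords_scale normal_coords_f mult_zero_right add_0_right)
qed

text \<open>
  The forms vanish on \<open>f\<close>, so they descend along the Euler sequence to the pulled back tangent
  bundle; chart \<open>0\<close> is a choice that does not matter by \<open>normal_map_chart\<close>.
\<close>

definition normal_map :: "(nat \<Rightarrow> nat \<Rightarrow> 'a ratfun) \<Rightarrow> nat \<Rightarrow> 'a ratfun" where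
  "normal_map w = normal_coords (\<lambda>j. f 0 * w 0 j)"

lemma normal_map_chart:
  assumes "w \<in> pullback_tangent_generic n F" "i \<le> n"
  shows "normal_map w = normal_coords (\<lambda>j. f i * w i j)"
  unfolding normal_map_def
proof (rule normal_coords_diff_multiple)
  fix j assume "j \<le> n"
  then have "f 0 * w 0 j = f i * w i j - f j / f 0 * (f i * w i 0)"
    by (intro generic_chart_change[OF assms(1)]) (use assms in auto)
  then show "f 0 * w 0 j = f i * w i j - f i * w i 0 / f 0 * f j"
    by (simp add: mult_ac)
qed

lemma normal_map_lift: "normal_map (lift_tangent n F v) = normal_coords v"
  unfolding normal_map_def
proof (rule normal_coords_diff_multiple)
  fix j assume "j \<le> n"
  then show "f 0 * lift_tangent n F v 0 j = v j - v 0 / f 0 * f j"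
    by (simp add: lift_tangent_def mult_ac)
qed

lemma normal_map_tangent:
  assumes "\<theta> \<in> Der" shows "normal_map (tangent_map n F \<theta>) = (\<lambda>_. 0)"
proof -
  have "normal_map (tangent_map n F \<theta>) = normal_coords (\<lambda>j. \<theta> var * ddx (f j))"
    unfolding normal_map_def
  proof (rule normal_coords_diff_multiple)
    fix j assume j: "j \<le> n"
    have "f 0 * tangent_map n F \<theta> 0 j = f 0 * \<theta> (f j / f 0)"
      using j by (simp only: tangent_map_def Fract_eq_divide) simp
    also have "\<dots> = \<theta> (f j) - \<theta> (f 0) / f 0 * f j"
      using Der_divide[OF assms, of "f 0" "f j"] by (simp add: right_diff_distrib power2_eq_square mult_ac)
    also have "\<theta> (f j) = \<theta> var * ddx (f j)" by (rule Der_eq_ddx[OF assms])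
    finally show "f 0 * tangent_map n F \<theta> 0 j = \<theta> var * ddx (f j) - \<theta> (f 0) / f 0 * f j" .
  qed
  then show ?thesis by (simp only: fun_eq_iff normal_coords_scale normal_coords_ddx mult_zero_right) simp
qed

abbreviation ds :: "int list" where "ds \<equiv> normal_degrees e (b_two n e)"

lemma length_ds: "length ds = Suc (n - 2)"
  by (simp add: b_two_def)

lemma ds_nth: "r < n - 2 \<Longrightarrow> ds ! r = int e + 2" "ds ! (n - 2) = int e + 2 * int m"
  using e by (simp_all add: b_two_def nth_append)

lemma degree_pderiv_h: "degree (pderiv h) \<le> m"
  using degree_pderiv_le_diff[of h] deg_h by linarith

text \<open>
  The coefficients of the relations are forms of degree \<open>2\<close> and \<open>2 m\<close>, so the relations map
  \<open>\<O>(e)^(n+1)\<close> to \<open>\<O>(e+2)^(n-2) \<oplus> \<O>(e+2m)\<close>.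
\<close>

lemma normal_coords_in_sum_stalk:
  assumes p: "p \<in> P1" and v: "\<And>j. j \<le> n \<Longrightarrow> v j \<in> O_stalk (int e) p"
  shows "normal_coords v \<in> sum_stalk ds p"
proof -
  have mem: "to_fract P * v j \<in> O_stalk (int e + int d) p" if "degree P \<le> d" "j \<le> n" for P d j
    using O_stalk_mult[OF p v[OF that(2)] to_fract_in_O_stalk[OF that(1)]] by (simp add: mult.commute)
  have "normal_coords v r \<in> O_stalk (int e + 2) p" if r: "r < n - 2" for r
  proof -
    have 1: "var\<^sup>2 * v r \<in> O_stalk (int e + 2) p"
      using mem[of "monom 1 2" 2 r] r by (simp add: var_power2_eq_to_fract degree_monom_eq)
    have 2: "var * v (r + 1) \<in> O_stalk (int e + 2) p"
      using mem[of "[:0, 1:]" 2 "r + 1"] r by (simp add: var_eq_to_fract)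
    have 3: "v (r + 2) \<in> O_stalk (int e + 2) p"
      using mem[of 1 2 "r + 2"] r by simp
    have "normal_coords v r = var\<^sup>2 * v r - (var * v (r + 1) + var * v (r + 1)) + v (r + 2)"
      using r by (simp only: normal_coords_low mult_2)
    then show ?thesis by (simp only: O_stalk_add[OF p] O_stalk_diff[OF p] 1 2 3)
  qed
  moreover have "normal_coords v (n - 2) \<in> O_stalk (int e + 2 * int m) p"
  proof -
    have 1: "H' * v 1 \<in> O_stalk (int e + 2 * int m) p"
      using mem[of "pderiv h" "2 * m" 1] degree_pderiv_h n by simp
    have "degree (h + [:0, 1:] * pderiv h) \<le> 2 * m"
      using degree_pderiv_h deg_h m degree_mult_le[of "[:0, 1:]" "pderiv h"]
      by (intro degree_add_le) (simp_all add: degree_mult_le order_trans)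
    from mem[OF this, of 0]
    have 2: "(H + var * H') * v 0 \<in> O_stalk (int e + 2 * int m) p"
      by (simp only: var_eq_to_fract to_fract_add to_fract_mult of_nat_mult of_nat_numeral le0)
    have "degree (h ^ 2) \<le> 2 * m" using degree_power_le[of h 2] deg_h by (simp add: mult.commute)
    from mem[OF this, of n]
    have 3: "H\<^sup>2 * v n \<in> O_stalk (int e + 2 * int m) p" by (simp add: power2_eq_square)
    show ?thesis by (simp only: normal_coords_last O_stalk_add[OF p] O_stalk_diff[OF p] 1 2 3)
  qed
  moreover have "normal_coords v r = 0" if "Suc (n - 2) \<le> r" for r
    using that by (simp add: normal_coords_def)
  ultimately show ?thesis
    unfolding sum_stalk_def length_ds by (auto simp only: less_Suc_eq ds_nth mem_Collect_eq)
qed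

lemma H_square_cancel: "H\<^sup>2 * (inverse (to_fract (h * h)) * x) = x"
proof -
  define y where "y = to_fract (h * h)"
  have "H\<^sup>2 = y" "y \<noteq> 0" by (simp_all add: y_def power2_eq_square)
  then show ?thesis unfolding y_def[symmetric] by (simp flip: mult.assoc)
qed

text \<open>
  Over a finite point the quadratic relations are solved upwards for \<open>v (r + 2)\<close>, whose coefficient
  is \<open>1\<close>, once \<open>v 0\<close>, \<open>v 1\<close> and \<open>v n\<close> satisfy the last relation; this is possible because \<open>h'\<close> or
  \<open>h^2\<close> is a unit there. At infinity the coefficients \<open>x^2\<close> of \<open>v r\<close> and \<open>h^2\<close> of \<open>v n\<close> generate
  \<open>\<O>(2)\<close> and \<open>\<O>(2m)\<close>, so one starts with \<open>v (n - 1) = v (n - 2) = 0\<close>, solves downwards, and obtains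
  \<open>v n\<close> from the last relation.
\<close>

lemma normal_coords_surj:
  assumes p: "p \<in> P1" and s: "s \<in> sum_stalk ds p"
  shows "\<exists>v. (\<forall>j\<le>n. v j \<in> O_stalk (int e) p) \<and> normal_coords v = s"
proof -
  have s_low: "s r \<in> O_stalk (int e + 2) p" if "r < n - 2" for r
  proof -
    have "s r \<in> O_stalk (ds ! r) p" using s that unfolding sum_stalk_def length_ds by simp
    then show ?thesis by (simp only: ds_nth(1)[OF that])
  qed
  have s_last: "s (n - 2) \<in> O_stalk (int e + 2 * int m) p"
  proof -
    have "s (n - 2) \<in> O_stalk (ds ! (n - 2)) p" using s unfolding sum_stalk_def length_ds by simp
    then show ?thesis by (simp only: ds_nth(2))
  qed
  have s_out: "s r = 0" if "n - 2 < r" for r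
    using s that unfolding sum_stalk_def length_ds by simp
  have eqI: "normal_coords v = s"
    if low: "\<And>r. r < n - 2 \<Longrightarrow> var\<^sup>2 * v r - 2 * (var * v (r + 1)) + v (r + 2) = s r"
      and last: "H' * v 1 - (H + var * H') * v 0 + H\<^sup>2 * v n = s (n - 2)" for v
  proof
    fix r
    consider "r < n - 2" | "r = n - 2" | "n - 2 < r" by linarith
    then show "normal_coords v r = s r"
    proof cases
      case 1
      then show ?thesis using low[OF 1] by (simp only: normal_coords_low)
    next
      case 2
      then show ?thesis using last by (simp only: normal_coords_last)
    next
      case 3
      then show ?thesis using s_out[OF 3] by (simp add: normal_coords_def)
    qed
  qed
  show ?thesis
    using p
  proof (cases rule: P1_cases)
    case affine
    define z where "z = snd p / fst p"
    have O: "u \<in> O_stalk k p \<longleftrightarrow> regular_at z u" for u k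
      using affine by (simp add: O_stalk_affine z_def)
    obtain b c where bc: "H' * b + H\<^sup>2 * c = s (n - 2)" "regular_at z b" "regular_at z c"
    proof (cases "poly h z = 0")
      case True
      define b where "b = inverse H' * s (n - 2)"
      have "pderiv h \<noteq> 0" using simple_roots[OF True] by auto
      then have "H' * b + H\<^sup>2 * 0 = s (n - 2)" by (simp add: b_def flip: mult.assoc)
      moreover have "regular_at z b"
        unfolding b_def using s_last[unfolded O] simple_roots[OF True]
        by (intro regular_at_mult regular_at_inverse_to_fract)
      moreover have "regular_at z 0" by (rule regular_at_zero)
      ultimately show ?thesis by (rule that)
    next
      case False
      define c where "c = inverse (to_fract (h * h)) * s (n - 2)"
      have "H' * 0 + H\<^sup>2 * c = s (n - 2)"
        unfolding c_def H_square_cancel by simp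
      moreover have "regular_at z c"
        unfolding c_def using s_last[unfolded O] False
        by (intro regular_at_mult regular_at_inverse_to_fract) auto
      moreover have "regular_at z 0" by (rule regular_at_zero)
      ultimately show ?thesis using that by blast
    qed
    define t where "t = two_step (\<lambda>x y k. s k - var\<^sup>2 * x + 2 * (var * y)) 0 b"
    have t0: "t 0 = 0" "t 1 = b" "\<And>k. t (k + 2) = s k - var\<^sup>2 * t k + 2 * (var * t (k + 1))"
      by (simp_all add: t_def)
    have t: "regular_at z (t k) \<and> regular_at z (t (Suc k))" if "Suc k < n" for k
      using that
    proof (induction k)
      case 0
      then show ?case using t0(1,2) bc(2) by (simp add: regular_at_zero)
    next
      case (Suc k)
      have "regular_at z (s k)" using s_low[of k] Suc.prems by (simp add: O)
      moreover have "regular_at z (var\<^sup>2 * t k)" "regular_at z (var * t (k + 1))"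
        using Suc unfolding var_eq_to_fract power2_eq_square
        by (auto intro!: regular_at_mult regular_at_to_fract)
      ultimately have "regular_at z (t (k + 2))"
        unfolding t0(3) mult_2 by (intro regular_at_add regular_at_diff)
      then show ?case using Suc by simp
    qed
    have t': "regular_at z (t k)" if "k < n" for k
      using t[of k] t[of "k - 1"] that n by (cases k) auto
    define v where "v = (\<lambda>j. if j < n then t j else c)"
    have "normal_coords v = s"
    proof (rule eqI)
      fix r assume "r < n - 2"
      then have "r < n" "r + 1 < n" "r + 2 < n" by auto
      then have "v r = t r" "v (r + 1) = t (r + 1)" "v (r + 2) = t (r + 2)"
        by (simp_all only: v_def if_True)
      then show "var\<^sup>2 * v r - 2 * (var * v (r + 1)) + v (r + 2) = s r"
        by (simp only: t0(3)) simp
    next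
      have "v 0 = 0" "v 1 = b" "v n = c" using t0(1,2) n by (simp_all add: v_def)
      then show "H' * v 1 - (H + var * H') * v 0 + H\<^sup>2 * v n = s (n - 2)"
        using bc(1) by (simp only: mult_zero_right diff_zero)
    qed
    moreover have "v j \<in> O_stalk (int e) p" for j
      unfolding O v_def using t' bc(3) by simp
    ultimately show ?thesis by (intro exI[of _ v] conjI allI impI)
  next
    case infinity
    have O: "u \<in> O_stalk k p \<longleftrightarrow> deg_le k u" for u k
      using infinity by (simp add: O_stalk_infinity)
    define t where
      "t = two_step (\<lambda>x y k. inverse (var\<^sup>2) * (s (n - 3 - k) + 2 * (var * y) - x)) 0 0"
    have t0: "t 0 = 0" "t 1 = 0"
      "\<And>k. t (k + 2) = inverse (var\<^sup>2) * (s (n - 3 - k) + 2 * (var * t (k + 1)) - t k)"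
      by (simp_all add: t_def)
    have t: "deg_le (int e) (t k) \<and> deg_le (int e) (t (Suc k))" if "Suc k < n" for k
      using that
    proof (induction k)
      case 0
      then show ?case using t0(1,2) by (simp add: deg_le_zero)
    next
      case (Suc k)
      have IH: "deg_le (int e) (t k)" "deg_le (int e) (t (k + 1))" using Suc by auto
      have 1: "deg_le (int e + 2) (s (n - 3 - k))"
        using s_low[of "n - 3 - k"] Suc.prems by (simp add: O)
      have 2: "deg_le (int e + 2) (var * t (k + 1))"
        using deg_le_mult[OF deg_le_var IH(2)] by (rule deg_le_mono) simp
      have 3: "deg_le (int e + 2) (t k)"
        using IH(1) by (rule deg_le_mono) simp
      have "deg_le (int e + 2) (s (n - 3 - k) + 2 * (var * t (k + 1)) - t k)"
        unfolding mult_2 by (intro deg_le_add deg_le_diff 1 2 3)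
      from deg_le_mult[OF deg_le_inverse_var2 this]
      have "deg_le (int e) (t (k + 2))" unfolding t0(3) by simp
      then show ?case using IH by simp
    qed
    have t': "deg_le (int e) (t k)" if "k < n" for k
      using t[of k] t[of "k - 1"] that n by (cases k) auto
    define c where "c = inverse (to_fract (h * h)) *
      (s (n - 2) - H' * t (n - 2) + (H + var * H') * t (n - 1))"
    define v where "v = (\<lambda>j. if j < n then t (n - 1 - j) else c)"
    have H2: "H\<^sup>2 * c = s (n - 2) - H' * t (n - 2) + (H + var * H') * t (n - 1)"
      unfolding c_def by (rule H_square_cancel)
    have "normal_coords v = s"
    proof (rule eqI)
      fix r assume r: "r < n - 2"
      define k where "k = n - 3 - r"
      have k: "n - 1 - r = k + 2" "n - 1 - (r + 1) = k + 1" "n - 1 - (r + 2) = k" "n - 3 - k = r"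
        using r by (simp_all add: k_def)
      have "r < n" "r + 1 < n" "r + 2 < n" using r by auto
      then have "v r = t (n - 1 - r)" "v (r + 1) = t (n - 1 - (r + 1))" "v (r + 2) = t (n - 1 - (r + 2))"
        by (simp_all only: v_def if_True)
      then have v: "v r = t (k + 2)" "v (r + 1) = t (k + 1)" "v (r + 2) = t k"
        by (simp_all only: k)
      have "var\<^sup>2 * t (k + 2) = s r + 2 * (var * t (k + 1)) - t k"
        unfolding t0(3) k(4) by (simp flip: mult.assoc)
      then show "var\<^sup>2 * v r - 2 * (var * v (r + 1)) + v (r + 2) = s r"
        unfolding v by simp
    next
      have "v 0 = t (n - 1)" "v 1 = t (n - 2)" "v n = c" using n by (simp_all add: v_def numeral_2_eq_2)
      then show "H' * v 1 - (H + var * H') * v 0 + H\<^sup>2 * v n = s (n - 2)"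
        using H2 by simp
    qed
    moreover have "deg_le (int e) c"
    proof -
      have "deg_le (int m) H'" by (rule deg_le_to_fract[OF degree_pderiv_h])
      from deg_le_mult[OF this t'[of "n - 2"]] have 1: "deg_le (int e + 2 * int m) (H' * t (n - 2))"
        using n by (auto elim: deg_le_mono)
      have "deg_le (int m + 1) H" using deg_le_to_fract[of h m] deg_h by (auto elim: deg_le_mono)
      moreover have "deg_le (int m + 1) (var * H')"
        using deg_le_mult[OF deg_le_var \<open>deg_le (int m) H'\<close>] by (simp add: add.commute)
      ultimately have "deg_le (int m + 1) (H + var * H')" by (rule deg_le_add)
      from deg_le_mult[OF this t'[of "n - 1"]]
      have 2: "deg_le (int e + 2 * int m) ((H + var * H') * t (n - 1))"
        using n m by (auto elim: deg_le_mono)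
      have "deg_le (int e + 2 * int m) (s (n - 2) - H' * t (n - 2) + (H + var * H') * t (n - 1))"
        using s_last[unfolded O] by (intro deg_le_add deg_le_diff 1 2)
      moreover have "deg_le (- (2 * int m)) (inverse (to_fract (h * h)))"
        using deg_le_inverse_to_fract[of "h * h"] deg_h by (simp add: degree_mult_eq)
      ultimately have "deg_le (- (2 * int m) + (int e + 2 * int m)) c"
        unfolding c_def by (intro deg_le_mult)
      then show ?thesis by simp
    qed
    then have "v j \<in> O_stalk (int e) p" for j
      unfolding O v_def using t' by simp
    ultimately show ?thesis by (intro exI[of _ v] conjI allI impI)
  qed
qed

text \<open>
  A tangent vector \<open>w\<close> in the kernel is compared with \<open>g f'\<close>, where \<open>g = w 0 1\<close>: the difference
  vanishes in the coordinates \<open>0\<close> and \<open>1\<close>, hence by the recurrences in all of them. Regularity of the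
  vector field \<open>g d/dx\<close> is read off from an entry of \<open>w\<close> in a chart around the point, namely
  \<open>g\<close>, \<open>g h'\<close> at a zero of \<open>h\<close>, and \<open>- g / x^2\<close> at infinity.
\<close>

lemma normal_map_kernel:
  assumes p: "p \<in> P1" and w: "w \<in> pullback_tangent_stalk n e F p" and ker: "normal_map w = 0"
  shows "w \<in> tangent_map n F ` tangent_stalk p"
proof -
  have gen: "w \<in> pullback_tangent_generic n F" using w by (simp add: pullback_tangent_stalk_def)
  have stalk: "w i j \<in> local_ring p" if "i \<le> n" "form_eval e (F i) p \<noteq> 0" "j \<le> n" for i j
    using w that by (simp add: pullback_tangent_stalk_def)
  define g where "g = w 0 1"
  define \<theta> where "\<theta> = (\<lambda>u. g * ddx u)"
  have \<theta>: "\<theta> \<in> Der" unfolding \<theta>_def by (rule Der_scale[OF ddx_Der])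
  have gen': "tangent_map n F \<theta> \<in> pullback_tangent_generic n F" by (rule tangent_map_generic[OF \<theta>])
  define d where "d = (\<lambda>j. f 0 * (w 0 j - tangent_map n F \<theta> 0 j))"
  have nd: "normal_coords d r = 0" for r
  proof -
    have "d = (\<lambda>j. f 0 * w 0 j + (- 1) * (f 0 * tangent_map n F \<theta> 0 j))"
      by (simp add: d_def fun_eq_iff right_diff_distrib)
    then have "normal_coords d r = normal_map w r + (- 1) * normal_map (tangent_map n F \<theta>) r"
      by (simp only: normal_coords_add normal_coords_scale normal_map_def)
    then show ?thesis by (simp add: ker normal_map_tangent[OF \<theta>])
  qed
  have "d 0 = 0"
    using gen gen' by (simp add: d_def pullback_tangent_generic_def)
  moreover have "d 1 = 0"
  proof -
    have "tangent_map n F \<theta> 0 1 = \<theta> (coord F 0 1)" using n by (simp add: tangent_map_def)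
    also have "\<dots> = g" unfolding coord_0_1 by (simp add: \<theta>_def ddx_var)
    finally show ?thesis by (simp add: d_def g_def)
  qed
  ultimately have pair: "d k = 0 \<and> d (Suc k) = 0" if "Suc k < n" for k
    using that
  proof (induction k)
    case (Suc k)
    then have "d k = 0" "d (k + 1) = 0" "k < n - 2" by auto
    then have "d (k + 2) = 0"
      using nd[of k] by (simp only: normal_coords_low mult_zero_right) simp
    then show ?case using Suc by simp
  qed simp
  have d_low: "d j = 0" if "j < n" for j
    using pair[of j] pair[of "j - 1"] that n by (cases j) auto
  have "d n = 0"
  proof -
    have "d 0 = 0" "d 1 = 0" using d_low n by auto
    then have "H\<^sup>2 * d n = 0"
      using nd[of "n - 2"] by (simp only: normal_coords_last mult_zero_right) simp
    then show ?thesis by simp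
  qed
  with d_low have "d j = 0" if "j \<le> n" for j using that by (cases "j = n") auto
  then have "w 0 j = tangent_map n F \<theta> 0 j" if "j \<le> n" for j
    using that by (simp add: d_def)
  then have w_eq: "w = tangent_map n F \<theta>"
    by (intro generic_eqI[OF gen gen', of 0]) auto
  have w_entry: "w i j = g * ddx (coord F i j)" if "i \<le> n" "j \<le> n" for i j
    unfolding w_eq using that by (simp add: tangent_map_def \<theta>_def)
  have "\<theta> \<in> tangent_stalk p"
    using p
  proof (cases rule: P1_cases)
    case affine
    define z where "z = snd p / fst p"
    have O: "u \<in> local_ring p \<longleftrightarrow> regular_at z u" for u
      using affine by (simp add: O_stalk_affine z_def)
    have "regular_at z g"
    proof (cases "poly h z = 0")
      case False
      then have "form_eval e (F 0) p \<noteq> 0" using chart_affine[OF affine, of 0] by (simp add: z_def)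
      then show ?thesis using stalk[of 0 1] n by (simp add: g_def O)
    next
      case True
      have "form_eval e (F n) p \<noteq> 0" using chart_affine[OF affine, of n] by simp
      then have "regular_at z (w n 0)" using stalk[of n 0] by (simp add: O)
      moreover have "w n 0 = g * H'"
      proof -
        have "coord F n 0 = H" using f_eq(1)[of 0] n by (simp only: coord_n) simp
        then show ?thesis using w_entry[of n 0] by (simp add: ddx_to_fract)
      qed
      moreover have "regular_at z (inverse H')"
        by (rule regular_at_inverse_to_fract[OF simple_roots[OF True]])
      ultimately have "regular_at z (g * H' * inverse H')" by (simp only: regular_at_mult)
      moreover have "pderiv h \<noteq> 0" using simple_roots[OF True] by auto
      ultimately show ?thesis by (simp add: mult.assoc)
    qed
    then show ?thesis unfolding \<theta>_def using tangent_stalk_affine[OF affine] by (simp add: z_def)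
  next
    case infinity
    have chart: "form_eval e (F (n - 1)) p \<noteq> 0" using chart_infinity[OF infinity, of "n - 1"] by simp
    have "w (n - 1) (n - 1 - 1) = g * ddx (coord F (n - 1) (n - 1 - 1))" by (rule w_entry) auto
    also have "coord F (n - 1) (n - 1 - 1) = inverse var" by (rule coord_pred) (use n in auto)
    finally have eq: "w (n - 1) (n - 1 - 1) = - (g * inverse (var\<^sup>2))"
      by (simp add: ddx_inverse_var)
    have "w (n - 1) (n - 1 - 1) \<in> local_ring p" by (rule stalk[OF _ chart]) auto
    then have "deg_le 0 (- (g * inverse (var\<^sup>2)))" unfolding eq using infinity by (simp add: O_stalk_infinity)
    from deg_le_mult[OF deg_le_uminus[OF this] deg_le_var2]
    have "deg_le 2 g" by (simp add: mult.assoc)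
    then show ?thesis unfolding \<theta>_def by (rule tangent_stalk_infinityI[OF infinity])
  qed
  then show ?thesis using w_eq by blast
qed

lemma normal_map_image:
  assumes "p \<in> P1"
  shows "normal_map ` pullback_tangent_stalk n e F p = sum_stalk ds p"
proof
  show "normal_map ` pullback_tangent_stalk n e F p \<subseteq> sum_stalk ds p"
  proof
    fix s assume "s \<in> normal_map ` pullback_tangent_stalk n e F p"
    then obtain w where w: "w \<in> pullback_tangent_stalk n e F p" "s = normal_map w" by blast
    obtain i where i: "i \<le> n" "form_eval e (F i) p \<noteq> 0" using chart_exists[OF assms] by blast
    have "f i * w i j \<in> O_stalk (int e) p" if "j \<le> n" for j
    proof -
      have "w i j \<in> local_ring p" using w(1) i that by (simp add: pullback_tangent_stalk_def)
      from O_stalk_mult[OF assms to_fract_in_O_stalk[OF degree_F_le[of i]] this]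
      show ?thesis by simp
    qed
    then have "normal_coords (\<lambda>j. f i * w i j) \<in> sum_stalk ds p"
      by (rule normal_coords_in_sum_stalk[OF assms])
    moreover have "w \<in> pullback_tangent_generic n F" using w(1) by (simp add: pullback_tangent_stalk_def)
    ultimately show "s \<in> sum_stalk ds p" unfolding w(2) using normal_map_chart[of w i] i by simp
  qed
  show "sum_stalk ds p \<subseteq> normal_map ` pullback_tangent_stalk n e F p"
  proof
    fix s assume "s \<in> sum_stalk ds p"
    then obtain v where v: "\<forall>j\<le>n. v j \<in> O_stalk (int e) p" "normal_coords v = s"
      using normal_coords_surj[OF assms] by blast
    have "lift_tangent n F v \<in> pullback_tangent_stalk n e F p"
      by (rule lift_tangent_stalk[OF assms degree_F_le]) (use v in auto)
    then show "s \<in> normal_map ` pullback_tangent_stalk n e F p"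
      using normal_map_lift[of v] v(2) by (metis imageI)
  qed
qed

lemma normal_bundle_F: "normal_bundle_iso_sum n e F ds"
  unfolding normal_bundle_iso_sum_def
proof (intro exI[of _ normal_map] conjI ballI allI)
  fix w w' :: "nat \<Rightarrow> nat \<Rightarrow> 'a ratfun"
  show "normal_map (w + w') = normal_map w + normal_map w'"
    unfolding normal_map_def
    by (simp add: fun_eq_iff distrib_left normal_coords_add)
next
  fix g and w :: "nat \<Rightarrow> nat \<Rightarrow> 'a ratfun"
  have "normal_map (\<lambda>i j. g * w i j) = normal_coords (\<lambda>j. g * (f 0 * w 0 j))"
    unfolding normal_map_def by (simp add: mult_ac)
  then show "normal_map (\<lambda>i j. g * w i j) = (\<lambda>i. g * normal_map w i)"
    by (simp only: normal_map_def normal_coords_scale fun_eq_iff) simp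
next
  fix p :: "'a \<times> 'a" assume p: "p \<in> P1"
  show "inj_on (tangent_map n F) (tangent_stalk p)"
  proof (rule inj_onI)
    fix \<theta> \<theta>' assume *: "\<theta> \<in> tangent_stalk p" "\<theta>' \<in> tangent_stalk p"
      "tangent_map n F \<theta> = tangent_map n F \<theta>'"
    have "tangent_map n F \<eta> 0 1 = \<eta> var" for \<eta>
      unfolding coord_0_1[symmetric] using n by (simp add: tangent_map_def)
    then have "\<theta> var = \<theta>' var" using *(3) by metis
    then show "\<theta> = \<theta>'" using * by (intro Der_eqI) (auto simp: tangent_stalk_def)
  qed
  show "tangent_map n F ` tangent_stalk p = {w \<in> pullback_tangent_stalk n e F p. normal_map w = 0}"
  proof
    show "tangent_map n F ` tangent_stalk p \<subseteq> {w \<in> pullback_tangent_stalk n e F p. normal_map w = 0}"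
    proof
      fix w assume "w \<in> tangent_map n F ` tangent_stalk p"
      then obtain \<theta> where \<theta>: "\<theta> \<in> tangent_stalk p" "w = tangent_map n F \<theta>" by blast
      then have "normal_map w = (\<lambda>_. 0)"
        using normal_map_tangent by (simp add: tangent_stalk_def)
      moreover have "w \<in> pullback_tangent_stalk n e F p"
        unfolding \<theta>(2) by (rule tangent_map_stalk[OF \<theta>(1) p degree_F_le])
      ultimately show "w \<in> {w \<in> pullback_tangent_stalk n e F p. normal_map w = 0}"
        by (simp add: zero_fun_def)
    qed
    show "{w \<in> pullback_tangent_stalk n e F p. normal_map w = 0} \<subseteq> tangent_map n F ` tangent_stalk p"
      using normal_map_kernel[OF p] by blast
  qed
  show "normal_map ` pullback_tangent_stalk n e F p = sum_stalk ds p"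
    by (rule normal_map_image[OF p])
qed

end


section \<open>Nonemptiness of the locus\<close>

lemma coord_smult:
  assumes "c \<noteq> 0" shows "coord (\<lambda>i. smult c (F i)) = coord F"
proof (intro ext)
  fix i j
  have "to_fract (smult c P) = to_fract [:c:] * to_fract P" for P
    by (simp flip: to_fract_mult)
  moreover have "to_fract [:c:] \<noteq> 0" using assms by simp
  ultimately show "coord (\<lambda>i. smult c (F i)) i j = coord F i j"
    unfolding Fract_eq_divide by simp
qed

lemma form_eval_smult: "form_eval d (smult c P) p = c * form_eval d P p"
  by (simp add: form_eval_def sum_distrib_left mult_ac)

text \<open>
  All properties in the definition of the locus depend on the forms only through their ratios and
  zeros.
\<close>

lemma predicates_smult:
  assumes c: "c \<noteq> 0"
  shows "nondegenerate n e (\<lambda>i. smult c (F i)) = nondegenerate n e F"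
    and "unramified n e (\<lambda>i. smult c (F i)) = unramified n e F"
    and "birational_onto_image n (\<lambda>i. smult c (F i)) = birational_onto_image n F"
    and "normal_bundle_iso_sum n e (\<lambda>i. smult c (F i)) ds = normal_bundle_iso_sum n e F ds"
proof -
  let ?G = "\<lambda>i. smult c (F i)"
  have coord: "Fract (smult c (F j)) (smult c (F i)) = coord F i j" for i j
    using fun_cong[OF fun_cong[OF coord_smult[OF c, of F]]] by simp
  have zero: "smult c P = 0 \<longleftrightarrow> P = 0" for P :: "'a poly" using c by simp
  have eval: "form_eval e (smult c (F i)) p \<noteq> 0 \<longleftrightarrow> form_eval e (F i) p \<noteq> 0" for i p
    using c by (simp add: form_eval_smult)
  have "(\<Sum>i\<le>n. a i * form_eval e (?G i) p) = c * (\<Sum>i\<le>n. a i * form_eval e (F i) p)" for a p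
    by (simp add: form_eval_smult sum_distrib_left mult_ac)
  then show "nondegenerate n e ?G = nondegenerate n e F"
    using c by (simp only: nondegenerate_def mult_eq_0_iff simp_thms)
  show "unramified n e ?G = unramified n e F"
    unfolding unramified_def coord eval ..
  show "birational_onto_image n ?G = birational_onto_image n F"
    unfolding birational_onto_image_def image_function_field_def coord zero ..
  have generic: "pullback_tangent_generic n ?G = pullback_tangent_generic n F"
    unfolding pullback_tangent_generic_def coord zero ..
  have stalk: "pullback_tangent_stalk n e ?G = pullback_tangent_stalk n e F"
    unfolding pullback_tangent_stalk_def generic eval ..
  have tangent: "tangent_map n ?G = tangent_map n F"
    unfolding tangent_map_def coord zero ..
  show "normal_bundle_iso_sum n e ?G ds = normal_bundle_iso_sum n e F ds"
    unfolding normal_bundle_iso_sum_def generic stalk tangent ..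
qed

text \<open>
  The polynomial \<open>x^m - 1\<close> has simple roots: a root is nonzero, and then so is \<open>m x^(m-1)\<close>, the
  characteristic being zero.
\<close>

lemma normal_locus_b_two_nonempty:
  assumes "2 \<le> n" "n \<le> e"
  shows "(normal_locus n e (b_two n e) :: (nat \<Rightarrow> 'a::field_char_0 poly) set set) \<noteq> {}"
proof -
  define m where "m = e + 1 - n"
  define h where "h = (monom 1 m - 1 :: 'a poly)"
  have m: "1 \<le> m" using assms by (simp add: m_def)
  have "degree h = m"
  proof -
    have "degree (- 1 :: 'a poly) < degree (monom (1::'a) m)" using m by (simp add: degree_monom_eq)
    then have "degree (monom 1 m + (- 1 :: 'a poly)) = degree (monom (1::'a) m)"
      by (rule degree_add_eq_left)
    then show ?thesis by (simp add: h_def degree_monom_eq)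
  qed
  moreover have "poly (pderiv h) z \<noteq> 0" if "poly h z = 0" for z
  proof -
    have "z \<noteq> 0" using that m by (auto simp: h_def poly_monom power_0_left)
    then show ?thesis using m by (simp add: h_def pderiv_diff pderiv_monom poly_monom)
  qed
  ultimately interpret cone_curve n m e h
    using assms m by unfold_locales (auto simp: m_def)
  have "scaling_class F \<in> normal_locus n e (b_two n e)"
    unfolding normal_locus_def
  proof (intro CollectI conjI ballI)
    show "scaling_class F \<in> Mor n e" unfolding Mor_def using mor_tuple_F by blast
    fix G assume "G \<in> scaling_class F"
    then obtain c where c: "c \<noteq> 0" "G = (\<lambda>i. smult c (F i))" by (auto simp: scaling_class_def)
    show "nondegenerate n e G" "unramified n e G" "birational_onto_image n G" "normal_bundle_iso_sum n e G ds"
      unfolding c(2) predicates_smult[OF c(1)]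
      by (fact nondegenerate_F unramified_F birational_F normal_bundle_F)+
  qed
  then show ?thesis by blast
qed

lemma splitting_sequence_b_two:
  assumes "2 \<le> n" "n \<le> e"
  shows "splitting_sequence n e (b_two n e)"
  unfolding splitting_sequence_def b_two_def
  using assms by (auto simp: sorted_append sum_list_replicate of_nat_diff)


section \<open>Homogeneous forms as functions\<close>

definition monom_eval :: "('v \<Rightarrow>\<^sub>0 nat) \<Rightarrow> ('v \<Rightarrow> 'a::field) \<Rightarrow> 'a" where
  "monom_eval m x = (\<Prod>v\<in>Poly_Mapping.keys m. x v ^ Poly_Mapping.lookup m v)"

definition total_degree :: "('v \<Rightarrow>\<^sub>0 nat) \<Rightarrow> nat" where
  "total_degree m = (\<Sum>v\<in>Poly_Mapping.keys m. Poly_Mapping.lookup m v)"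

lemma mv_homogeneous_iff: "mv_homogeneous d P \<longleftrightarrow> (\<forall>m\<in>Poly_Mapping.keys P. total_degree m = d)"
  by (simp add: mv_homogeneous_def total_degree_def)

lemma monom_eval_superset:
  assumes "finite A" "Poly_Mapping.keys m \<subseteq> A"
  shows "monom_eval m x = (\<Prod>v\<in>A. x v ^ Poly_Mapping.lookup m v)"
  unfolding monom_eval_def
  by (rule prod.mono_neutral_left) (use assms in \<open>auto simp: in_keys_iff\<close>)

lemma total_degree_superset:
  assumes "finite A" "Poly_Mapping.keys m \<subseteq> A"
  shows "total_degree m = (\<Sum>v\<in>A. Poly_Mapping.lookup m v)"
  unfolding total_degree_def
  by (rule sum.mono_neutral_left) (use assms in \<open>auto simp: in_keys_iff\<close>)

lemma monom_eval_add: "monom_eval (m + m') x = monom_eval m x * monom_eval m' x"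
proof -
  let ?A = "Poly_Mapping.keys m \<union> Poly_Mapping.keys m'"
  have "Poly_Mapping.keys (m + m') \<subseteq> ?A" by (rule keys_add)
  then show ?thesis
    by (simp add: monom_eval_superset[of ?A] lookup_add power_add prod.distrib)
qed

lemma total_degree_add: "total_degree (m + m') = total_degree m + total_degree m'"
proof -
  let ?A = "Poly_Mapping.keys m \<union> Poly_Mapping.keys m'"
  have "Poly_Mapping.keys (m + m') \<subseteq> ?A" by (rule keys_add)
  then show ?thesis
    by (simp add: total_degree_superset[of ?A] lookup_add sum.distrib)
qed

lemma mv_eval_superset:
  assumes "finite A" "Poly_Mapping.keys P \<subseteq> A"
  shows "mv_eval P x = (\<Sum>m\<in>A. Poly_Mapping.lookup P m * monom_eval m x)"
  unfolding mv_eval_def monom_eval_def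
  by (rule sum.mono_neutral_left) (use assms in \<open>auto simp: in_keys_iff\<close>)

lemma mv_eval_add: "mv_eval (P + Q) x = mv_eval P x + mv_eval Q x"
proof -
  let ?A = "Poly_Mapping.keys P \<union> Poly_Mapping.keys Q"
  have "Poly_Mapping.keys (P + Q) \<subseteq> ?A" by (rule keys_add)
  then show ?thesis
    by (simp add: mv_eval_superset[of ?A] lookup_add distrib_right sum.distrib)
qed

lemma mv_eval_zero [simp]: "mv_eval 0 x = 0"
  by (simp add: mv_eval_def)

lemma mv_eval_sum: "mv_eval (\<Sum>i\<in>A. P i) x = (\<Sum>i\<in>A. mv_eval (P i) x)"
  by (induction A rule: infinite_finite_induct) (auto simp: mv_eval_add)

lemma mv_eval_single: "mv_eval (Poly_Mapping.single m c) x = c * monom_eval m x"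
  by (subst mv_eval_superset[of "{m}"]) auto

lemma poly_mapping_eq_sum_single:
  "P = (\<Sum>m\<in>Poly_Mapping.keys P. Poly_Mapping.single m (Poly_Mapping.lookup P m))"
  by (rule poly_mapping_eqI) (auto simp: lookup_sum lookup_single when_def in_keys_iff)

lemma mv_eval_mult:
  fixes P Q :: "('v, 'a::field) mvpoly"
  shows "mv_eval (P * Q) x = mv_eval P x * mv_eval Q x"
proof -
  have "P * Q = (\<Sum>m\<in>Poly_Mapping.keys P. \<Sum>m'\<in>Poly_Mapping.keys Q.
      Poly_Mapping.single (m + m') (Poly_Mapping.lookup P m * Poly_Mapping.lookup Q m'))"
    by (subst poly_mapping_eq_sum_single[of P], subst poly_mapping_eq_sum_single[of Q])
       (simp add: sum_product mult_single)
  then show ?thesis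
    by (simp add: mv_eval_sum mv_eval_single monom_eval_add mv_eval_superset[OF _ order_refl]
        sum_product mult_ac)
qed

text \<open>
  Forms are studied as functions on the coefficient space, because restricting them to a set is what
  the growth argument needs.
\<close>

definition form_functions :: "nat \<Rightarrow> (('v \<Rightarrow> 'a::field) \<Rightarrow> 'a) set" where
  "form_functions d = {mv_eval P | P. mv_homogeneous d P}"

lemma form_functions_add:
  assumes "f \<in> form_functions d" "g \<in> form_functions d"
  shows "(\<lambda>x. f x + g x) \<in> form_functions d"
proof -
  obtain P Q where PQ: "f = mv_eval P" "mv_homogeneous d P" "g = mv_eval Q" "mv_homogeneous d Q"
    using assms by (auto simp: form_functions_def)
  have "mv_homogeneous d (P + Q)"
    using PQ keys_add[of P Q] by (auto simp: mv_homogeneous_iff)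
  moreover have "(\<lambda>x. f x + g x) = mv_eval (P + Q)"
    using PQ by (simp add: mv_eval_add fun_eq_iff)
  ultimately show ?thesis by (auto simp: form_functions_def)
qed

lemma form_functions_mult:
  assumes "f \<in> form_functions d" "g \<in> form_functions d'"
  shows "(\<lambda>x. f x * g x) \<in> form_functions (d + d')"
proof -
  obtain P Q where PQ: "f = mv_eval P" "mv_homogeneous d P" "g = mv_eval Q" "mv_homogeneous d' Q"
    using assms by (auto simp: form_functions_def)
  have "mv_homogeneous (d + d') (P * Q)"
    using PQ keys_mult[of P Q] by (force simp: mv_homogeneous_iff total_degree_add)
  moreover have "(\<lambda>x. f x * g x) = mv_eval (P * Q)"
    using PQ by (simp add: mv_eval_mult fun_eq_iff)
  ultimately show ?thesis by (auto simp: form_functions_def)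
qed

lemma form_functions_monom: "(\<lambda>x. c * monom_eval m x) \<in> form_functions (total_degree m)"
proof -
  have "mv_homogeneous (total_degree m) (Poly_Mapping.single m c)"
    by (auto simp: mv_homogeneous_iff)
  moreover have "(\<lambda>x. c * monom_eval m x) = mv_eval (Poly_Mapping.single m c)"
    by (simp add: mv_eval_single fun_eq_iff)
  ultimately show ?thesis by (auto simp: form_functions_def)
qed

lemma form_functions_const: "(\<lambda>x. c) \<in> form_functions 0"
  using form_functions_monom[of c 0] by (simp add: monom_eval_def total_degree_def)

lemma form_functions_zero: "(\<lambda>x. 0) \<in> form_functions d"
  unfolding form_functions_def
  by (rule CollectI, rule exI[of _ 0]) (auto simp: mv_homogeneous_def)

lemma form_functions_scale:
  assumes "f \<in> form_functions d" shows "(\<lambda>x. c * f x) \<in> form_functions d"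
  using form_functions_mult[OF form_functions_const assms] by simp

lemma form_functions_sum:
  assumes "\<And>i. i \<in> A \<Longrightarrow> f i \<in> form_functions d"
  shows "(\<lambda>x. \<Sum>i\<in>A. f i x) \<in> form_functions d"
  using assms
  by (induction A rule: infinite_finite_induct)
     (auto intro: form_functions_add simp: form_functions_zero)

lemma form_functions_power:
  assumes "f \<in> form_functions d" shows "(\<lambda>x. f x ^ k) \<in> form_functions (d * k)"
proof (induction k)
  case 0
  show ?case using form_functions_const[of 1] by simp
next
  case (Suc k)
  show ?case using form_functions_mult[OF assms Suc.IH] by simp
qed

lemma form_functions_var: "(\<lambda>x. x v) \<in> form_functions 1"
  using form_functions_monom[of 1 "Poly_Mapping.single v 1"]
  by (simp add: monom_eval_def total_degree_def)

text \<open>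
  This forces a form that vanishes somewhere but not everywhere to have positive degree.
\<close>

lemma form_functions_0_const:
  assumes "f \<in> form_functions 0" shows "f x = f y"
proof -
  obtain P where P: "f = mv_eval P" "mv_homogeneous 0 P"
    using assms by (auto simp: form_functions_def)
  have "monom_eval m x = monom_eval m y" if "m \<in> Poly_Mapping.keys P" for m
    using P(2) that by (auto simp: mv_homogeneous_iff total_degree_def monom_eval_def)
  then show ?thesis
    by (simp add: P(1) mv_eval_superset[OF _ order_refl])
qed

lemma mv_eval_homogeneous_scale:
  assumes "mv_homogeneous d P"
  shows "mv_eval P (\<lambda>v. c * x v) = c ^ d * mv_eval P x"
proof -
  have "monom_eval m (\<lambda>v. c * x v) = c ^ d * monom_eval m x" if "m \<in> Poly_Mapping.keys P" for m
  proof -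
    have "d = (\<Sum>v\<in>Poly_Mapping.keys m. Poly_Mapping.lookup m v)"
      using assms that by (auto simp: mv_homogeneous_def)
    then show ?thesis
      by (simp add: monom_eval_def power_mult_distrib prod.distrib power_sum)
  qed
  then show ?thesis
    by (simp add: mv_eval_superset[OF _ order_refl] sum_distrib_left mult_ac)
qed


section \<open>Growth of the number of independent forms on a cone\<close>

text \<open>
  A lower bound for the Hilbert function of the set \<open>C\<close> in degree \<open>d\<close>.
\<close>

definition independent_forms :: "('v \<Rightarrow> 'a::field) set \<Rightarrow> nat \<Rightarrow> nat \<Rightarrow> bool" where
  "independent_forms C d k \<longleftrightarrow> (\<exists>f. (\<forall>i<k. f i \<in> form_functions d) \<and>
     (\<forall>c. (\<forall>x\<in>C. (\<Sum>i<k. c i * f i x) = 0) \<longrightarrow> (\<forall>i<k. c i = 0)))"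

lemma independent_forms_mono:
  assumes "independent_forms C d k" "k' \<le> k"
  shows "independent_forms C d k'"
proof -
  obtain f where f: "\<forall>i<k. f i \<in> form_functions d"
    and ind: "\<And>c. (\<forall>x\<in>C. (\<Sum>i<k. c i * f i x) = 0) \<Longrightarrow> (\<forall>i<k. c i = 0)"
    using assms(1) by (auto simp: independent_forms_def)
  have "\<forall>i<k'. c i = 0" if "\<forall>x\<in>C. (\<Sum>i<k'. c i * f i x) = 0" for c
  proof -
    have "(\<Sum>i<k. (if i < k' then c i else 0) * f i x) = (\<Sum>i<k'. c i * f i x)" for x
      by (rule sum.mono_neutral_cong_right) (use assms(2) in auto)
    then have "\<forall>i<k. (if i < k' then c i else 0) = 0"
      using ind[of "\<lambda>i. if i < k' then c i else 0"] that by simp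
    then show ?thesis using assms(2) by (metis less_le_trans)
  qed
  then show ?thesis
    unfolding independent_forms_def using f assms(2) by (intro exI[of _ f]) auto
qed

text \<open>
  The homogeneous vanishing ideal of \<open>C\<close> is prime.
\<close>

definition form_irreducible :: "('v \<Rightarrow> 'a::field) set \<Rightarrow> bool" where
  "form_irreducible C \<longleftrightarrow> (\<forall>d d'. \<forall>u\<in>form_functions d. \<forall>v\<in>form_functions d'.
     (\<forall>x\<in>C. u x * v x = 0) \<longrightarrow> (\<forall>x\<in>C. u x = 0) \<or> (\<forall>x\<in>C. v x = 0))"

text \<open>
  The forms that are independent on \<open>C'\<close> are put together with the multiples by \<open>g\<close> of those that
  are independent on \<open>C\<close>. In a linear relation restricted to \<open>C'\<close> the multiples of \<open>g\<close> drop out, so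
  the other coefficients vanish; what remains is divisible by \<open>g\<close>, which can be cancelled because \<open>C\<close>
  is irreducible.
\<close>

lemma independent_forms_step:
  assumes "C' \<subseteq> C" "form_irreducible C" "g \<in> form_functions a"
    and g0: "\<And>x. x \<in> C' \<Longrightarrow> g x = 0" and g1: "\<not> (\<forall>x\<in>C. g x = 0)"
    and "independent_forms C' (d + a) k'" "independent_forms C d k"
  shows "independent_forms C (d + a) (k' + k)"
proof -
  obtain f' where f': "\<forall>i<k'. f' i \<in> form_functions (d + a)"
    and ind': "\<And>c. (\<forall>x\<in>C'. (\<Sum>i<k'. c i * f' i x) = 0) \<Longrightarrow> (\<forall>i<k'. c i = 0)"
    using assms(6) by (auto simp: independent_forms_def)
  obtain f where f: "\<forall>i<k. f i \<in> form_functions d"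
    and ind: "\<And>c. (\<forall>x\<in>C. (\<Sum>i<k. c i * f i x) = 0) \<Longrightarrow> (\<forall>i<k. c i = 0)"
    using assms(7) by (auto simp: independent_forms_def)
  define h where "h = (\<lambda>i. if i < k' then f' i else (\<lambda>x. f (i - k') x * g x))"
  have "h i \<in> form_functions (d + a)" if "i < k' + k" for i
    using that f f' form_functions_mult[OF _ assms(3), of "f (i - k')" d] by (auto simp: h_def)
  moreover have "\<forall>i<k' + k. c i = 0" if c: "\<forall>x\<in>C. (\<Sum>i<k' + k. c i * h i x) = 0" for c
  proof -
    have split: "(\<Sum>i<k' + k. c i * h i x) =
        (\<Sum>i<k'. c i * f' i x) + g x * (\<Sum>i<k. c (k' + i) * f i x)" for x
    proof -
      have "(\<Sum>i<k' + k. c i * h i x) = (\<Sum>i<k'. c i * h i x) + (\<Sum>i<k. c (k' + i) * h (k' + i) x)"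
        by (induction k) (simp_all add: add.assoc)
      then show ?thesis by (simp add: h_def sum_distrib_left mult_ac)
    qed
    have c': "\<forall>i<k'. c i = 0"
    proof (rule ind', rule ballI)
      fix x assume "x \<in> C'"
      then show "(\<Sum>i<k'. c i * f' i x) = 0"
        using c split[of x] g0 assms(1) by auto
    qed
    have "\<forall>x\<in>C. g x * (\<Sum>i<k. c (k' + i) * f i x) = 0"
      using c split c' by auto
    moreover have "(\<lambda>x. \<Sum>i<k. c (k' + i) * f i x) \<in> form_functions d"
      using f by (intro form_functions_sum form_functions_scale) auto
    ultimately have "\<forall>x\<in>C. (\<Sum>i<k. c (k' + i) * f i x) = 0"
      using assms(2)[unfolded form_irreducible_def, rule_format, OF assms(3)] g1 by blast
    from ind[OF this] have "\<forall>i<k. c (k' + i) = 0" .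
    then show ?thesis using c'
      by (metis add_diff_inverse_nat nat_add_left_cancel_less)
  qed
  ultimately show ?thesis unfolding independent_forms_def by (intro exI[of _ h]) auto
qed

lemma independent_forms_single:
  assumes "f \<in> form_functions d" "x \<in> C" "f x \<noteq> 0"
  shows "independent_forms C d 1"
  unfolding independent_forms_def
  by (rule exI[of _ "\<lambda>_. f"]) (use assms in auto)

text \<open>
  Pascal's rule matches the step just proved. Since the separating forms have different degrees, the
  degrees are rescaled: if degree \<open>D m\<close> works for \<open>C l\<close> and \<open>g\<close> has degree \<open>a\<close>, then \<open>g^D\<close> has
  degree \<open>a D\<close>, and degree \<open>a D m\<close> works for \<open>C (Suc l)\<close>.
\<close>

lemma independent_forms_chain:
  fixes C :: "nat \<Rightarrow> ('v \<Rightarrow> 'a::field) set"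
  assumes irr: "\<And>i. i \<le> l \<Longrightarrow> form_irreducible (C i)"
    and sub: "\<And>i. i < l \<Longrightarrow> C i \<subseteq> C (Suc i)"
    and sep: "\<And>i. i < l \<Longrightarrow> \<exists>d. \<exists>g\<in>form_functions d.
                 (\<forall>x\<in>C i. g x = 0) \<and> \<not> (\<forall>x\<in>C (Suc i). g x = 0)"
    and ne: "x \<in> C 0" "x v \<noteq> 0"
  shows "\<exists>D>0. \<forall>m. independent_forms (C l) (D * m) ((m + l) choose l)"
  using irr sub sep
proof (induction l)
  case 0
  have "independent_forms (C 0) m 1" for m
    by (rule independent_forms_single[OF _ ne(1), of "\<lambda>x. x v ^ m"])
       (use form_functions_power[OF form_functions_var, of v m] ne in auto)
  then show ?case by (intro exI[of _ 1]) auto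
next
  case (Suc l)
  have "\<exists>D>0. \<forall>m. independent_forms (C l) (D * m) ((m + l) choose l)"
    by (rule Suc.IH) (use Suc.prems in auto)
  then obtain D where D: "D > 0" "\<And>m. independent_forms (C l) (D * m) ((m + l) choose l)"
    by blast
  obtain a g where g: "g \<in> form_functions a" "\<forall>x\<in>C l. g x = 0" "\<not> (\<forall>x\<in>C (Suc l). g x = 0)"
    using Suc.prems(3)[of l] by auto
  have irrS: "form_irreducible (C (Suc l))" by (rule Suc.prems(1)) simp
  have subS: "\<And>i. i < Suc l \<Longrightarrow> C i \<subseteq> C (Suc i)" by (rule Suc.prems(2))
  have x_in: "x \<in> C i" if "i \<le> Suc l" for i
    using that
  proof (induction i)
    case 0 then show ?case using ne by simp
  next
    case (Suc i)
    then have "x \<in> C i" "i < Suc l" by auto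
    then show ?case using subS by blast
  qed
  have a: "a > 0"
  proof (rule ccontr)
    assume "\<not> a > 0"
    then have "g y = g x" for y
      using form_functions_0_const g(1) by auto
    then show False using g x_in[of l] by auto
  qed
  define h where "h = (\<lambda>x. g x ^ D)"
  have h: "h \<in> form_functions (a * D)" "\<And>x. x \<in> C l \<Longrightarrow> h x = 0" "\<not> (\<forall>x\<in>C (Suc l). h x = 0)"
    using form_functions_power[OF g(1), of D] g D(1) by (auto simp: h_def)
  have "independent_forms (C (Suc l)) (a * D * m) ((m + Suc l) choose Suc l)" for m
  proof (induction m)
    case 0
    show ?case
      using independent_forms_single[OF form_functions_const[of 1] x_in[of "Suc l"]] by simp
  next
    case (Suc m)
    have "(Suc m + l choose l) \<le> (a * Suc m + l choose l)"
      by (rule binomial_right_mono) (use a mult_le_mono1[of 1 a "Suc m"] in auto)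
    then have "independent_forms (C l) (D * (a * Suc m)) (Suc m + l choose l)"
      using independent_forms_mono D(2) by blast
    then have 1: "independent_forms (C l) (a * D * m + a * D) (Suc m + l choose l)"
      by (simp add: algebra_simps)
    have "independent_forms (C (Suc l)) (a * D * m + a * D)
           ((Suc m + l choose l) + (m + Suc l choose Suc l))"
      by (rule independent_forms_step[OF _ _ h 1 Suc.IH])
         (use irrS subS in auto)
    then show ?case by (simp add: algebra_simps)
  qed
  then show ?case using a D(1) by (intro exI[of _ "a * D"]) auto
qed

definition fun_scale :: "'a::field \<Rightarrow> ('p \<Rightarrow> 'a) \<Rightarrow> 'p \<Rightarrow> 'a" where
  "fun_scale c f = (\<lambda>x. c * f x)"

interpretation fun_vs: vector_space fun_scale
  by standard (auto simp: fun_scale_def fun_eq_iff algebra_simps)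

text \<open>
  On a set on which only the variables in \<open>V\<close> can be nonzero, forms of degree \<open>d\<close> are spanned by the
  monomials in \<open>V\<close> with exponents at most \<open>d\<close>.
\<close>

lemma independent_forms_bound:
  fixes C :: "('v \<Rightarrow> 'a::field) set"
  assumes "finite V" and supp: "\<And>x v. x \<in> C \<Longrightarrow> v \<notin> V \<Longrightarrow> x v = 0"
    and "independent_forms C d k"
  shows "k \<le> (d + 1) ^ card V"
proof -
  obtain f where f: "\<forall>i<k. f i \<in> form_functions d"
    and ind: "\<And>c. (\<forall>x\<in>C. (\<Sum>i<k. c i * f i x) = 0) \<Longrightarrow> (\<forall>i<k. c i = 0)"
    using assms(3) by (auto simp: independent_forms_def)
  \<comment> \<open>Cutting functions off outside \<open>C\<close> turns independence on \<open>C\<close> into linear independence.\<close>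
  define r where "r = (\<lambda>(h :: ('v \<Rightarrow> 'a) \<Rightarrow> 'a) x. if x \<in> C then h x else 0)"
  define M where "M = {m :: 'v \<Rightarrow>\<^sub>0 nat. Poly_Mapping.keys m \<subseteq> V \<and> total_degree m = d}"
  define T where "T = (\<lambda>m. r (monom_eval m)) ` M"
  have lookup_le: "Poly_Mapping.lookup m v \<le> d" if "m \<in> M" for m v
  proof (cases "v \<in> Poly_Mapping.keys m")
    case True
    then have "Poly_Mapping.lookup m v \<le> total_degree m"
      unfolding total_degree_def by (intro member_le_sum) auto
    then show ?thesis using that by (simp add: M_def)
  qed (simp add: in_keys_iff)
  have inj: "inj_on (\<lambda>m. restrict (Poly_Mapping.lookup m) V) M"
  proof (rule inj_onI, rule poly_mapping_eqI)
    fix m m' v assume "m \<in> M" "m' \<in> M"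
      and eq: "restrict (Poly_Mapping.lookup m) V = restrict (Poly_Mapping.lookup m') V"
    show "Poly_Mapping.lookup m v = Poly_Mapping.lookup m' v"
    proof (cases "v \<in> V")
      case True then show ?thesis using fun_cong[OF eq, of v] by simp
    next
      case False
      then have "v \<notin> Poly_Mapping.keys m" "v \<notin> Poly_Mapping.keys m'"
        using \<open>m \<in> M\<close> \<open>m' \<in> M\<close> by (auto simp: M_def)
      then show ?thesis by (simp add: in_keys_iff)
    qed
  qed
  have img: "(\<lambda>m. restrict (Poly_Mapping.lookup m) V) ` M \<subseteq> (V \<rightarrow>\<^sub>E {..d})"
    using lookup_le by auto
  have fin: "finite (V \<rightarrow>\<^sub>E {..d})" using assms(1) by (intro finite_PiE) auto
  have finM: "finite M" using inj_on_finite[OF inj img fin] .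
  have "card M \<le> card (V \<rightarrow>\<^sub>E {..d})" by (rule card_inj_on_le[OF inj img fin])
  also have "\<dots> = (d + 1) ^ card V" using assms(1) by (simp add: card_PiE)
  finally have cardM: "card M \<le> (d + 1) ^ card V" .
  have in_span: "r (f i) \<in> fun_vs.span T" if ik: "i < k" for i
  proof -
    obtain P where P: "f i = mv_eval P" "mv_homogeneous d P"
      using f ik by (auto simp: form_functions_def)
    have "r (f i) = (\<Sum>m\<in>Poly_Mapping.keys P. fun_scale (Poly_Mapping.lookup P m) (r (monom_eval m)))"
      by (auto simp: r_def P(1) mv_eval_superset[OF _ order_refl] fun_eq_iff fun_sum_apply fun_scale_def)
    also have "\<dots> \<in> fun_vs.span T"
    proof (intro fun_vs.span_sum fun_vs.span_scale)
      fix m assume m: "m \<in> Poly_Mapping.keys P"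
      show "r (monom_eval m) \<in> fun_vs.span T"
      proof (cases "Poly_Mapping.keys m \<subseteq> V")
        case True
        then show ?thesis using m P(2)
          by (intro fun_vs.span_base) (auto simp: T_def M_def mv_homogeneous_iff)
      next
        case False
        then obtain v where v: "v \<in> Poly_Mapping.keys m" "v \<notin> V" by blast
        have "monom_eval m x = 0" if "x \<in> C" for x
          unfolding monom_eval_def
          by (rule prod_zero) (use v supp[OF that v(2)] in \<open>auto simp: in_keys_iff intro!: bexI[of _ v]\<close>)
        then have "r (monom_eval m) = 0" by (auto simp: r_def fun_eq_iff)
        then show ?thesis by (simp add: fun_vs.span_zero)
      qed
    qed
    finally show ?thesis .
  qed
  define S where "S = (\<lambda>i. r (f i)) ` {..<k}"
  have injf: "inj_on (\<lambda>i. r (f i)) {..<k}"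
  proof (rule inj_onI, rule ccontr)
    fix i j assume ij: "i \<in> {..<k}" "j \<in> {..<k}" "r (f i) = r (f j)" "i \<noteq> j"
    define c where "c = (\<lambda>l. if l = i then 1 else if l = j then - 1 else 0 :: 'a)"
    have "(\<Sum>l<k. c l * f l x) = 0" if "x \<in> C" for x
    proof -
      have "(\<Sum>l<k. c l * f l x) = (\<Sum>l\<in>{i,j}. c l * f l x)"
        by (rule sum.mono_neutral_right) (use ij in \<open>auto simp: c_def\<close>)
      also have "\<dots> = f i x - f j x" using ij by (simp add: c_def)
      also have "\<dots> = 0" using fun_cong[OF ij(3), of x] that by (simp add: r_def)
      finally show ?thesis .
    qed
    then have "c i = 0" using ind[of c] ij by auto
    then show False by (simp add: c_def)
  qed
  have finS: "finite S" unfolding S_def by (rule finite_imageI) (rule finite_lessThan)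
  have coeffs: "u h = 0" if u: "(\<Sum>h\<in>S. fun_scale (u h) h) = 0" and h: "h \<in> S" for u h
  proof -
    obtain i where i: "i < k" "h = r (f i)" using h by (auto simp: S_def)
    have "(\<Sum>i<k. u (r (f i)) * f i x) = 0" if x: "x \<in> C" for x
    proof -
      have "(\<Sum>h\<in>S. u h * h x) = 0"
        using fun_cong[OF u, of x] by (simp add: fun_sum_apply fun_scale_def)
      then have "(\<Sum>i<k. u (r (f i)) * r (f i) x) = 0"
        by (simp add: S_def sum.reindex[OF injf])
      then show ?thesis
        using x by (simp add: r_def)
    qed
    then show "u h = 0" using ind[of "\<lambda>i. u (r (f i))"] i by auto
  qed
  have indS: "fun_vs.independent S"
    proof (rule notI)
    assume "fun_vs.dependent S"
    then obtain u h where "h \<in> S" "u h \<noteq> 0" "(\<Sum>h\<in>S. fun_scale (u h) h) = 0"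
      unfolding fun_vs.dependent_finite[OF finS] by blast
    then show False using coeffs by blast
  qed
  have finT: "finite T"
    unfolding T_def
    by (rule finite_imageI[OF finM])
  have SsubT: "S \<subseteq> fun_vs.span T"
  proof
    fix h assume "h \<in> S"
    then obtain i where "i < k" "h = r (f i)"
      by (auto simp: S_def)
    then show "h \<in> fun_vs.span T"
      using in_span by simp
  qed
  have "card S \<le> card T"
    by (rule conjunct2[OF fun_vs.independent_span_bound[OF finT indS SsubT]])
  moreover have "card S = k"
    using card_image[OF injf] by (simp add: S_def)
  moreover have "card T \<le> card M"
    unfolding T_def
    by (rule card_image_le[OF finM])
  ultimately show ?thesis using cardM
    by linarith
qed

text \<open>
  The left-hand side is at least \<open>(m / l)^l\<close>, the right-hand side is of order \<open>m^N\<close>; a large \<open>m\<close>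
  decides.
\<close>

lemma chain_length_bound:
  fixes l N D :: nat
  assumes "D > 0" and "\<And>m. ((m + l) choose l) \<le> (D * m + 1) ^ N"
  shows "l \<le> N"
proof (rule ccontr)
  assume "\<not> l \<le> N"
  then have l: "N < l" "l > 0" by auto
  define m where "m = l ^ l * (D + 1) ^ N + 1"
  have "real m ^ l \<le> real l ^ l * real ((m + l) choose l)"
  proof -
    have "(real (m + l) / real l) ^ l \<le> real ((m + l) choose l)"
      by (rule binomial_ge_n_over_k_pow_k) auto
    then have "real (m + l) ^ l \<le> real ((m + l) choose l) * real l ^ l"
      using l by (simp add: power_divide field_simps)
    moreover have "real m ^ l \<le> real (m + l) ^ l" by (intro power_mono) auto
    ultimately show ?thesis by (simp add: mult.commute)
  qed
  then have "m ^ l \<le> l ^ l * ((m + l) choose l)"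
    by (metis of_nat_le_iff of_nat_mult of_nat_power)
  also have "\<dots> \<le> l ^ l * (D * m + 1) ^ N" using assms(2) by simp
  also have "\<dots> \<le> l ^ l * ((D + 1) * m) ^ N"
    by (intro mult_left_mono power_mono) (auto simp: m_def)
  also have "\<dots> = l ^ l * (D + 1) ^ N * m ^ N" by (simp only: power_mult_distrib mult.assoc)
  finally have *: "m ^ l \<le> l ^ l * (D + 1) ^ N * m ^ N" .
  have "m > 0" by (simp add: m_def)
  have "m ^ Suc N \<le> m ^ l" using l \<open>m > 0\<close> by (intro power_increasing) auto
  with * have "m * m ^ N \<le> l ^ l * (D + 1) ^ N * m ^ N" by (simp only: power_Suc)
  then have "m \<le> l ^ l * (D + 1) ^ N" using \<open>m > 0\<close> by simp
  then show False by (simp add: m_def)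
qed


section \<open>The dimension of the space of morphisms\<close>

definition affine_cone :: "(nat \<Rightarrow> 'a::field poly) set set \<Rightarrow> (nat \<times> nat \<Rightarrow> 'a) set" where
  "affine_cone Z = coefficients ` \<Union>Z"

lemma coefficients_scale: "coefficients (\<lambda>i. smult c (F i)) = (\<lambda>v. c * coefficients F v)"
  by (auto simp: coefficients_def)

lemma Mor_rep:
  assumes "f \<in> Mor n e"
  obtains F where "mor_tuple n e F" "f = scaling_class F" "F \<in> f"
proof -
  obtain F where F: "mor_tuple n e F" "f = scaling_class F"
    using assms by (auto simp: Mor_def)
  have "F \<in> scaling_class F"
    unfolding scaling_class_def by (rule CollectI, rule exI[of _ 1]) auto
  then show ?thesis using F that by auto
qed

lemma form_vanishes_on_class:
  assumes "f \<in> Mor n e" "F \<in> f" "G \<in> f" "u \<in> form_functions d" "u (coefficients F) = 0"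
  shows "u (coefficients G) = 0"
proof -
  obtain H where H: "f = scaling_class H" using assms(1) by (rule Mor_rep)
  obtain c c' where c: "c \<noteq> 0" "F = (\<lambda>i. smult c (H i))" "G = (\<lambda>i. smult c' (H i))"
    using assms(2,3) by (auto simp: H scaling_class_def)
  obtain P where P: "u = mv_eval P" "mv_homogeneous d P"
    using assms(4) by (auto simp: form_functions_def)
  show ?thesis
    using assms(5) c by (simp add: P(1) coefficients_scale mv_eval_homogeneous_scale[OF P(2)])
qed

definition nonvanishing :: "nat \<Rightarrow> nat \<Rightarrow> ((nat \<times> nat \<Rightarrow> 'a::field) \<Rightarrow> 'a) \<Rightarrow> (nat \<Rightarrow> 'a poly) set set" where
  "nonvanishing n e u = {f\<in>Mor n e. \<forall>F\<in>f. u (coefficients F) \<noteq> 0}"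

lemma Mor_zariski_alt:
  "Mor_zariski n e = topology_generated_by {nonvanishing n e u | u d. u \<in> form_functions d}"
proof -
  have "{{f\<in>Mor n e. \<forall>F\<in>f. mv_eval P (coefficients F) \<noteq> 0} | P d. mv_homogeneous d P}
    = {nonvanishing n e u | u d. u \<in> form_functions d}"
    by (auto simp: nonvanishing_def form_functions_def)
  then show ?thesis unfolding Mor_zariski_def by (rule arg_cong)
qed

lemma topspace_Mor_zariski: "topspace (Mor_zariski n e) = Mor n e"
proof
  show "topspace (Mor_zariski n e) \<subseteq> Mor n e"
    unfolding Mor_zariski_alt topology_generated_by_topspace by (auto simp: nonvanishing_def)
  have "nonvanishing n e (\<lambda>_. 1) = Mor n e" by (simp add: nonvanishing_def)
  then show "Mor n e \<subseteq> topspace (Mor_zariski n e)"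
    unfolding Mor_zariski_alt topology_generated_by_topspace
    using form_functions_const[of 1] by blast
qed

lemma closedin_vanishing:
  assumes "u \<in> form_functions d"
  shows "closedin (Mor_zariski n e) (Mor n e - nonvanishing n e u)"
proof -
  have "openin (Mor_zariski n e) (nonvanishing n e u)"
    unfolding Mor_zariski_alt by (rule topology_generated_by_Basis) (use assms in blast)
  then show ?thesis
    using openin_closedin_eq topspace_Mor_zariski by metis
qed

text \<open>
  Products of forms make the nonvanishing loci a basis of the topology, not just a subbasis.
\<close>

lemma open_contains_nonvanishing:
  assumes "generate_topology_on {nonvanishing n e u | u d. u \<in> form_functions d} U" "f \<in> U"
  shows "\<exists>d. \<exists>u\<in>form_functions d. f \<in> nonvanishing n e u \<and> nonvanishing n e u \<subseteq> U"
  using assms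
proof (induction rule: generate_topology_on.induct)
  case (Int A B)
  then obtain d u d' v where u: "u \<in> form_functions d" "f \<in> nonvanishing n e u" "nonvanishing n e u \<subseteq> A"
    and v: "v \<in> form_functions d'" "f \<in> nonvanishing n e v" "nonvanishing n e v \<subseteq> B"
    by blast
  have "nonvanishing n e (\<lambda>x. u x * v x) = nonvanishing n e u \<inter> nonvanishing n e v"
    by (auto simp: nonvanishing_def)
  then show ?case
    using form_functions_mult[OF u(1) v(1)] u v by blast
next
  case (UN K)
  from UN.prems obtain k where k: "k \<in> K" "f \<in> k" by blast
  show ?case using UN.IH[OF k] k(1) by blast
next
  case (Basis s)
  then show ?case by blast
qed simp

text \<open>
  If \<open>u v\<close> vanishes on the cone, the closed sets where \<open>u\<close> and \<open>v\<close> vanish cover \<open>Z\<close>.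
\<close>

lemma affine_cone_irreducible:
  assumes "irreducible_closedin (Mor_zariski n e) Z"
  shows "form_irreducible (affine_cone Z)"
  unfolding form_irreducible_def
proof (intro allI ballI impI)
  fix d d' u v
  assume u: "u \<in> form_functions d" and v: "v \<in> form_functions d'"
    and uv: "\<forall>x\<in>affine_cone Z. u x * v x = 0"
  let ?A = "Mor n e - nonvanishing n e u" and ?B = "Mor n e - nonvanishing n e v"
  have "closedin (Mor_zariski n e) Z" using assms by (simp add: irreducible_closedin_def)
  then have Z: "Z \<subseteq> Mor n e" using closedin_subset topspace_Mor_zariski by metis
  have cover: "Z \<subseteq> ?A \<union> ?B"
  proof
    fix f assume f: "f \<in> Z"
    then obtain F where F: "F \<in> f" using Z by (meson Mor_rep subsetD)
    then have "u (coefficients F) * v (coefficients F) = 0"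
      using uv f by (auto simp: affine_cone_def)
    then show "f \<in> ?A \<union> ?B" using f F Z by (auto simp: nonvanishing_def)
  qed
  have "Z \<subseteq> ?A \<or> Z \<subseteq> ?B"
    by (rule assms[unfolded irreducible_closedin_def, THEN conjunct2, THEN conjunct2, rule_format,
        OF conjI[OF closedin_vanishing[OF u] conjI[OF closedin_vanishing[OF v] cover]]])
  moreover have "\<forall>x\<in>affine_cone Z. w x = 0"
    if w: "w \<in> form_functions c" and sub: "Z \<subseteq> Mor n e - nonvanishing n e w" for w c
  proof
    fix x assume "x \<in> affine_cone Z"
    then obtain f F where f: "f \<in> Z" "F \<in> f" "x = coefficients F" by (auto simp: affine_cone_def)
    obtain G where "G \<in> f" "w (coefficients G) = 0"
      using sub f Z by (auto simp: nonvanishing_def)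
    then show "w x = 0" using form_vanishes_on_class[OF _ _ f(2) w] f Z by blast
  qed
  ultimately show "(\<forall>x\<in>affine_cone Z. u x = 0) \<or> (\<forall>x\<in>affine_cone Z. v x = 0)"
    using u v by blast
qed

text \<open>
  A point of \<open>Z'\<close> outside the closed set \<open>Z\<close> has a basic open neighbourhood that misses \<open>Z\<close>.
\<close>

lemma affine_cone_separation:
  assumes "closedin (Mor_zariski n e) Z" "closedin (Mor_zariski n e) Z'" "Z \<subset> Z'"
  shows "\<exists>d. \<exists>g\<in>form_functions d. (\<forall>x\<in>affine_cone Z. g x = 0) \<and> \<not> (\<forall>x\<in>affine_cone Z'. g x = 0)"
proof -
  have sub: "Z \<subseteq> Mor n e" "Z' \<subseteq> Mor n e"
    using assms closedin_subset topspace_Mor_zariski by metis+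
  obtain f where f: "f \<in> Z'" "f \<notin> Z" using assms(3) by blast
  have "openin (Mor_zariski n e) (Mor n e - Z)"
    using assms(1) topspace_Mor_zariski by (metis closedin_def)
  then have "generate_topology_on {nonvanishing n e u | u d. u \<in> form_functions d} (Mor n e - Z)"
    unfolding Mor_zariski_alt by (rule openin_topology_generated_by)
  then obtain d u where u: "u \<in> form_functions d" "f \<in> nonvanishing n e u"
      "nonvanishing n e u \<subseteq> Mor n e - Z"
    using open_contains_nonvanishing[where f=f] f sub by blast
  have "u x = 0" if x: "x \<in> affine_cone Z" for x
  proof -
    obtain g F where g: "g \<in> Z" "F \<in> g" "x = coefficients F"
      using x by (auto simp: affine_cone_def)
    obtain G where "G \<in> g" "u (coefficients G) = 0"
      using u(3) g(1) sub(1) unfolding nonvanishing_def by blast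
    then show ?thesis using form_vanishes_on_class[OF _ _ g(2) u(1)] g sub by blast
  qed
  moreover have "\<exists>x\<in>affine_cone Z'. u x \<noteq> 0"
  proof -
    obtain F where "F \<in> f" using f sub by (meson Mor_rep subsetD)
    then show ?thesis using u(2) f by (auto simp: affine_cone_def nonvanishing_def)
  qed
  ultimately show ?thesis using u(1) by blast
qed

lemma affine_cone_supported:
  assumes "Z \<subseteq> Mor n e" "x \<in> affine_cone Z" "v \<notin> {..n} \<times> {..e}"
  shows "x v = 0"
proof -
  obtain f F where f: "f \<in> Z" "F \<in> f" "x = coefficients F"
    using assms(2) by (auto simp: affine_cone_def)
  obtain G where G: "mor_tuple n e G" "f = scaling_class G"
    using assms(1) f(1) by (meson Mor_rep subsetD)
  obtain c where c: "F = (\<lambda>i. smult c (G i))" using f G by (auto simp: scaling_class_def)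
  obtain i j where v: "v = (i, j)" by (cases v)
  have "coeff (G i) j = 0"
  proof (cases "i \<le> n")
    case True
    then show ?thesis using G assms(3) v
      by (intro coeff_eq_0) (auto simp: mor_tuple_def not_le elim!: allE[of _ i])
  next
    case False
    then show ?thesis using G by (auto simp: mor_tuple_def)
  qed
  then show ?thesis by (simp add: f(3) c v coefficients_def)
qed

lemma mor_tuple_coefficient_nonzero:
  assumes "mor_tuple n e F"
  shows "\<exists>v. coefficients F v \<noteq> 0"
proof -
  have "(1, 0) \<in> P1" by (simp add: P1_def)
  then obtain i where i: "form_eval e (F i) (1, 0) \<noteq> 0"
    using assms unfolding mor_tuple_def by blast
  then obtain j where "coeff (F i) j \<noteq> 0"
    unfolding form_eval_def by (metis (no_types, lifting) mult_zero_left sum.neutral)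
  then show ?thesis by (intro exI[of _ "(i, j)"]) (simp add: coefficients_def)
qed

theorem krull_dim_Mor_le:
  "krull_dim (Mor_zariski n e :: (nat \<Rightarrow> 'a::field poly) set topology) \<le> enat ((n + 1) * (e + 1))"
  unfolding krull_dim_def
proof (rule Sup_least, clarify)
  fix l and Z :: "nat \<Rightarrow> (nat \<Rightarrow> 'a poly) set set"
  assume irr: "\<forall>i\<le>l. irreducible_closedin (Mor_zariski n e) (Z i)"
    and sub: "\<forall>i<l. Z i \<subset> Z (Suc i)"
  have cl: "closedin (Mor_zariski n e) (Z i)" if "i \<le> l" for i
    using irr that by (auto simp: irreducible_closedin_def)
  have Mor: "Z i \<subseteq> Mor n e" if "i \<le> l" for i
    using cl[OF that] closedin_subset topspace_Mor_zariski by metis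
  have "Z 0 \<noteq> {}" using irr unfolding irreducible_closedin_def by blast
  then obtain f where f: "f \<in> Z 0" by blast
  obtain F where F: "mor_tuple n e F" "F \<in> f"
    using Mor[of 0] f by (meson Mor_rep subsetD zero_le)
  obtain v where v: "coefficients F v \<noteq> 0" using mor_tuple_coefficient_nonzero[OF F(1)] by blast
  have "\<exists>D>0. \<forall>m. independent_forms (affine_cone (Z l)) (D * m) ((m + l) choose l)"
  proof (rule independent_forms_chain[where C="\<lambda>i. affine_cone (Z i)"])
    show "coefficients F \<in> affine_cone (Z 0)" using f F by (auto simp: affine_cone_def)
    show "affine_cone (Z i) \<subseteq> affine_cone (Z (Suc i))" if "i < l" for i
      using sub that by (auto simp: affine_cone_def)
    show "\<exists>d. \<exists>g\<in>form_functions d. (\<forall>x\<in>affine_cone (Z i). g x = 0) \<and> \<not> (\<forall>x\<in>affine_cone (Z (Suc i)). g x = 0)"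
      if "i < l" for i
      using sub that by (intro affine_cone_separation[where n=n and e=e] cl) auto
    show "form_irreducible (affine_cone (Z i))" if "i \<le> l" for i
      using irr that by (intro affine_cone_irreducible) blast
    show "coefficients F v \<noteq> 0" by (rule v)
  qed
  then obtain D where D: "D > 0" "\<And>m. independent_forms (affine_cone (Z l)) (D * m) ((m + l) choose l)"
    by blast
  have "l \<le> card ({..n} \<times> {..e})"
  proof (rule chain_length_bound[OF D(1)])
    fix m
    show "(m + l choose l) \<le> (D * m + 1) ^ card ({..n} \<times> {..e})"
      by (rule independent_forms_bound[OF _ _ D(2)])
         (use affine_cone_supported[OF Mor[OF order_refl]] in auto)
  qed
  then show "enat l \<le> enat ((n + 1) * (e + 1))" by simp
qed


section \<open>Loci of larger expected codimension than the ambient dimension\<close>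

theorem proposition2p8:
  shows
    "(\<forall>n\<ge>6. \<exists>e bs. splitting_sequence n e bs \<and>
        (normal_locus n e bs :: (nat \<Rightarrow> 'a::{alg_closed_field, field_char_0} poly) set set) \<noteq> {} \<and>
        enat (expected_codim TYPE('a) e bs) > krull_dim (Mor_zariski n e :: (nat \<Rightarrow> 'a poly) set topology))
     \<and>
     (\<forall>n e. n \<ge> 6 \<and>
        (int n - 2) * (2 * int e - 2 * int n - 1) \<ge> (int e + 1) * (int n + 1) \<longrightarrow>
        splitting_sequence n e (b_two n e) \<and>
        (normal_locus n e (b_two n e) :: (nat \<Rightarrow> 'a poly) set set) \<noteq> {} \<and>
        expected_dim TYPE('a) n e (b_two n e) < 0)"
proof (intro conjI allI impI)
  fix n :: nat assume n: "6 \<le> n"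
  \<comment> \<open>The codimension exceeds \<open>(n + 1) * (e + 1)\<close> as soon as
    \<open>(n - 5) * e > (n - 2) * (2 * n + 1) + (n + 1)\<close>; this \<open>e\<close> satisfies it even for \<open>n = 6\<close>.\<close>
  define e where "e = (n - 2) * (2 * n + 1) + n + 2"
  have "int (n - 2) = int n - 2" using n by simp
  then have e: "int e = (int n - 2) * (2 * int n + 1) + int n + 2"
    by (simp only: e_def of_nat_add of_nat_mult of_nat_numeral of_nat_1)
  have "n < e" by (simp add: e_def)
  have "int e \<le> (int n - 5) * int e" using n mult_right_mono[of 1 "int n - 5" "int e"] by simp
  moreover have "(int n - 2) * (2 * int e - 2 * int n - 1) - int ((n + 1) * (e + 1)) =
      (int n - 5) * int e - ((int n - 2) * (2 * int n + 1) + int n + 1)"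
    by (simp add: algebra_simps)
  ultimately have "int ((n + 1) * (e + 1)) < (int n - 2) * (2 * int e - 2 * int n - 1)"
    using e by linarith
  also have "\<dots> = int (expected_codim TYPE('a) e (b_two n e))"
    using n \<open>n < e\<close> by (simp add: expected_codim_b_two)
  finally have "enat ((n + 1) * (e + 1)) < enat (expected_codim TYPE('a) e (b_two n e))"
    by (simp only: of_nat_less_iff enat_ord_simps)
  then have "krull_dim (Mor_zariski n e :: (nat \<Rightarrow> 'a poly) set topology) <
      enat (expected_codim TYPE('a) e (b_two n e))"
    by (rule le_less_trans[OF krull_dim_Mor_le])
  moreover have "splitting_sequence n e (b_two n e)"
    by (rule splitting_sequence_b_two) (use n \<open>n < e\<close> in auto)
  moreover have "(normal_locus n e (b_two n e) :: (nat \<Rightarrow> 'a poly) set set) \<noteq> {}"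
    by (rule normal_locus_b_two_nonempty) (use n \<open>n < e\<close> in auto)
  ultimately show "\<exists>e bs. splitting_sequence n e bs \<and>
        (normal_locus n e bs :: (nat \<Rightarrow> 'a poly) set set) \<noteq> {} \<and>
        enat (expected_codim TYPE('a) e bs) > krull_dim (Mor_zariski n e :: (nat \<Rightarrow> 'a poly) set topology)"
    by blast
next
  fix n e :: nat
  assume *: "n \<ge> 6 \<and> (int n - 2) * (2 * int e - 2 * int n - 1) \<ge> (int e + 1) * (int n + 1)"
  then have "0 < (int n - 2) * (2 * int e - 2 * int n - 1)"
    by (intro less_le_trans[OF _ conjunct2[OF *]]) simp
  then have "0 < 2 * int e - 2 * int n - 1" using * by (simp add: zero_less_mult_iff)
  then have "n < e" by linarith
  show "splitting_sequence n e (b_two n e)"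
    by (rule splitting_sequence_b_two) (use * \<open>n < e\<close> in auto)
  show "(normal_locus n e (b_two n e) :: (nat \<Rightarrow> 'a poly) set set) \<noteq> {}"
    by (rule normal_locus_b_two_nonempty) (use * \<open>n < e\<close> in auto)
  show "expected_dim TYPE('a) n e (b_two n e) < 0"
    unfolding expected_dim_def using * \<open>n < e\<close> by (simp add: expected_codim_b_two)
qed

end
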